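(* For every $\varepsilon>0$ there is a constant $c(\varepsilon)>0$, depending only on $\varepsilon$, such that the following holds. If $\Omega\subset\bar{\mathbf C}$ is an $(\varepsilon)$ John domain, then there is a $(c(\varepsilon))$ John domain $\Omega'\subset\bar{\mathbf C}$ such that $\Omega'$ is simply connected and $$\partial\Omega\subset\partial\Omega'.$$
   Context: John domain: let $\Omega$ be a domain (open connected set, with nonempty boundary) on the Riemann sphere $\bar{\mathbf C}$ and let $z_0\in\Omega$. For $\varepsilon>0$, $\Omega$ is an $(\varepsilon)$ John domain with center $z_0$ if for all $z_1\in\Omega$ there is an arc $\gamma\subset\Omega$ connecting $z_0$ to $z_1$ with $d(z)\ge\varepsilon\, d(z,z_1)$ for all $z\in\gamma$, where $d(z,z_1)$ is the chordal distance from $z$ to $z_1$ and $d(z)$ is the chordal distance from $z$ to $\partial\Omega$. $\Omega$ is an $(\varepsilon)$ John domain if this holds for some center $z_0\in\Omega$. Simply connected means simply connected as a subset of the Riemann sphere. *)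

theory Defs
  imports "HOL-Analysis.Analysis"
begin

text \<open>
  The Riemann sphere is the unit sphere of \<open>\<complex> \<times> \<real>\<close>, a copy of Euclidean 3-space; the chordal
  distance is then the ambient distance \<^const>\<open>dist\<close>. The map \<open>stereo\<close> below is not used in the
  later definitions: it identifies this model with \<open>\<complex> \<union> {\<infinity>}\<close> (\<open>None\<close> being the point at
  infinity) and shows that \<^const>\<open>dist\<close> is given by the usual chordal formulas.
\<close>

definition riemann_sphere :: "(complex \<times> real) set" where
  "riemann_sphere = sphere 0 1"

fun stereo :: "complex option \<Rightarrow> complex \<times> real" where
  "stereo None = (0, 1)"
| "stereo (Some z) = ((2 / (1 + (cmod z)\<^sup>2)) *\<^sub>R z, ((cmod z)\<^sup>2 - 1) / ((cmod z)\<^sup>2 + 1))"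

lemma mem_riemann_sphere_iff: "(u, t) \<in> riemann_sphere \<longleftrightarrow> (cmod u)\<^sup>2 + t\<^sup>2 = 1"
  by (simp add: riemann_sphere_def norm_Pair)

lemma bij_betw_stereo: "bij_betw stereo UNIV riemann_sphere"
proof (rule bij_betwI[where g = "\<lambda>(u, t). if t = 1 then None else Some ((1 / (1 - t)) *\<^sub>R u)"])
  have pos: "1 + (cmod z)\<^sup>2 > 0" for z by (smt (verit) zero_le_power2)
  show "stereo \<in> UNIV \<rightarrow> riemann_sphere"
  proof
    fix p show "stereo p \<in> riemann_sphere"
    proof (cases p)
      case (Some z)
      have "(2 / (1 + a) * c)\<^sup>2 + ((a - 1) / (a + 1))\<^sup>2 = 1" if "a = c\<^sup>2" "1 + a > 0" for a c :: real
      proof -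
        have "(2 / (1 + a) * c)\<^sup>2 + ((a - 1) / (a + 1))\<^sup>2 = (4 * a + (a - 1)\<^sup>2) / (1 + a)\<^sup>2"
          using that by (simp add: power_mult_distrib power_divide add_divide_distrib add.commute)
        also have "4 * a + (a - 1)\<^sup>2 = (1 + a)\<^sup>2" by (simp add: power2_eq_square algebra_simps)
        finally show ?thesis using that(2) by simp
      qed
      from this[OF refl pos[of z]] show ?thesis
        using Some pos[of z] by (simp add: mem_riemann_sphere_iff)
    qed (simp add: mem_riemann_sphere_iff)
  qed
  show "(\<lambda>(u, t). if t = 1 then None else Some ((1 / (1 - t)) *\<^sub>R u)) \<in> riemann_sphere \<rightarrow> UNIV"
    by simp
  show "(case stereo p of (u, t) \<Rightarrow> if t = 1 then None else Some ((1 / (1 - t)) *\<^sub>R u)) = p" for p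
  proof (cases p)
    case (Some z)
    have "((cmod z)\<^sup>2 - 1) / ((cmod z)\<^sup>2 + 1) \<noteq> 1"
      and "1 - ((cmod z)\<^sup>2 - 1) / ((cmod z)\<^sup>2 + 1) = 2 / (1 + (cmod z)\<^sup>2)"
      using pos[of z] by (simp_all add: field_simps)
    moreover have "(1 / (2 / (1 + (cmod z)\<^sup>2))) * (2 / (1 + (cmod z)\<^sup>2)) = 1"
      using pos[of z] by simp
    ultimately show ?thesis using Some by (simp only: stereo.simps prod.case if_False scaleR_scaleR scaleR_one)
  qed simp
  show "stereo (case q of (u, t) \<Rightarrow> if t = 1 then None else Some ((1 / (1 - t)) *\<^sub>R u)) = q"
    if "q \<in> riemann_sphere" for q
  proof -
    obtain u t where q: "q = (u, t)" by (cases q)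
    with that have eq: "(cmod u)\<^sup>2 = 1 - t\<^sup>2" by (simp add: mem_riemann_sphere_iff)
    show ?thesis
    proof (cases "t = 1")
      case True
      with eq q show ?thesis by simp
    next
      case False
      have "(cmod ((1 / (1 - t)) *\<^sub>R u))\<^sup>2 = (1 - t\<^sup>2) / (1 - t)\<^sup>2"
        by (simp add: power_divide eq)
      also have "\<dots> = (1 + t) / (1 - t)"
        using False by (simp add: power2_eq_square divide_simps) (simp add: algebra_simps)
      finally have n: "(cmod ((1 / (1 - t)) *\<^sub>R u))\<^sup>2 = (1 + t) / (1 - t)" .
      have "2 / (1 + (1 + t) / (1 - t)) = 1 - t"
        "((1 + t) / (1 - t) - 1) / ((1 + t) / (1 - t) + 1) = t"
        using False by (simp_all add: field_simps)
      with n False q show ?thesis by (simp del: norm_scaleR)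
    qed
  qed
qed

lemma dist_stereo_infinity: "dist (stereo (Some z)) (stereo None) = 2 / sqrt (1 + (cmod z)\<^sup>2)"
proof -
  define a where "a = (cmod z)\<^sup>2"
  have a: "a \<ge> 0" by (simp add: a_def)
  have "(dist (stereo (Some z)) (stereo None))\<^sup>2 = 4 * a / (1 + a)\<^sup>2 + ((a - 1) / (a + 1) - 1)\<^sup>2"
    using a by (simp add: dist_norm norm_Pair power_mult_distrib power_divide a_def)
  also have "(a - 1) / (a + 1) - 1 = - 2 / (1 + a)" using a by (simp add: field_simps)
  also have "4 * a / (1 + a)\<^sup>2 + (- 2 / (1 + a))\<^sup>2 = 4 * (1 + a) / (1 + a)\<^sup>2"
    by (simp add: power_divide add_divide_distrib algebra_simps)
  also have "\<dots> = 4 / (1 + a)" using a by (simp add: power2_eq_square divide_simps)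
  also have "\<dots> = (2 / sqrt (1 + a))\<^sup>2" using a by (simp add: power_divide)
  finally show ?thesis
    using a unfolding a_def[symmetric] by (simp add: power2_eq_iff_nonneg)
qed

lemma dist_stereo:
  "dist (stereo (Some z)) (stereo (Some w))
     = 2 * cmod (z - w) / (sqrt (1 + (cmod z)\<^sup>2) * sqrt (1 + (cmod w)\<^sup>2))"
proof -
  define a b c where "a = (cmod z)\<^sup>2" and "b = (cmod w)\<^sup>2" and "c = z \<bullet> w"
  have ab: "a \<ge> 0" "b \<ge> 0" by (simp_all add: a_def b_def)
  have n: "(cmod (r *\<^sub>R z - s *\<^sub>R w))\<^sup>2 = r\<^sup>2 * a + s\<^sup>2 * b - 2 * r * s * c" for r s
    unfolding a_def b_def c_def power2_norm_eq_inner
    by (simp add: inner_diff inner_commute power2_eq_square algebra_simps)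
  have "(dist (stereo (Some z)) (stereo (Some w)))\<^sup>2 =
      (2 / (1 + a))\<^sup>2 * a + (2 / (1 + b))\<^sup>2 * b - 2 * (2 / (1 + a)) * (2 / (1 + b)) * c
      + ((a - 1) / (a + 1) - (b - 1) / (b + 1))\<^sup>2"
    using n[of "2 / (1 + a)" "2 / (1 + b)"]
    by (simp only: dist_norm stereo.simps diff_Pair norm_Pair a_def[symmetric] b_def[symmetric])
       (metis add_nonneg_nonneg real_norm_def power2_abs real_sqrt_pow2 zero_le_power2)
  also have "(a - 1) / (a + 1) - (b - 1) / (b + 1) = 2 * (a - b) / ((1 + a) * (1 + b))"
    using ab by (simp add: divide_simps) (simp add: algebra_simps)
  also have "(2 / (1 + a))\<^sup>2 * a + (2 / (1 + b))\<^sup>2 * b - 2 * (2 / (1 + a)) * (2 / (1 + b)) * c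
      + (2 * (a - b) / ((1 + a) * (1 + b)))\<^sup>2 = 4 * (a + b - 2 * c) / ((1 + a) * (1 + b))"
  proof -
    have nz: "1 + a \<noteq> 0" "1 + b \<noteq> 0" using ab by auto
    show ?thesis using nz
      by (simp add: divide_simps power2_eq_square) (simp add: algebra_simps)
  qed
  also have "a + b - 2 * c = (cmod (z - w))\<^sup>2" using n[of 1 1] by simp
  also have "4 * (cmod (z - w))\<^sup>2 / ((1 + a) * (1 + b))
      = (2 * cmod (z - w) / (sqrt (1 + a) * sqrt (1 + b)))\<^sup>2"
    using ab by (simp add: power_divide power_mult_distrib)
  finally show ?thesis
    using ab unfolding a_def[symmetric] b_def[symmetric] by (simp add: power2_eq_iff_nonneg)
qed

text \<open>Boundaries are taken in the topology of the sphere, not in the ambient 3-space.\<close>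

definition sphere_boundary :: "(complex \<times> real) set \<Rightarrow> (complex \<times> real) set" where
  "sphere_boundary \<Omega> = top_of_set riemann_sphere frontier_of \<Omega>"

definition sphere_domain :: "(complex \<times> real) set \<Rightarrow> bool" where
  "sphere_domain \<Omega> \<longleftrightarrow>
     openin (top_of_set riemann_sphere) \<Omega> \<and> connected \<Omega> \<and> sphere_boundary \<Omega> \<noteq> {}"

text \<open>
  For \<open>z1 = z0\<close> the connecting arc degenerates to a point and the John inequality is trivial.
  Since \<^const>\<open>arc\<close> means an injective path, which cannot join a point to itself, this case
  is left out.
\<close>

definition John_domain_center :: "real \<Rightarrow> (complex \<times> real) set \<Rightarrow> complex \<times> real \<Rightarrow> bool" where
  "John_domain_center \<epsilon> \<Omega> z0 \<longleftrightarrow>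
     sphere_domain \<Omega> \<and> z0 \<in> \<Omega> \<and>
     (\<forall>z1 \<in> \<Omega> - {z0}. \<exists>\<gamma>. arc \<gamma> \<and> path_image \<gamma> \<subseteq> \<Omega> \<and> pathstart \<gamma> = z0 \<and> pathfinish \<gamma> = z1 \<and>
        (\<forall>z \<in> path_image \<gamma>. infdist z (sphere_boundary \<Omega>) \<ge> \<epsilon> * dist z z1))"

definition John_domain :: "real \<Rightarrow> (complex \<times> real) set \<Rightarrow> bool" where
  "John_domain \<epsilon> \<Omega> \<longleftrightarrow> (\<exists>z0 \<in> \<Omega>. John_domain_center \<epsilon> \<Omega> z0)"

end

theory Submission
  imports Defs "HOL-Complex_Analysis.Riemann_Mapping"
begin

text \<open>
  Stereographic projection with the John centre at infinity, suitably scaled, turns \<open>\<Omega>\<close> into the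
  complement of a compact set \<open>K\<close> in a small disc, the chordal metric being a weighted Euclidean
  metric whose weights are comparable on the relevant set. Decompose the box \<open>[-1, 1]\<^sup>2\<close> minus \<open>K\<close>
  into Whitney squares, let a square of side \<open>2\<^sup>-\<^sup>k\<close> cost \<open>2\<^sup>k\<close>, and join every square to the
  exterior of the box by a cheapest chain of edge-adjacent squares. These chains form a tree, and
  opening only the doors between a square and its parent in the tree gives \<open>\<Omega>'\<close>.

  The John arcs of \<open>\<Omega>\<close> meet boundedly many Whitney squares of each size, so the distance \<open>D(Q)\<close> of
  a square \<open>Q\<close> to the root is comparable to the inverse of its side. If \<open>A\<close> is the parent of \<open>Q\<close>, the
  side of \<open>Q\<close> is therefore at most a constant times \<open>1/D(A) - 1/D(Q)\<close>; this telescopes along the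
  tree and shows that its branches are John arcs. The set \<open>\<Omega>'\<close> is simply connected because continuous
  logarithms can be chosen on the squares and adjusted successively along the tree.
\<close>

section \<open>Dyadic squares\<close>

text \<open>John arcs of different points need not fit together: two of them may enclose a piece of
  the complement, so a simply connected subdomain needs one consistent choice of routes. A tree of
  cheapest routes is consistent, but its branches are no longer the given arcs, and the John
  property must be read off from the distance \<open>Dst\<close> alone. Counting squares would not
  suffice, since the number of squares in a chain says little about their sizes. With the price 2^k
  a single square much smaller than the end Q already costs more than the bound for
  \<open>Dst\<close>, so cheapest chains avoid such squares. The given arcs serve only for the upper
  bound of \<open>Dst\<close>; the lower bound is the price of the last square. The boundary
  survives because no Whitney square is dropped: only walls are added, and squares accumulate at
  every boundary point. A further obstacle is that an arc may pass from square to square through a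
  corner, where no door can be opened. Arcs are therefore thickened to open sets, from which the
  countably many corners can be removed without disconnecting them.\<close>

type_synonym dyadic = "nat \<times> int \<times> int"

text \<open>The lower left corner is (i, j) / 2^k. Levels are natural numbers, so no side exceeds
  1.\<close>

fun dsq :: "dyadic \<Rightarrow> complex set" where
  "dsq (k, i, j) = {z. of_int i \<le> 2^k * Re z \<and> 2^k * Re z \<le> of_int i + 1 \<and>
                       of_int j \<le> 2^k * Im z \<and> 2^k * Im z \<le> of_int j + 1}"

fun osq :: "dyadic \<Rightarrow> complex set" where
  "osq (k, i, j) = {z. of_int i < 2^k * Re z \<and> 2^k * Re z < of_int i + 1 \<and>
                       of_int j < 2^k * Im z \<and> 2^k * Im z < of_int j + 1}"

definition side :: "dyadic \<Rightarrow> real" where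
  "side Q = 1 / 2 ^ fst Q"

fun cen :: "dyadic \<Rightarrow> complex" where
  "cen (k, i, j) = Complex ((i + 1/2) / 2^k) ((j + 1/2) / 2^k)"

lemma side_pos [simp]: "side Q > 0" and side_le_1: "side Q \<le> 1"
  by (simp_all add: side_def)

lemma osq_subset_dsq: "osq Q \<subseteq> dsq Q"
  by (cases Q) auto

lemma open_osq: "open (osq Q)"
proof (cases Q)
  case (fields k i j)
  have "open {z. real_of_int i < 2^k * Re z}" "open {z. 2^k * Re z < of_int i + 1}"
       "open {z. real_of_int j < 2^k * Im z}" "open {z. 2^k * Im z < of_int j + 1}"
    by (intro open_Collect_less continuous_intros)+
  then have "open ({z. real_of_int i < 2^k * Re z} \<inter> {z. 2^k * Re z < of_int i + 1} \<inter>
       {z. real_of_int j < 2^k * Im z} \<inter> {z. 2^k * Im z < of_int j + 1})"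
    by (intro open_Int)
  then show ?thesis unfolding fields osq.simps by (rule back_subst[where P = "open"]) auto
qed

lemma closed_dsq: "closed (dsq Q)"
proof (cases Q)
  case (fields k i j)
  have "closed {z. real_of_int i \<le> 2^k * Re z}" "closed {z. 2^k * Re z \<le> of_int i + 1}"
       "closed {z. real_of_int j \<le> 2^k * Im z}" "closed {z. 2^k * Im z \<le> of_int j + 1}"
    by (intro closed_Collect_le continuous_intros)+
  then have "closed ({z. real_of_int i \<le> 2^k * Re z} \<inter> {z. 2^k * Re z \<le> of_int i + 1} \<inter>
       {z. real_of_int j \<le> 2^k * Im z} \<inter> {z. 2^k * Im z \<le> of_int j + 1})"
    by (intro closed_Int)
  then show ?thesis unfolding fields dsq.simps by (rule back_subst[where P = "closed"]) auto
qed

lemma between_mix: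
  fixes a b s l :: real
  assumes "l \<le> a" "l < b" "0 < s" "s \<le> 1"
  shows "l < (1 - s) * a + s * b"
proof -
  have "(1 - s) * l \<le> (1 - s) * a" "s * l < s * b"
    using assms by (auto intro: mult_left_mono)
  then show ?thesis by (simp add: algebra_simps)
qed

lemma between_mix':
  fixes a b s l :: real
  assumes "a \<le> l" "b < l" "0 < s" "s \<le> 1"
  shows "(1 - s) * a + s * b < l"
  using between_mix[of "-l" "-a" "-b" s] assms by (simp add: algebra_simps)

text \<open>Positive weight on a strict inequality makes the convex combination strict. This gives
  both the density of \<open>osq Q\<close> in \<open>dsq Q\<close> and the star shape of a square
  about a door in its boundary.\<close>

lemma osq_mix:
  assumes "m \<in> dsq Q" "y \<in> osq Q" "0 < s" "s \<le> 1"
  shows "(1 - s) *\<^sub>R m + s *\<^sub>R y \<in> osq Q"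
proof (cases Q)
  case (fields k i j)
  have e: "2^k * ((1 - s) * a + s * b) = (1 - s) * (2^k * a) + s * (2^k * b)" for a b :: real
    by (simp add: algebra_simps)
  show ?thesis using assms unfolding fields
    by (simp add: e between_mix between_mix')
qed

lemma convex_osq: "convex (osq Q)"
  unfolding convex_alt
proof (intro ballI allI impI)
  fix x y u assume a: "x \<in> osq Q" "y \<in> osq Q" "0 \<le> u \<and> u \<le> (1::real)"
  show "(1 - u) *\<^sub>R x + u *\<^sub>R y \<in> osq Q"
  proof (cases "u = 0")
    case False
    with a osq_subset_dsq[of Q] show ?thesis by (intro osq_mix) auto
  qed (use a in simp)
qed

lemma cen_mem_osq: "cen Q \<in> osq Q"
  by (cases Q) auto

lemma ball_subset_coords:
  assumes "z \<in> ball c r"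
  shows "\<bar>Re z - Re c\<bar> < r \<and> \<bar>Im z - Im c\<bar> < r"
proof -
  have "cmod (z - c) < r" using assms by (simp add: dist_norm norm_minus_commute)
  moreover have "\<bar>Re z - Re c\<bar> \<le> cmod (z - c)" using abs_Re_le_cmod[of "z - c"] by simp
  moreover have "\<bar>Im z - Im c\<bar> \<le> cmod (z - c)" using abs_Im_le_cmod[of "z - c"] by simp
  ultimately show ?thesis by linarith
qed

lemma ball_cen_subset: "ball (cen Q) (side Q / 2) \<subseteq> osq Q"
proof
  fix z assume z: "z \<in> ball (cen Q) (side Q / 2)"
  obtain k i j where Q: "Q = (k, i, j)" by (cases Q)
  have p: "(2::real)^k > 0" by simp
  have "\<bar>Re z - (i + 1/2) / 2^k\<bar> < 1 / 2^k / 2" "\<bar>Im z - (j + 1/2) / 2^k\<bar> < 1 / 2^k / 2"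
    using ball_subset_coords[OF z] by (auto simp: Q side_def)
  then have "2^k * \<bar>Re z - (i + 1/2) / 2^k\<bar> < 2^k * (1 / 2^k / 2)"
     "2^k * \<bar>Im z - (j + 1/2) / 2^k\<bar> < 2^k * (1 / 2^k / 2)"
    by (simp_all only: mult_less_cancel_left_pos[OF p])
  moreover have "2^k * \<bar>t - (l + 1/2) / 2^k\<bar> = \<bar>2^k * t - (l + 1/2)\<bar>" for t l :: real
  proof -
    have "2^k * \<bar>t - (l + 1/2) / 2^k\<bar> = \<bar>2^k * (t - (l + 1/2) / 2^k)\<bar>" by (simp add: abs_mult)
    also have "2^k * (t - (l + 1/2) / 2^k) = 2^k * t - (l + 1/2)" by (simp add: field_simps)
    finally show ?thesis .
  qed
  ultimately have "\<bar>2^k * Re z - (i + 1/2)\<bar> < 1/2" "\<bar>2^k * Im z - (j + 1/2)\<bar> < 1/2"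
    by simp_all
  then show "z \<in> osq Q"
    unfolding Q osq.simps mem_Collect_eq by linarith
qed

lemma dsq_coords_cen:
  assumes "z \<in> dsq Q"
  shows "\<bar>Re z - Re (cen Q)\<bar> \<le> side Q / 2" "\<bar>Im z - Im (cen Q)\<bar> \<le> side Q / 2"
proof -
  obtain k i j where Q: "Q = (k, i, j)" by (cases Q)
  have p: "(2::real)^k > 0" by simp
  have *: "\<bar>t - (l + 1/2) / 2^k\<bar> \<le> 1 / 2^k / 2" if "l \<le> 2^k * t" "2^k * t \<le> l + 1" for t l :: real
  proof -
    have "t - (l + 1/2) / 2^k = (2^k * t - (l + 1/2)) / 2^k" by (simp add: field_simps)
    moreover have "\<bar>2^k * t - (l + 1/2)\<bar> \<le> 1/2" using that by linarith
    ultimately show ?thesis using p by (simp add: field_simps)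
  qed
  show "\<bar>Re z - Re (cen Q)\<bar> \<le> side Q / 2" "\<bar>Im z - Im (cen Q)\<bar> \<le> side Q / 2"
    using assms * by (auto simp: Q side_def)
qed

lemma dist_cen: "z \<in> dsq Q \<Longrightarrow> dist z (cen Q) \<le> side Q"
  using dsq_coords_cen[of z Q] cmod_le[of "z - cen Q"] by (simp add: dist_norm)

lemma dist_dsq: "z \<in> dsq Q \<Longrightarrow> w \<in> dsq Q \<Longrightarrow> dist z w \<le> 2 * side Q"
  using dist_cen[of z Q] dist_cen[of w Q] dist_triangle2[of z w "cen Q"] by simp

lemma dsq_subset_closure: "dsq Q \<subseteq> closure (osq Q)"
proof
  fix x assume x: "x \<in> dsq Q"
  show "x \<in> closure (osq Q)"
    unfolding closure_approachable
  proof (intro allI impI)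
    fix e :: real assume e: "e > 0"
    define s where "s = min 1 (e/2)"
    define y where "y = (1 - s) *\<^sub>R x + s *\<^sub>R cen Q"
    have s: "0 < s" "s \<le> 1" "s < e" using e by (auto simp: s_def)
    have "y - x = s *\<^sub>R (cen Q - x)" by (simp add: y_def algebra_simps)
    then have "dist y x = s * dist x (cen Q)"
      using s by (simp add: dist_norm norm_minus_commute)
    also have "\<dots> \<le> s * 1"
      using dist_cen[OF x] side_le_1[of Q] s by (intro mult_left_mono) linarith+
    finally have "dist y x < e" using s by simp
    moreover have "y \<in> osq Q" unfolding y_def using osq_mix[OF x cen_mem_osq s(1,2)] .
    ultimately show "\<exists>y\<in>osq Q. dist y x < e" by blast
  qed
qed

lemma open_meets_osq: "open U \<Longrightarrow> x \<in> U \<Longrightarrow> x \<in> dsq Q \<Longrightarrow> \<exists>y \<in> U. y \<in> osq Q"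
  using dsq_subset_closure[of Q] open_Int_closure_eq_empty[of U "osq Q"] by blast

text \<open>Scaled to level l, the ends of the coarse interval are integers, and an integer below i
  + 1 is at most i. The point is interior to the coarse interval but may be an endpoint of the fine
  one.\<close>

lemma dyadic_nested:
  fixes x :: real and a i :: int
  assumes "k \<le> l" "a < 2^k * x" "2^k * x < of_int a + 1" "i \<le> 2^l * x" "2^l * x \<le> of_int i + 1"
  shows "a * 2^(l-k) \<le> i" "i + 1 \<le> (a + 1) * 2^(l-k)"
proof -
  define q where "q = (2::int)^(l-k)"
  have q: "(2::real)^l = of_int q * 2^k" using assms(1) by (simp add: q_def flip: power_add)
  have qp: "real_of_int q > 0" by (simp add: q_def)
  have "of_int q * a < of_int q * (2^k * x)" "of_int q * (2^k * x) < of_int q * (a + 1)"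
    using assms qp by simp_all
  then have "real_of_int (q * a) < i + 1" "real_of_int i < of_int (q * (a + 1))"
    using assms(4,5) unfolding q by (simp_all add: algebra_simps)
  then have "q * a < i + 1" "i < q * (a+1)" by linarith+
  then show "a * 2^(l-k) \<le> i" "i + 1 \<le> (a + 1) * 2^(l-k)" unfolding q_def[symmetric]
    by (simp_all add: mult.commute)
qed

lemma dyadic_interval_subset:
  fixes x :: real and a i :: int
  assumes "k \<le> l" "a * 2^(l-k) \<le> i" "i + 1 \<le> (a + 1) * 2^(l-k)" "i \<le> 2^l * x" "2^l * x \<le> of_int i + 1"
  shows "a \<le> 2^k * x" "2^k * x \<le> of_int a + 1"
proof -
  define q where "q = (2::int)^(l-k)"
  have q: "(2::real)^l = of_int q * 2^k" using assms(1) by (simp add: q_def flip: power_add)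
  have qp: "real_of_int q > 0" by (simp add: q_def)
  have "real_of_int (a * q) \<le> i" "real_of_int (i+1) \<le> of_int ((a+1)*q)"
    using assms(2,3) unfolding q_def of_int_le_iff by simp_all
  moreover have e: "of_int q * (2^k * x) = 2^l * x" by (simp add: q)
  ultimately have "real_of_int q * a \<le> of_int q * (2^k * x)"
    "of_int q * (2^k * x) \<le> of_int q * of_int (a + 1)"
    using assms(4,5) unfolding e by (simp_all add: mult.commute)
  then have "a \<le> 2^k * x" "2^k * x \<le> of_int (a + 1)"
    by (simp_all only: mult_le_cancel_left_pos[OF qp])
  then show "a \<le> 2^k * x" "2^k * x \<le> of_int a + 1" by simp_all
qed

definition dyadics :: "real set" where
  "dyadics = (\<lambda>(k::nat, i::int). i / 2^k) ` UNIV"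

lemma dyadicsI: "2^k * x = of_int i \<Longrightarrow> x \<in> dyadics"
  unfolding dyadics_def by (rule image_eqI[of _ _ "(k, i)"]) (auto simp: field_simps)

text \<open>Two Whitney squares that touch at a point outside this countable set share an edge of the smaller one.\<close>

definition corners :: "complex set" where
  "corners = {z. Re z \<in> dyadics \<and> Im z \<in> dyadics}"

lemma countable_corners: "countable corners"
proof -
  have "countable dyadics" by (simp add: dyadics_def)
  then have "countable ((\<lambda>(x,y). Complex x y) ` (dyadics \<times> dyadics))"
    by blast
  moreover have "corners \<subseteq> (\<lambda>(x,y). Complex x y) ` (dyadics \<times> dyadics)"
  proof
    fix z assume "z \<in> corners"
    then show "z \<in> (\<lambda>(x,y). Complex x y) ` (dyadics \<times> dyadics)"
      by (intro image_eqI[of _ _ "(Re z, Im z)"]) (simp_all add: corners_def)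
  qed
  ultimately show ?thesis by (rule countable_subset[rotated])
qed

lemma nondyadic_strict:
  assumes "x \<notin> dyadics" "of_int i \<le> 2^k * x" "2^k * x \<le> of_int i + 1"
  shows "of_int i < 2^k * x \<and> 2^k * x < of_int i + 1"
proof -
  have "2^k * x \<noteq> of_int i" using dyadicsI assms(1) by blast
  moreover have "2^k * x \<noteq> of_int i + 1" using dyadicsI[of k x "i+1"] assms(1) by auto
  ultimately show ?thesis using assms by linarith
qed

lemma dsq_nested:
  assumes "x \<in> osq (k,a,b)" "x \<in> dsq (l,i,j)" "k \<le> l"
  shows "a * 2^(l-k) \<le> i \<and> i + 1 \<le> (a + 1) * 2^(l-k) \<and> b * 2^(l-k) \<le> j \<and> j + 1 \<le> (b + 1) * 2^(l-k)"
  using assms dyadic_nested[of k l a "Re x" i] dyadic_nested[of k l b "Im x" j] by auto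

lemma dsq_subset_index:
  assumes "a * 2^(l-k) \<le> i" "i + 1 \<le> (a + 1) * 2^(l-k)" "b * 2^(l-k) \<le> j" "j + 1 \<le> (b + 1) * 2^(l-k)" "k \<le> l"
  shows "dsq (l,i,j) \<subseteq> dsq (k,a,b)"
  using assms dyadic_interval_subset[of k l a i] dyadic_interval_subset[of k l b j] by auto

lemma dsq_nested_subset:
  assumes "x \<in> osq P" "x \<in> dsq Q" "fst P \<le> fst Q"
  shows "dsq Q \<subseteq> dsq P"
proof -
  obtain k a b l i j where "P = (k,a,b)" "Q = (l,i,j)" by (metis prod_cases3)
  then show ?thesis using dsq_nested[of x k a b l i j] assms dsq_subset_index[of a l k i b j] by simp
qed

lemma dsq_same_level:
  assumes "x \<in> osq P" "x \<in> dsq Q" "fst P = fst Q"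
  shows "P = Q"
proof -
  obtain k a b l i j where "P = (k,a,b)" "Q = (l,i,j)" by (metis prod_cases3)
  then show ?thesis using dsq_nested[of x k a b l i j] assms by simp
qed

section \<open>Dyadic squares in the box [-1, 1]^2\<close>

definition open_box :: "complex set" where "open_box = {z. \<bar>Re z\<bar> < 1 \<and> \<bar>Im z\<bar> < 1}"
definition closed_box :: "complex set" where "closed_box = {z. \<bar>Re z\<bar> \<le> 1 \<and> \<bar>Im z\<bar> \<le> 1}"

fun inbox :: "dyadic \<Rightarrow> bool" where
  "inbox (k,i,j) \<longleftrightarrow> - (2^k) \<le> i \<and> i < 2^k \<and> - (2^k) \<le> j \<and> j < 2^k"

lemma open_open_box: "open open_box"
proof -
  have "open ({z. \<bar>Re z\<bar> < 1} \<inter> {z. \<bar>Im z\<bar> < 1})"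
    by (intro open_Int open_Collect_less continuous_intros)
  then show ?thesis unfolding open_box_def by (rule back_subst[where P="open"]) auto
qed

lemma closed_closed_box: "closed closed_box"
proof -
  have "closed ({z. \<bar>Re z\<bar> \<le> 1} \<inter> {z. \<bar>Im z\<bar> \<le> 1})"
    by (intro closed_Int closed_Collect_le continuous_intros)
  then show ?thesis unfolding closed_box_def by (rule back_subst[where P="closed"]) auto
qed

lemma closed_box_norm: "z \<in> closed_box \<Longrightarrow> cmod z \<le> 2"
  using cmod_le[of z] by (simp add: closed_box_def)

lemma inbox_coord:
  fixes t :: real and l :: int
  assumes "- (2^k) \<le> l" "l < 2^k" "of_int l \<le> 2^k * t" "2^k * t \<le> of_int l + 1"
  shows "\<bar>t\<bar> \<le> 1"
proof -
  have p: "(2::real)^k > 0" by simp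
  have "real_of_int (- (2^k)) \<le> l" "real_of_int (l + 1) \<le> of_int (2^k)"
    using assms(1,2) unfolding of_int_le_iff by auto
  then have "- (2^k) \<le> real_of_int l" "real_of_int l + 1 \<le> 2^k"
    by simp_all
  then have "2^k * (-1) \<le> 2^k * t" "2^k * t \<le> 2^k * 1"
    using assms(3,4) by linarith+
  then have "-1 \<le> t" "t \<le> 1"
    by (simp_all only: mult_le_cancel_left_pos[OF p])
  then show ?thesis by simp
qed

lemma inbox_subset: "inbox Q \<Longrightarrow> dsq Q \<subseteq> closed_box"
  by (cases Q) (auto simp: closed_box_def dest: inbox_coord)

lemma inbox_parent:
  assumes "inbox (Suc k, i, j)"
  shows "inbox (k, i div 2, j div 2)" "dsq (Suc k,i,j) \<subseteq> dsq (k, i div 2, j div 2)"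
proof -
  define p where "p = (2::int)^k"
  have "- (2 * p) \<le> i" "i < 2*p" "- (2 * p) \<le> j" "j < 2*p" using assms by (simp_all add: p_def)
  then have "- p \<le> i div 2" "i div 2 < p" "- p \<le> j div 2" "j div 2 < p" by presburger+
  then show "inbox (k, i div 2, j div 2)" by (simp add: p_def)
  show "dsq (Suc k,i,j) \<subseteq> dsq (k, i div 2, j div 2)"
  proof (rule dsq_subset_index)
    have "Suc k - k = 1" by simp
    moreover have "l div 2 * 2 \<le> l" "l + 1 \<le> (l div 2 + 1) * 2" for l :: int by presburger+
    ultimately show "i div 2 * 2 ^ (Suc k - k) \<le> i" "i + 1 \<le> (i div 2 + 1) * 2 ^ (Suc k - k)"
      "j div 2 * 2 ^ (Suc k - k) \<le> j" "j + 1 \<le> (j div 2 + 1) * 2 ^ (Suc k - k)"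
      by (simp_all only: power_one_right)
  qed simp
qed

lemma dyadic_coord_exists:
  fixes t :: real
  assumes "\<bar>t\<bar> \<le> 1"
  shows "\<exists>i::int. - ((2::int)^k) \<le> i \<and> i < (2::int)^k \<and> i \<le> 2^k * t \<and> 2^k * t \<le> of_int i + 1"
proof -
  have p: "(2::real)^k > 0" by simp
  have b: "- (2^k) \<le> 2^k * t" "2^k * t \<le> 2^k"
    using assms mult_left_mono[of t 1 "2^k"] mult_left_mono[of "-1" t "2^k"] by (simp_all add: abs_le_iff)
  show ?thesis
  proof (cases "t = 1")
    \<comment> \<open>At t = 1 the floor would give the interval just outside the box, hence the
      index 2^k - 1.\<close>
    case True
    have "(1::int) \<le> 2^k" by simp
    then have "- (2^k) \<le> (2^k - 1 :: int)" "(2^k - 1 :: int) < 2^k" by linarith+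
    with True show ?thesis by (intro exI[of _ "2^k - 1"] conjI) (auto simp del: One_nat_def)
  next
    case False
    then have "2^k * t < 2^k" using assms by simp
    then have "\<lfloor>2^k * t\<rfloor> < 2^k" by (simp add: floor_less_iff)
    moreover have "- (2^k) \<le> \<lfloor>2^k * t\<rfloor>" using b(1) by (simp add: le_floor_iff)
    ultimately show ?thesis by (intro exI[of _ "\<lfloor>2^k * t\<rfloor>"]) (simp add: floor_correct less_imp_le)
  qed
qed

lemma closed_box_dsq: assumes "x \<in> closed_box" shows "\<exists>Q. fst Q = k \<and> inbox Q \<and> x \<in> dsq Q"
proof -
  obtain i j :: int where "- ((2::int)^k) \<le> i \<and> i < (2::int)^k \<and> i \<le> 2^k * Re x \<and> 2^k * Re x \<le> of_int i + 1"
    "- ((2::int)^k) \<le> j \<and> j < (2::int)^k \<and> j \<le> 2^k * Im x \<and> 2^k * Im x \<le> of_int j + 1"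
    using dyadic_coord_exists[of "Re x" k] dyadic_coord_exists[of "Im x" k] assms by (auto simp: closed_box_def)
  then show ?thesis by (intro exI[of _ "(k,i,j)"]) simp
qed

section \<open>Whitney squares\<close>

declare dsq.simps [simp del] osq.simps [simp del] inbox.simps [simp del] cen.simps [simp del]

text \<open>The radius 1/2 keeps K inside the open box and bounds the distance to K on the box by 3,
  which lets level 0 serve as the coarsest level.\<close>

locale whitney_setup =
  fixes K :: "complex set"
  assumes compact_K: "compact K" and K_ne: "K \<noteq> {}" and K_small: "K \<subseteq> ball 0 (1/2)"
begin

abbreviation d :: "complex \<Rightarrow> real" where "d x \<equiv> infdist x K"

definition good :: "dyadic \<Rightarrow> bool" where
  "good Q \<longleftrightarrow> inbox Q \<and> (\<forall>x \<in> dsq Q. 4 * side Q \<le> d x)"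

text \<open>Maximality makes the interiors disjoint, by dyadic nesting, and bounds the distance to K
  from above, because the dyadic parent fails to be good.\<close>

definition whit :: "dyadic \<Rightarrow> bool" where
  "whit Q \<longleftrightarrow> good Q \<and> (\<forall>P. good P \<and> fst P < fst Q \<longrightarrow> \<not> dsq Q \<subseteq> dsq P)"

lemma whit_maximal: "whit Q \<Longrightarrow> good P \<Longrightarrow> fst P < fst Q \<Longrightarrow> \<not> dsq Q \<subseteq> dsq P"
  and whit_good: "whit Q \<Longrightarrow> good Q"
  unfolding whit_def by blast+

lemma whit_subset_box: "whit Q \<Longrightarrow> dsq Q \<subseteq> closed_box"
  using inbox_subset by (auto simp: whit_def good_def)

lemma d_lip: "d x \<le> d y + dist x y"
  by (rule infdist_triangle)

lemma d_pos: "x \<notin> K \<Longrightarrow> d x > 0"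
  using compact_imp_closed[OF compact_K] K_ne infdist_pos_not_in_closed by blast

lemma whit_disjoint_open:
  assumes "whit P" "whit Q" "x \<in> osq P" "x \<in> osq Q"
  shows "P = Q"
proof -
  have *: "P = Q" if "whit P" "whit Q" "x \<in> osq P" "x \<in> osq Q" "fst P \<le> fst Q" for P Q
  proof (cases "fst P = fst Q")
    case True
    then show ?thesis using dsq_same_level that osq_subset_dsq by blast
  next
    case False
    then have "dsq Q \<subseteq> dsq P" using dsq_nested_subset that osq_subset_dsq by blast
    then show ?thesis using False that whit_maximal[of Q P] whit_good by simp
  qed
  show ?thesis using *[of P Q] *[of Q P] assms by (metis nat_le_linear)
qed

lemma whit_disjoint:
  assumes "whit P" "whit Q" "x \<in> osq P" "x \<in> dsq Q"
  shows "P = Q"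
  using open_meets_osq[OF open_osq assms(3,4)] whit_disjoint_open assms(1,2) by blast

lemma whit_cover:
  assumes "x \<in> closed_box" "x \<notin> K"
  shows "\<exists>Q. whit Q \<and> x \<in> dsq Q"
proof -
  \<comment> \<open>6 = 4 + 2: the margin asked of a good square plus the bound 2 * side for its
    diameter.\<close>
  obtain n where n: "(1/2::real)^n < d x / 6"
    using real_arch_pow_inv[of "d x / 6" "1/2"] d_pos[OF assms(2)] by auto
  obtain Q where Q: "fst Q = n" "inbox Q" "x \<in> dsq Q" using closed_box_dsq[OF assms(1)] by blast
  have "good Q"
    unfolding good_def
  proof (intro conjI ballI)
    fix y assume "y \<in> dsq Q"
    then have "d x \<le> d y + 2 * side Q" using d_lip[of x y] dist_dsq[OF Q(3)] by fastforce
    moreover have "6 * side Q < d x" using n by (simp add: side_def Q(1) power_one_over)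
    ultimately show "4 * side Q \<le> d y" by linarith
  qed fact
  with Q have "good Q \<and> x \<in> dsq Q" by simp
  from ex_has_least_nat[of "\<lambda>Q. good Q \<and> x \<in> dsq Q", OF this, of fst]
  obtain P where P: "good P \<and> x \<in> dsq P" and min: "\<forall>R. good R \<and> x \<in> dsq R \<longrightarrow> fst P \<le> fst R"
    by metis
  have "whit P"
    unfolding whit_def
  proof (intro conjI allI impI notI)
    fix R assume "good R \<and> fst R < fst P" "dsq P \<subseteq> dsq R"
    with P min[rule_format, of R] show False by auto
  qed (use P in simp)
  with P show ?thesis by blast
qed

lemma whit_lower: "whit Q \<Longrightarrow> x \<in> dsq Q \<Longrightarrow> 4 * side Q \<le> d x"
  by (auto simp: whit_def good_def)

text \<open>The dyadic parent P has a point y with d y < 4 * side P = 8 * side Q, and dist x y <= 2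
  * side P = 4 * side Q. A square of level 0 has no parent; there d x < 3 suffices.\<close>

lemma whit_upper:
  assumes "whit Q" "x \<in> dsq Q"
  shows "d x \<le> 12 * side Q"
proof -
  obtain k i j where Q: "Q = (k,i,j)" by (metis prod_cases3)
  obtain y0 where y0: "y0 \<in> K" using K_ne by blast
  have "cmod x \<le> 2" "cmod y0 < 1/2" using closed_box_norm whit_subset_box[OF assms(1)] assms(2) K_small y0 by auto
  then have d3: "d x < 3" using infdist_le[OF y0, of x] norm_triangle_ineq4[of x y0] by (simp add: dist_norm)
  show ?thesis
  proof (cases k)
    case 0
    then show ?thesis using d3 by (simp add: side_def Q)
  next
    case (Suc l)
    define P where "P = (l, i div 2, j div 2)"
    have P: "inbox P" "dsq Q \<subseteq> dsq P" "fst P < fst Q"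
      using inbox_parent[of l i j] assms(1) by (simp_all add: P_def Q Suc whit_def good_def)
    then have "\<not> good P" using assms(1) whit_maximal by blast
    then obtain y where y: "y \<in> dsq P" "d y < 4 * side P" using P(1) by (auto simp: good_def not_le)
    have "side P = 2 * side Q" by (simp add: side_def P_def Q Suc)
    moreover have "dist x y \<le> 2 * side P" using dist_dsq y(1) P(2) assms(2) by blast
    ultimately show ?thesis using d_lip[of x y] y(2) by simp
  qed
qed

lemma whit_side_comparable:
  assumes "whit P" "whit Q" "x \<in> dsq P" "x \<in> dsq Q"
  shows "side P \<le> 3 * side Q"
  using whit_lower[OF assms(1,3)] whit_upper[OF assms(2,4)] by simp

lemma whit_not_K: "whit Q \<Longrightarrow> dsq Q \<inter> K = {}"
  using whit_lower[of Q] side_pos[of Q] by (metis disjoint_iff infdist_zero linorder_not_le mult_pos_pos zero_less_numeral)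

end

section \<open>Doors between neighbouring squares\<close>

lemma half_edge_v:
  shows "\<exists>m. m \<in> dsq (l,i,j) \<and> m \<in> dsq (l,i-1,j) \<and> Re m = i / 2^l \<and>
     ball m (1 / 2^l / 2) \<subseteq> dsq (l,i,j) \<union> dsq (l,i-1,j)"
proof (intro exI conjI)
  let ?m = "Complex (i / 2^l) ((j + 1/2) / 2^l)"
  show "?m \<in> dsq (l,i,j)" "?m \<in> dsq (l,i-1,j)" "Re ?m = i / 2^l" by (simp_all add: dsq.simps)
  show "ball ?m (1 / 2^l / 2) \<subseteq> dsq (l,i,j) \<union> dsq (l,i-1,j)"
  proof
    fix z assume z: "z \<in> ball ?m (1 / 2^l / 2)"
    have s: "\<bar>2^l * t - c\<bar> < 1/2" if "\<bar>t - c / 2^l\<bar> < 1 / 2^l / 2" for t c :: real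
    proof -
      have "\<bar>2^l * t - c\<bar> = 2^l * \<bar>t - c / 2^l\<bar>"
      proof -
        have "2^l * \<bar>t - c / 2^l\<bar> = \<bar>2^l * (t - c / 2^l)\<bar>" by (simp add: abs_mult)
        also have "2^l * (t - c / 2^l) = 2^l * t - c" by (simp add: field_simps)
        finally show ?thesis by simp
      qed
      also have "\<dots> < 2^l * (1 / 2^l / 2)" using that by (intro mult_strict_left_mono) auto
      finally show ?thesis by simp
    qed
    have c: "\<bar>Re z - i / 2^l\<bar> < 1 / 2^l / 2" "\<bar>Im z - (j + 1/2) / 2^l\<bar> < 1 / 2^l / 2"
      using ball_subset_coords[OF z] by simp_all
    have "\<bar>2^l * Re z - i\<bar> < 1/2" "\<bar>2^l * Im z - (j + 1/2)\<bar> < 1/2"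
      by (rule s[OF c(1)], rule s[OF c(2)])
    then show "z \<in> dsq (l,i,j) \<union> dsq (l,i-1,j)"
      unfolding dsq.simps Un_iff mem_Collect_eq of_int_diff of_int_1 by linarith
  qed
qed

text \<open>Reflection in the diagonal reduces horizontal edges to vertical ones.\<close>

lemma dsq_swap: "Complex (Im z) (Re z) \<in> dsq (l,i,j) \<longleftrightarrow> z \<in> dsq (l,j,i)"
  by (auto simp: dsq.simps)

lemma half_edge_h:
  shows "\<exists>m. m \<in> dsq (l,i,j) \<and> m \<in> dsq (l,i,j-1) \<and> Im m = j / 2^l \<and>
     ball m (1 / 2^l / 2) \<subseteq> dsq (l,i,j) \<union> dsq (l,i,j-1)"
proof -
  obtain m where m: "m \<in> dsq (l,j,i)" "m \<in> dsq (l,j-1,i)" "Re m = j / 2^l"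
     "ball m (1 / 2^l / 2) \<subseteq> dsq (l,j,i) \<union> dsq (l,j-1,i)"
    using half_edge_v by blast
  have "Complex (Im z) (Re z) \<in> ball m r" if "z \<in> ball (Complex (Im m) (Re m)) r" for z r
  proof -
    have "cmod (m - Complex (Im z) (Re z)) = cmod (Complex (Im m) (Re m) - z)"
      by (simp add: cmod_def add.commute)
    then show ?thesis using that by (simp add: dist_norm)
  qed
  then have "ball (Complex (Im m) (Re m)) (1 / 2^l / 2) \<subseteq> dsq (l,i,j) \<union> dsq (l,i,j-1)"
    using m(4) dsq_swap by blast
  then show ?thesis
    using m(1-3) dsq_swap[of m] complex.sel by (intro exI[of _ "Complex (Im m) (Re m)"] conjI) (simp_all only:)
qed

text \<open>Here m stands for the midpoint of an edge of Q. The far side S is an arbitrary set, so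
  that a neighbour of equal size can be replaced by a larger square containing it.\<close>

definition edge :: "dyadic \<Rightarrow> complex set \<Rightarrow> complex \<Rightarrow> bool" where
  "edge Q S m \<longleftrightarrow> m \<in> dsq Q \<and> m \<in> S \<and> ball m (side Q / 2) \<subseteq> dsq Q \<union> S"

lemma edge_mono: "edge Q S m \<Longrightarrow> S \<subseteq> T \<Longrightarrow> edge Q T m"
  unfolding edge_def by blast

lemma edge_neighbour:
  "\<exists>m. edge (l,i,j) (dsq (l,i-1,j)) m \<and> Re m = i / 2^l"
  "\<exists>m. edge (l,i,j) (dsq (l,i+1,j)) m \<and> Re m = (i+1) / 2^l"
  "\<exists>m. edge (l,i,j) (dsq (l,i,j-1)) m \<and> Im m = j / 2^l"
  "\<exists>m. edge (l,i,j) (dsq (l,i,j+1)) m \<and> Im m = (j+1) / 2^l"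
  using half_edge_v[of l i j] half_edge_v[of l "i+1" j] half_edge_h[of l i j] half_edge_h[of l i "j+1"]
  unfolding edge_def side_def fst_conv by (force simp: Un_commute)+

text \<open>If t is interior to the coarse interval, the fine interval is nested in it. If t is an
  endpoint of the coarse interval, the fine one or one of its two neighbours lies inside.\<close>

lemma dyadic_contact:
  fixes t :: real and a i :: int
  assumes "k \<le> l" "a \<le> 2^k * t" "2^k * t \<le> of_int a + 1" "i \<le> 2^l * t" "2^l * t \<le> of_int i + 1"
  shows "(a * 2^(l-k) \<le> i \<and> i + 1 \<le> (a + 1) * 2^(l-k)) \<or>
    (a * 2^(l-k) \<le> i + 1 \<and> i + 2 \<le> (a + 1) * 2^(l-k)) \<or>
    (a * 2^(l-k) \<le> i - 1 \<and> i \<le> (a + 1) * 2^(l-k))"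
proof -
  define q where "q = (2::int)^(l-k)"
  have q: "(2::real)^l = of_int q * 2^k" using assms(1) by (simp add: q_def flip: power_add)
  have q1: "q \<ge> 1" by (simp add: q_def)
  have exp: "(a + 1) * q = a * q + q" by (simp add: algebra_simps)
  consider "of_int a < 2^k * t" "2^k * t < of_int a + 1" | "2^k * t = a" | "2^k * t = a + 1"
    using assms(2,3) by force
  then show ?thesis
  proof cases
    case 1
    then show ?thesis using dyadic_nested[OF assms(1) 1 assms(4,5)] by simp
  next
    case 2
    then have "2^l * t = of_int (a * q)" by (simp add: q)
    then have "i \<le> a * q" "a * q \<le> i + 1" using assms(4,5) by linarith+
    then show ?thesis unfolding q_def[symmetric] exp using q1 by linarith
  next
    case 3
    then have "2^l * t = of_int ((a + 1) * q)" by (simp add: q)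
    then have "i \<le> (a + 1) * q" "(a+1) * q \<le> i + 1" using assms(4,5) by linarith+
    then show ?thesis unfolding q_def[symmetric] exp using q1 by linarith
  qed
qed

text \<open>Some coordinate of x is not dyadic, and in it the interval of Q lies inside that of P.
  In the other coordinate the intervals touch without being nested, so a neighbour of Q of the same
  size lies in P, and Q has a whole edge on P.\<close>

lemma dsq_contact_edge:
  assumes "fst P \<le> fst Q" "\<not> dsq Q \<subseteq> dsq P" "x \<in> dsq P" "x \<in> dsq Q" "x \<notin> corners"
  shows "\<exists>m. edge Q (dsq P) m"
proof -
  obtain k a b l i j where PQ: "P = (k,a,b)" "Q = (l,i,j)" by (metis prod_cases3)
  have kl: "k \<le> l" using assms(1) by (simp add: PQ)
  have P: "a \<le> 2^k * Re x" "2^k * Re x \<le> of_int a + 1" "b \<le> 2^k * Im x" "2^k * Im x \<le> of_int b + 1"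
    and Q: "i \<le> 2^l * Re x" "2^l * Re x \<le> of_int i + 1" "j \<le> 2^l * Im x" "2^l * Im x \<le> of_int j + 1"
    using assms(3,4) by (auto simp: PQ dsq.simps)
  have no: "\<not> (a * 2^(l-k) \<le> i \<and> i + 1 \<le> (a + 1) * 2^(l-k) \<and> b * 2^(l-k) \<le> j \<and> j + 1 \<le> (b + 1) * 2^(l-k))"
    using dsq_subset_index[of a l k i b j] kl assms(2) by (auto simp: PQ)
  have sub: "dsq (l,i',j') \<subseteq> dsq P"
    if "a * 2^(l-k) \<le> i'" "i' + 1 \<le> (a + 1) * 2^(l-k)" "b * 2^(l-k) \<le> j'" "j' + 1 \<le> (b + 1) * 2^(l-k)" for i' j'
    unfolding PQ by (rule dsq_subset_index) (use that kl in auto)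
  have "Re x \<notin> dyadics \<or> Im x \<notin> dyadics" using assms(5) by (simp add: corners_def)
  then show ?thesis
  proof
    assume "Re x \<notin> dyadics"
    then have "a < 2^k * Re x" "2^k * Re x < of_int a + 1" using nondyadic_strict P by blast+
    note n = dyadic_nested[OF kl this Q(1,2)]
    consider "b * 2^(l-k) \<le> j + 1 \<and> j + 2 \<le> (b + 1) * 2^(l-k)" | "b * 2^(l-k) \<le> j - 1 \<and> j \<le> (b + 1) * 2^(l-k)"
      using dyadic_contact[OF kl P(3,4) Q(3,4)] no n by blast
    then show ?thesis
    proof cases
      case 1
      then have "dsq (l,i,j+1) \<subseteq> dsq P" using n by (intro sub) auto
      then show ?thesis using edge_neighbour(4)[of l i j] edge_mono PQ(2) by blast
    next
      case 2
      then have "dsq (l,i,j-1) \<subseteq> dsq P" using n by (intro sub) auto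
      then show ?thesis using edge_neighbour(3)[of l i j] edge_mono PQ(2) by blast
    qed
  next
    assume "Im x \<notin> dyadics"
    then have "b < 2^k * Im x" "2^k * Im x < of_int b + 1" using nondyadic_strict P by blast+
    note n = dyadic_nested[OF kl this Q(3,4)]
    consider "a * 2^(l-k) \<le> i + 1 \<and> i + 2 \<le> (a + 1) * 2^(l-k)" | "a * 2^(l-k) \<le> i - 1 \<and> i \<le> (a + 1) * 2^(l-k)"
      using dyadic_contact[OF kl P(1,2) Q(1,2)] no n by blast
    then show ?thesis
    proof cases
      case 1
      then have "dsq (l,i+1,j) \<subseteq> dsq P" using n by (intro sub) auto
      then show ?thesis using edge_neighbour(2)[of l i j] edge_mono PQ(2) by blast
    next
      case 2
      then have "dsq (l,i-1,j) \<subseteq> dsq P" using n by (intro sub) auto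
      then show ?thesis using edge_neighbour(1)[of l i j] edge_mono PQ(2) by blast
    qed
  qed
qed

fun region :: "dyadic option \<Rightarrow> complex set" where
  "region None = - closed_box" | "region (Some Q) = osq Q"

fun cell :: "dyadic option \<Rightarrow> complex set" where
  "cell None = - open_box" | "cell (Some Q) = dsq Q"

text \<open>The radius \<open>side Q / 6\<close> is at most half the side of the other square too, since touching Whitney squares
  have sides comparable up to the factor 3.\<close>

definition link :: "dyadic \<Rightarrow> dyadic option \<Rightarrow> complex \<Rightarrow> bool" where
  "link Q X m \<longleftrightarrow> m \<in> dsq Q \<and> m \<in> cell X \<and> ball m (side Q / 6) \<subseteq> dsq Q \<union> cell X
     \<and> convex (ball m (side Q / 6) \<inter> region X)"

text \<open>The rim of the box lies on grid lines of every level, so a square of the box that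
  touches it has a whole edge on it.\<close>

lemma box_exit_link:
  assumes "inbox Q" "x \<in> dsq Q" "x \<notin> open_box"
  shows "\<exists>m. link Q None m"
proof -
  obtain l i j where Q: "Q = (l,i,j)" by (metis prod_cases3)
  have q: "i \<le> 2^l * Re x" "2^l * Re x \<le> of_int i + 1" "j \<le> 2^l * Im x" "2^l * Im x \<le> of_int j + 1"
    using assms(2) by (auto simp: Q dsq.simps)
  have ib: "- (2^l) \<le> i" "i < 2^l" "- (2^l) \<le> j" "j < 2^l" using assms(1) by (auto simp: Q inbox.simps)
  have p: "(2::real)^l > 0" by simp
  \<comment> \<open>The outside of the box is not convex, but inside the disc around the midpoint of
    the edge it coincides with an open half plane H.\<close>
  have key: "link Q None m" if e: "edge Q S m" and S: "S \<subseteq> - open_box" "S \<subseteq> H \<union> closed_box"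
    and H: "convex H" "H \<subseteq> - closed_box" for m S H
    unfolding link_def
  proof (intro conjI)
    have b: "ball m (side Q / 6) \<subseteq> ball m (side Q / 2)" by (rule subset_ball) (simp add: less_imp_le)
    show "m \<in> dsq Q" "m \<in> cell None" using e S by (auto simp: edge_def)
    show "ball m (side Q / 6) \<subseteq> dsq Q \<union> cell None" using e b S(1) by (auto simp: edge_def)
    have "ball m (side Q / 6) \<inter> region None = ball m (side Q / 6) \<inter> H"
      using e b S(2) H(2) inbox_subset[OF assms(1)] by (auto simp: edge_def)
    then show "convex (ball m (side Q / 6) \<inter> region None)" by (simp add: convex_Int H(1))
  qed
  have ge: "t \<ge> 1" if "real_of_int (2^l) \<le> 2^l * t" for t :: real
    using that p by simp
  have le: "t \<le> -1" if "2^l * t \<le> real_of_int (- (2^l))" for t :: real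
  proof -
    have "2^l * t \<le> 2^l * (-1)" using that by simp
    then show ?thesis by (simp only: mult_le_cancel_left_pos[OF p])
  qed
  have "x \<in> closed_box" using inbox_subset assms by blast
  then consider "Re x = 1" | "Re x = -1" | "Im x = 1" | "Im x = -1"
    using assms(3) by (force simp: open_box_def closed_box_def)
  then show ?thesis
  proof cases
    case 1
    then have "real_of_int (2^l) \<le> of_int (i + 1)" using q by simp
    then have i: "i + 1 = 2^l" using ib unfolding of_int_le_iff by linarith
    have "dsq (l,i+1,j) \<subseteq> {z. Re z \<ge> 1 \<and> \<bar>Im z\<bar> \<le> 1}"
      unfolding i dsq.simps using inbox_coord[OF ib(3,4)] ge by blast
    then have "dsq (l,i+1,j) \<subseteq> - open_box" "dsq (l,i+1,j) \<subseteq> {z. Re z > 1} \<union> closed_box" "{z. Re z > 1} \<subseteq> - closed_box"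
      by (auto simp: open_box_def closed_box_def)
    then show ?thesis using key edge_neighbour(2)[of l i j] convex_halfspace_Re_gt Q by blast
  next
    case 2
    then have "real_of_int i \<le> of_int (- (2^l))" using q by simp
    then have i: "i - 1 + 1 = - (2^l)" using ib unfolding of_int_le_iff by linarith
    have "dsq (l,i-1,j) \<subseteq> {z. Re z \<le> -1 \<and> \<bar>Im z\<bar> \<le> 1}"
      unfolding dsq.simps using inbox_coord[OF ib(3,4)] le i by auto
    then have "dsq (l,i-1,j) \<subseteq> - open_box" "dsq (l,i-1,j) \<subseteq> {z. Re z < -1} \<union> closed_box" "{z. Re z < -1} \<subseteq> - closed_box"
      by (auto simp: open_box_def closed_box_def)
    then show ?thesis using key edge_neighbour(1)[of l i j] convex_halfspace_Re_lt Q by blast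
  next
    case 3
    then have "real_of_int (2^l) \<le> of_int (j + 1)" using q by simp
    then have i: "j + 1 = 2^l" using ib unfolding of_int_le_iff by linarith
    have "dsq (l,i,j+1) \<subseteq> {z. Im z \<ge> 1 \<and> \<bar>Re z\<bar> \<le> 1}"
      unfolding i dsq.simps using inbox_coord[OF ib(1,2)] ge by blast
    then have "dsq (l,i,j+1) \<subseteq> - open_box" "dsq (l,i,j+1) \<subseteq> {z. Im z > 1} \<union> closed_box" "{z. Im z > 1} \<subseteq> - closed_box"
      by (auto simp: open_box_def closed_box_def)
    then show ?thesis using key edge_neighbour(4)[of l i j] convex_halfspace_Im_gt Q by blast
  next
    case 4
    then have "real_of_int j \<le> of_int (- (2^l))" using q by simp
    then have i: "j - 1 + 1 = - (2^l)" using ib unfolding of_int_le_iff by linarith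
    have "dsq (l,i,j-1) \<subseteq> {z. Im z \<le> -1 \<and> \<bar>Re z\<bar> \<le> 1}"
      unfolding dsq.simps using inbox_coord[OF ib(1,2)] le i by auto
    then have "dsq (l,i,j-1) \<subseteq> - open_box" "dsq (l,i,j-1) \<subseteq> {z. Im z < -1} \<union> closed_box" "{z. Im z < -1} \<subseteq> - closed_box"
      by (auto simp: open_box_def closed_box_def)
    then show ?thesis using key edge_neighbour(3)[of l i j] convex_halfspace_Im_lt Q by blast
  qed
qed

context whitney_setup
begin

text \<open>The disc is centred at the midpoint of an edge of the smaller square. If that is P, then
  side Q <= 3 * side P makes half its side at least side Q / 6.\<close>

lemma whit_contact_link:
  assumes "whit P" "whit Q" "P \<noteq> Q" "x \<in> dsq P" "x \<in> dsq Q" "x \<notin> corners"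
  shows "\<exists>m. link Q (Some P) m"
proof -
  have nsub: "\<not> dsq Q \<subseteq> dsq P" if "whit P" "whit Q" "P \<noteq> Q" for P Q
    using whit_disjoint[OF that(2,1) cen_mem_osq[of Q]] osq_subset_dsq[of Q] cen_mem_osq[of Q] that(3) by blast
  have cmp: "side Q \<le> 3 * side P" "side P \<le> 3 * side Q"
    using whit_side_comparable assms by blast+
  have "\<exists>m r. m \<in> dsq P \<and> m \<in> dsq Q \<and> side Q / 6 \<le> r \<and> ball m r \<subseteq> dsq Q \<union> dsq P"
  proof (cases "fst P \<le> fst Q")
    case True
    then obtain m where "edge Q (dsq P) m"
      using dsq_contact_edge nsub assms by blast
    then show ?thesis using side_pos[of Q] unfolding edge_def by (intro exI[of _ m] exI[of _ "side Q / 2"]) auto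
  next
    case False
    then obtain m where "edge P (dsq Q) m"
      using dsq_contact_edge[of Q P x] nsub[of Q P] assms by auto
    then show ?thesis using cmp unfolding edge_def by (intro exI[of _ m] exI[of _ "side P / 2"]) auto
  qed
  then obtain m r where m: "m \<in> dsq P" "m \<in> dsq Q" "side Q / 6 \<le> r" "ball m r \<subseteq> dsq Q \<union> dsq P"
    by blast
  then show ?thesis unfolding link_def using subset_ball[OF m(3), of m]
    by (intro exI[of _ m]) (auto intro: convex_Int convex_osq)
qed

end

section \<open>Cheapest chains to the outer region\<close>

lemma open_noncorner:
  assumes "open V" "V \<noteq> {}"
  shows "\<exists>x \<in> V. x \<notin> corners"
proof -
  obtain x e where "e > 0" "ball x e \<subseteq> V" using assms open_contains_ball by blast
  moreover have "uncountable (ball x e)" using \<open>e > 0\<close> by (rule uncountable_ball)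
  then have "\<not> ball x e \<subseteq> corners" using countable_subset[OF _ countable_corners] by metis
  ultimately show ?thesis by blast
qed

lemma card_int_near:
  fixes t N :: real
  assumes "N \<ge> 0"
  shows "finite {i::int. \<bar>of_int i - t\<bar> \<le> N}" "card {i::int. \<bar>of_int i - t\<bar> \<le> N} \<le> 2 * N + 1"
proof -
  have *: "{i::int. \<bar>of_int i - t\<bar> \<le> N} = {\<lceil>t - N\<rceil>..\<lfloor>t + N\<rfloor>}"
    by (auto simp: ceiling_le_iff le_floor_iff abs_le_iff)
  show "finite {i::int. \<bar>of_int i - t\<bar> \<le> N}" unfolding * by simp
  have "real_of_int (\<lfloor>t + N\<rfloor> - \<lceil>t - N\<rceil> + 1) \<le> 2 * N + 1" by linarith
  then show "card {i::int. \<bar>of_int i - t\<bar> \<le> N} \<le> 2 * N + 1" unfolding *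
    using assms by (simp add: of_nat_nat le_max_iff_disj)
qed

text \<open>A geometric sum is at most twice its last term. So with boundedly many squares per
  level, the finest level governs the total cost.\<close>

lemma sum_pow2_bounded:
  fixes T :: real
  assumes "T \<ge> 0"
  shows "finite {k::nat. 2^k \<le> T}" "(\<Sum>k | 2^k \<le> T. 2^k) \<le> 2 * T"
proof -
  obtain n where n: "T < 2^n" using real_arch_pow[of 2 T] by auto
  have "k < n" if "2^k \<le> T" for k
  proof -
    have "(2::real)^k < 2^n" using that n by linarith
    then show ?thesis by simp
  qed
  then have sub: "{k::nat. 2^k \<le> T} \<subseteq> {..<n}" by auto
  then show fin: "finite {k::nat. 2^k \<le> T}" by (rule finite_subset) simp
  show "(\<Sum>k | 2^k \<le> T. 2^k) \<le> 2 * T"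
  proof (cases "{k::nat. 2^k \<le> T} = {}")
    case False
    define m where "m = Max {k::nat. 2^k \<le> T}"
    have m: "2^m \<le> T" using Max_in[OF fin False] by (simp add: m_def)
    have "{k::nat. 2^k \<le> T} \<subseteq> {..<Suc m}" using Max_ge[OF fin] by (auto simp: m_def less_Suc_eq_le)
    then have "(\<Sum>k | 2^k \<le> T. 2^k) \<le> (\<Sum>k<Suc m. (2::real)^k)" by (intro sum_mono2) auto
    also have "\<dots> = 2^Suc m - 1" by (induction m) simp_all
    also have "\<dots> \<le> 2 * T" using m by simp
    finally show ?thesis .
  next
    case True
    then show ?thesis unfolding True using assms by simp
  qed
qed

lemma cen_mem_dsq: "cen Q \<in> dsq Q"
  using cen_mem_osq osq_subset_dsq by (rule subsetD[rotated])

lemma open_box_subset: "open_box \<subseteq> closed_box"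
  by (auto simp: open_box_def closed_box_def)

definition cost :: "dyadic set \<Rightarrow> nat" where "cost A = (\<Sum>Q\<in>A. 2 ^ fst Q)"

lemma side_level: "side Q * 2 ^ fst Q = 1"
  by (simp add: side_def)

context whitney_setup
begin

text \<open>Here n is the cost of some chain of links from the exterior to the cell. Costs are
  natural numbers, so a cheapest chain exists although there may be infinitely many chains.\<close>

inductive reach :: "dyadic option \<Rightarrow> nat \<Rightarrow> bool" where
  root: "reach None 0"
| step: "reach X n \<Longrightarrow> whit Q \<Longrightarrow> link Q X m \<Longrightarrow> reach (Some Q) (n + 2 ^ fst Q)"

text \<open>If a Whitney square S meets U at y, then d y <= 12 * side S bounds d u + dist y u by a
  multiple of side S. Hence S is not much smaller than Q0, and on its level it is one of boundedly
  many squares near u. Summing over the levels leaves a multiple of 1 / side Q0.\<close>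

lemma finite_cost_whit_near:
  fixes M :: real
  assumes Q0: "whit Q0" and u: "u \<in> dsq Q0" and M: "M \<ge> 1"
    and U: "\<And>y. y \<in> U \<Longrightarrow> d u + dist y u \<le> M * d y"
  defines "\<S> \<equiv> {S. whit S \<and> dsq S \<inter> U \<noteq> {}}"
  shows "finite \<S>" "cost \<S> \<le> 6 * M * (24 * M + 3)^2 * 2 ^ fst Q0"
proof -
  \<comment> \<open>12 * M comes from \<open>whit_upper\<close>; the extra 1 pays for passing from
    the coordinate of a point to the index of its interval.\<close>
  define N where "N = 12 * M + 1"
  \<comment> \<open>From 4 * side Q0 <= d u <= 12 * M * side S.\<close>
  define T where "T = 3 * M * 2 ^ fst Q0"
  define I where "I t = {i::int. \<bar>of_int i - t\<bar> \<le> N}" for t :: real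
  define F where "F = (SIGMA k:{k. 2^k \<le> T}. I (2^k * Re u) \<times> I (2^k * Im u))"
  have N0: "N \<ge> 0" and T0: "T \<ge> 0" using M by (simp_all add: N_def T_def)
  have I: "finite (I t)" "card (I t) \<le> 2 * N + 1" for t
    using card_int_near[OF N0, of t] by (simp_all add: I_def)
  note P = sum_pow2_bounded[OF T0]
  have finF: "finite F" unfolding F_def using P(1) I(1) by (intro finite_SigmaI finite_cartesian_product)
  have sub: "\<S> \<subseteq> F"
  proof
    fix S assume "S \<in> \<S>"
    then obtain y where S: "whit S" and y: "y \<in> dsq S" "y \<in> U" by (auto simp: \<S>_def)
    obtain k i j where Sk: "S = (k,i,j)" by (metis prod_cases3)
    have pk: "(2::real)^k > 0" by simp
    have "M * d y \<le> M * (12 * side S)" using whit_upper[OF S y(1)] M by (intro mult_left_mono) auto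
    then have b: "d u + dist y u \<le> 12 * M * side S" using U[OF y(2)] by simp
    then have "4 * side Q0 \<le> 12 * M * side S"
      using whit_lower[OF Q0 u] zero_le_dist[of y u] by linarith
    then have "side Q0 \<le> 3 * M * side S" by simp
    then have "side Q0 * (2^fst Q0 * 2^k) \<le> 3 * M * side S * (2^fst Q0 * 2^k)"
      by (rule mult_right_mono) simp
    then have "2^k \<le> T" using side_level[of Q0] side_level[of S]
      by (simp add: T_def Sk side_def)
    moreover have "dist y u * 2^k \<le> 12 * M * side S * 2^k"
      using b infdist_nonneg[of u K] by (intro mult_right_mono) auto
    then have b2: "dist y u * 2^k \<le> 12 * M" by (simp add: Sk side_def)
    have near: "\<bar>of_int l - 2^k * t\<bar> \<le> N" if "of_int l \<le> 2^k * s" "2^k * s \<le> of_int l + 1" "\<bar>s - t\<bar> \<le> dist y u"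
      for l :: int and s t
    proof -
      have "\<bar>2^k * s - 2^k * t\<bar> = 2^k * \<bar>s - t\<bar>" by (simp add: abs_mult flip: right_diff_distrib)
      also have "\<dots> = \<bar>s - t\<bar> * 2^k" by (rule mult.commute)
      also have "\<dots> \<le> dist y u * 2^k" using that(3) by (rule mult_right_mono) simp
      also have "\<dots> \<le> 12 * M" by (rule b2)
      finally show ?thesis using that(1,2) unfolding N_def by linarith
    qed
    have "\<bar>Re y - Re u\<bar> \<le> dist y u" "\<bar>Im y - Im u\<bar> \<le> dist y u"
      using abs_Re_le_cmod[of "y - u"] abs_Im_le_cmod[of "y - u"] by (simp_all add: dist_norm)
    then have "i \<in> I (2^k * Re u)" "j \<in> I (2^k * Im u)"
      using near[of i "Re y" "Re u"] near[of j "Im y" "Im u"] y(1) by (simp_all add: I_def Sk dsq.simps)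
    ultimately show "S \<in> F" by (simp add: F_def Sk)
  qed
  then show "finite \<S>" using finF finite_subset by blast
  have "real (cost \<S>) \<le> (\<Sum>Q\<in>F. 2 ^ fst Q)"
    unfolding cost_def of_nat_sum of_nat_power of_nat_numeral using sub finF by (intro sum_mono2) auto
  also have "\<dots> = (\<Sum>k | 2^k \<le> T. \<Sum>p\<in>I (2^k * Re u) \<times> I (2^k * Im u). 2 ^ k)"
    unfolding F_def using P(1) I(1) by (subst sum.Sigma) (auto simp: case_prod_unfold)
  also have "\<dots> \<le> (\<Sum>k | 2^k \<le> T. (2 * N + 1)^2 * 2 ^ k)"
  proof (rule sum_mono)
    fix k :: nat
    have "real (card (I (2^k * Re u)) * card (I (2^k * Im u))) \<le> (2 * N + 1) * (2 * N + 1)"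
      unfolding of_nat_mult using I(2) N0 by (intro mult_mono) auto
    then show "(\<Sum>p\<in>I (2^k * Re u) \<times> I (2^k * Im u). 2 ^ k) \<le> (2 * N + 1)^2 * (2::real) ^ k"
      by (simp add: card_cartesian_product power2_eq_square)
  qed
  also have "\<dots> = (2 * N + 1)^2 * (\<Sum>k | 2^k \<le> T. 2 ^ k)" by (simp add: sum_distrib_left)
  also have "\<dots> \<le> (2 * N + 1)^2 * (2 * T)" using P(2) by (intro mult_left_mono) auto
  also have "\<dots> = 6 * M * (24 * M + 3)^2 * 2 ^ fst Q0" by (simp add: N_def T_def add.commute)
  finally show "cost \<S> \<le> 6 * M * (24 * M + 3)^2 * 2 ^ fst Q0" .
qed

text \<open>A subset \<open>A\<close> of \<open>\<S>\<close> is admissible if each of its members is reachable at cost at most \<open>cost A\<close>.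
  A maximal admissible set absorbs every square of \<open>\<S>\<close> adjacent to it or to the exterior, so if it missed
  \<open>Q0\<close>, it would disconnect \<open>U\<close> minus the corners.\<close>

lemma reach_within:
  assumes Q0: "whit Q0" and opU: "open U" and conU: "connected U" and UK: "U \<inter> K = {}"
    and u: "u \<in> U" "u \<in> dsq Q0" and out: "\<not> U \<subseteq> closed_box"
  defines "\<S> \<equiv> {S. whit S \<and> dsq S \<inter> U \<noteq> {}}"
  assumes fin: "finite \<S>"
  shows "\<exists>n \<le> cost \<S>. reach (Some Q0) n"
proof -
  define ok where "ok A \<longleftrightarrow> A \<subseteq> \<S> \<and> (\<forall>S\<in>A. \<exists>n \<le> cost A. reach (Some S) n)" for A
  have "ok {}" by (simp add: ok_def)
  moreover have "finite {A. ok A}" using fin by (rule_tac finite_subset[of _ "Pow \<S>"]) (auto simp: ok_def)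
  ultimately obtain A where A: "ok A" and maxA: "\<And>B. ok B \<Longrightarrow> A \<subseteq> B \<Longrightarrow> B = A"
    using finite_has_maximal[of "{A. ok A}"] by auto
  have finA: "finite A" using A fin finite_subset by (auto simp: ok_def)
  have extend: "S \<in> A" if S: "S \<in> \<S>" "link S X m" "reach X n" "n \<le> cost A" for S X m n
  proof (rule ccontr)
    assume nS: "S \<notin> A"
    \<comment> \<open>The new member raises the common allowance by exactly the price of the link
      that reaches it.\<close>
    have c: "cost (insert S A) = cost A + 2 ^ fst S" using finA nS by (simp add: cost_def)
    have "whit S" using S(1) by (simp add: \<S>_def)
    then have "reach (Some S) (n + 2 ^ fst S)" using reach.step S by blast
    moreover have "n + 2 ^ fst S \<le> cost (insert S A)" using S(4) c by simp
    ultimately have "\<exists>n' \<le> cost (insert S A). reach (Some S) n'" by blast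
    moreover have "\<exists>n' \<le> cost (insert S A). reach (Some R) n'" if R: "R \<in> A" for R
    proof -
      obtain n' where "n' \<le> cost A" "reach (Some R) n'" using A R unfolding ok_def by blast
      then show ?thesis using c by (intro exI[of _ n']) simp
    qed
    ultimately have "ok (insert S A)" using A S(1) unfolding ok_def by simp
    then show False using maxA nS by blast
  qed
  define E1 where "E1 = (\<Union>S\<in>A. dsq S) \<union> - open_box"
  define E2 where "E2 = (\<Union>S\<in>\<S> - A. dsq S)"
  have cl: "closed E1" "closed E2" unfolding E1_def E2_def
    using finA fin closed_dsq open_open_box by (auto intro!: closed_Un closed_UN)
  have cover: "U - corners \<subseteq> E1 \<union> E2"
  proof
    fix y assume y: "y \<in> U - corners"
    show "y \<in> E1 \<union> E2"
    proof (cases "y \<in> closed_box")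
      case True
      then obtain S where S: "whit S" "y \<in> dsq S" using whit_cover y UK by blast
      then have "S \<in> \<S>" using y by (auto simp: \<S>_def)
      then show ?thesis using S by (auto simp: E1_def E2_def)
    qed (use open_box_subset in \<open>auto simp: E1_def\<close>)
  qed
  have disj: "E1 \<inter> E2 \<inter> (U - corners) = {}"
  proof -
    have False if y: "y \<in> E1" "y \<in> E2" "y \<notin> corners" for y
    proof -
      obtain S where S: "S \<in> \<S>" "S \<notin> A" "y \<in> dsq S" using y(2) by (auto simp: E2_def)
      have wS: "whit S" using S(1) by (simp add: \<S>_def)
      show False
      proof (cases "y \<in> open_box")
        case False
        have "inbox S" using whit_good[OF wS] by (simp add: good_def)
        then obtain m where "link S None m" using box_exit_link S(3) False by blast
        then show False using extend[OF S(1) _ reach.root] S(2) by blast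
      next
        case True
        then obtain P where P: "P \<in> A" "y \<in> dsq P" using y(1) by (auto simp: E1_def)
        then have wP: "whit P" using A by (auto simp: ok_def \<S>_def)
        obtain n where n: "reach (Some P) n" "n \<le> cost A" using A P(1) unfolding ok_def by blast
        obtain m where "link S (Some P) m" using whit_contact_link[OF wP wS _ P(2) S(3) y(3)] P(1) S(2) by blast
        then show False using extend[OF S(1) _ n] S(2) by blast
      qed
    qed
    then show ?thesis by blast
  qed
  have "connected (U - corners)" using connected_open_diff_countable[of U corners] opU conU countable_corners by simp
  then have "E1 \<inter> (U - corners) = {} \<or> E2 \<inter> (U - corners) = {}"
    using connected_closedD[of "U - corners" E1 E2] disj cover cl by blast
  moreover have "\<exists>x \<in> U \<inter> - closed_box. x \<notin> corners"
    using opU closed_closed_box out by (intro open_noncorner open_Int) auto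
  then have "E1 \<inter> (U - corners) \<noteq> {}" using open_box_subset by (force simp: E1_def)
  \<comment> \<open>The point u may itself be a corner, as the centre of a square always is, so a
    nearby point serves as witness.\<close>
  moreover have "\<exists>x \<in> U \<inter> osq Q0. x \<notin> corners"
    using open_meets_osq[OF opU u] opU open_osq by (intro open_noncorner open_Int) auto
  then have "Q0 \<in> \<S> - A \<Longrightarrow> E2 \<inter> (U - corners) \<noteq> {}"
    using osq_subset_dsq[of Q0] unfolding E2_def by blast
  moreover have "Q0 \<in> \<S>" using Q0 u by (auto simp: \<S>_def)
  ultimately have "Q0 \<in> A" by blast
  then obtain n where "n \<le> cost A" "reach (Some Q0) n" using A by (auto simp: ok_def)
  moreover have "cost A \<le> cost \<S>" unfolding cost_def using A fin by (intro sum_mono2) (auto simp: ok_def)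
  ultimately show ?thesis by (meson order_trans)
qed

end

text \<open>\<open>escape\<close> is the John condition in the chart: the arc becomes a connected
  set, and reaching the centre becomes leaving the box.\<close>

locale planar_John = whitney_setup +
  fixes M :: real
  assumes M: "M \<ge> 1"
    and escape: "\<And>u. u \<in> closed_box \<Longrightarrow> u \<notin> K \<Longrightarrow>
      \<exists>G. connected G \<and> u \<in> G \<and> \<not> G \<subseteq> closed_box \<and> (\<forall>x\<in>G. dist x u \<le> M * d x)"
begin

text \<open>The factor in the bound of \<open>finite_cost_whit_near\<close> with 4 * M + 3 in place
  of M.\<close>

definition chain_const :: real where "chain_const = 6 * (4 * M + 3) * (24 * (4 * M + 3) + 3)^2"

lemma reach_bound:
  assumes Q0: "whit Q0"
  shows "\<exists>n. reach (Some Q0) n \<and> n \<le> chain_const * 2 ^ fst Q0"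
proof -
  define u where "u = cen Q0"
  have u: "u \<in> dsq Q0" using cen_mem_dsq by (simp add: u_def)
  have uK: "u \<notin> K" "u \<in> closed_box" using u whit_not_K[OF Q0] whit_subset_box[OF Q0] by auto
  obtain G where G: "connected G" "u \<in> G" "\<not> G \<subseteq> closed_box" and GM: "\<And>x. x\<in>G \<Longrightarrow> dist x u \<le> M * d x"
    using escape[OF uK(2,1)] by metis
  have GK: "d x > 0" if "x \<in> G" for x
  proof (rule d_pos, rule notI)
    assume "x \<in> K"
    then have "dist x u \<le> 0" using GM[OF that] by simp
    then show False using uK \<open>x \<in> K\<close> by simp
  qed
  \<comment> \<open>The thickening is open, as the removal of corners requires. With G included in
    every piece, all pieces share the point u and the union is visibly connected.\<close>
  define U where "U = (\<Union>x\<in>G. G \<union> ball x (d x / 2))"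
  have U_eq: "U = (\<Union>x\<in>G. ball x (d x / 2))" unfolding U_def using GK by auto
  have opU: "open U" unfolding U_eq by auto
  have "connected (G \<union> ball x (d x / 2))" if "x \<in> G" for x
    using G(1) that GK[OF that] by (intro connected_Un) auto
  then have conU: "connected U" unfolding U_def using G(2) by (intro connected_Union) auto
  \<comment> \<open>The triangle inequality through x gives dist y u <= (2 * M + 1) * d y. Adding d
    u <= d y + dist y u yields 1 + 2 * (2 * M + 1) = 4 * M + 3.\<close>
  have *: "d u + dist y u \<le> (4 * M + 3) * d y \<and> d y > 0" if y: "y \<in> U" for y
  proof -
    obtain x where x: "x \<in> G" "dist x y < d x / 2" using y by (auto simp: U_eq)
    have 1: "d x \<le> 2 * d y" using d_lip[of x y] x(2) by simp
    have "M * d x \<le> M * (2 * d y)" using 1 M by (intro mult_left_mono) auto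
    then have 2: "dist y u \<le> d y + 2 * M * d y"
      using GM[OF x(1)] dist_triangle[of y u x] x(2) 1 by (simp add: dist_commute)
    have "d u \<le> d y + dist y u" using d_lip[of u y] by (simp add: dist_commute)
    then show ?thesis using 1 2 GK[OF x(1)] by (simp add: algebra_simps)
  qed
  have UK: "U \<inter> K = {}" using * by force
  have "G \<subseteq> U" unfolding U_def by auto
  then have out: "\<not> U \<subseteq> closed_box" and uU: "u \<in> U" using G by auto
  have M3: "4 * M + 3 \<ge> 1" using M by simp
  have fin: "finite {S. whit S \<and> dsq S \<inter> U \<noteq> {}}"
    by (rule finite_cost_whit_near(1)[OF Q0 u M3]) (use * in blast)
  have "cost {S. whit S \<and> dsq S \<inter> U \<noteq> {}} \<le> chain_const * 2 ^ fst Q0" unfolding chain_const_def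
    by (rule finite_cost_whit_near(2)[OF Q0 u M3]) (use * in blast)
  moreover obtain n where "n \<le> cost {S. whit S \<and> dsq S \<inter> U \<noteq> {}}" "reach (Some Q0) n"
    using reach_within[OF Q0 opU conU UK uU u out fin] by blast
  ultimately show ?thesis by (intro exI[of _ n]) linarith
qed

end

section \<open>The tree domain and its carrots\<close>

text \<open>Let a >= 1 be the larger absolute coordinate of u. At s u it has grown to s a, and a
  move by less than (s - 1) |u| / 2 <= (s - 1) a leaves it above a.\<close>

lemma ray_ball_outside:
  assumes "u \<notin> open_box" "s \<ge> 1"
  shows "ball (s *\<^sub>R u) ((s - 1) * (cmod u / 2)) \<subseteq> - closed_box"
proof
  fix z assume z: "z \<in> ball (s *\<^sub>R u) ((s - 1) * (cmod u / 2))"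
  have c: "\<bar>Re z - s * Re u\<bar> < (s - 1) * (cmod u / 2)" "\<bar>Im z - s * Im u\<bar> < (s - 1) * (cmod u / 2)"
    using ball_subset_coords[OF z] by auto
  define a where "a = max \<bar>Re u\<bar> \<bar>Im u\<bar>"
  have a1: "a \<ge> 1" using assms(1) by (auto simp: a_def open_box_def)
  have "cmod u / 2 \<le> a" using cmod_le[of u] by (simp add: a_def)
  then have b: "(s - 1) * (cmod u / 2) \<le> (s - 1) * a" using assms(2) by (intro mult_left_mono) auto
  have key: "\<bar>t\<bar> > 1" if "\<bar>t - s * v\<bar> < (s - 1) * a" "\<bar>v\<bar> = a" for t v
  proof -
    have "\<bar>s * v\<bar> = s * a" using that(2) assms(2) by (simp add: abs_mult)
    then have "\<bar>t\<bar> > s * a - (s - 1) * a" using that(1) by linarith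
    also have "s * a - (s - 1) * a = a" by (simp add: algebra_simps)
    finally show ?thesis using a1 by simp
  qed
  consider "\<bar>Re u\<bar> = a" | "\<bar>Im u\<bar> = a" unfolding a_def by linarith
  then have "\<bar>Re z\<bar> > 1 \<or> \<bar>Im z\<bar> > 1"
  proof cases
    case 1 then show ?thesis using key[of "Re z" "Re u"] c(1) b by linarith
  next
    case 2 then show ?thesis using key[of "Im z" "Im u"] c(2) b by linarith
  qed
  then show "z \<in> - closed_box" by (auto simp: closed_box_def)
qed

text \<open>The homothety with centre m and ratio t carries the inscribed disc around
  \<open>cen Q\<close> to this disc.\<close>

lemma osq_segment_ball:
  assumes "m \<in> dsq Q" "0 \<le> t" "t \<le> 1"
  shows "ball ((1 - t) *\<^sub>R m + t *\<^sub>R cen Q) (t * (side Q / 2)) \<subseteq> osq Q"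
proof (cases "t = 0")
  case False
  then have t: "t > 0" using assms by simp
  show ?thesis
  proof
    fix z assume z: "z \<in> ball ((1 - t) *\<^sub>R m + t *\<^sub>R cen Q) (t * (side Q / 2))"
    define y where "y = cen Q + (z - ((1 - t) *\<^sub>R m + t *\<^sub>R cen Q)) /\<^sub>R t"
    have "dist (cen Q) y = norm (z - ((1 - t) *\<^sub>R m + t *\<^sub>R cen Q)) / t"
      using t by (simp add: y_def dist_norm divide_inverse mult.commute)
    also have "\<dots> < side Q / 2"
      using z t by (simp add: dist_norm norm_minus_commute pos_divide_less_eq mult.commute)
    finally have "y \<in> osq Q" using ball_cen_subset[of Q] by auto
    moreover have "z = (1 - t) *\<^sub>R m + t *\<^sub>R y" using t by (simp add: y_def algebra_simps)
    ultimately show "z \<in> osq Q" using osq_mix[OF assms(1) _ t assms(3)] by simp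
  qed
qed simp

text \<open>Near m the disc around x stays in the disc around m. Once dist x m > 3 r, the disc of
  \<open>osq_segment_ball\<close> already has radius at least r. With r = side / 24 the disc around
  m is the one opened at a door.\<close>

lemma door_segment_ball:
  assumes m: "m \<in> dsq Q" and x: "x \<in> closed_segment m (cen Q)" and r: "r > 0"
  shows "ball x r \<subseteq> osq Q \<union> ball m (4 * r)"
proof (cases "dist x m \<le> 3 * r")
  case True
  have "ball x r \<subseteq> ball m (4 * r)"
  proof
    fix z assume "z \<in> ball x r"
    then show "z \<in> ball m (4 * r)" using True dist_triangle[of m z x] by (simp add: dist_commute)
  qed
  then show ?thesis by blast
next
  case False
  obtain t where t: "0 \<le> t" "t \<le> 1" "x = (1 - t) *\<^sub>R m + t *\<^sub>R cen Q"
    using x by (auto simp: closed_segment_def)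
  have "x - m = t *\<^sub>R (cen Q - m)" by (simp add: t(3) algebra_simps)
  then have "dist x m = t * dist m (cen Q)" using t(1) by (simp add: dist_norm norm_minus_commute)
  also have "\<dots> \<le> t * side Q" using dist_cen[OF m] t(1) by (rule mult_left_mono)
  finally have "r \<le> t * (side Q / 2)" using False r by simp
  then have "ball x r \<subseteq> ball x (t * (side Q / 2))" by (rule subset_ball)
  then show ?thesis using osq_segment_ball[OF m t(1,2)] t(3) by blast
qed

section \<open>The tree of cheapest chains and the domain that it opens\<close>

context planar_John
begin

definition Dst :: "dyadic option \<Rightarrow> nat" where "Dst X = (LEAST n. reach X n)"

lemma reach_Dst: "reach X n \<Longrightarrow> reach X (Dst X)"
  unfolding Dst_def by (rule LeastI)

lemma Dst_le: "reach X n \<Longrightarrow> Dst X \<le> n"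
  unfolding Dst_def by (rule Least_le)

lemma whit_reach: "whit Q \<Longrightarrow> reach (Some Q) (Dst (Some Q))"
  using reach_bound reach_Dst by blast

lemma Dst_upper: "whit Q \<Longrightarrow> Dst (Some Q) \<le> chain_const * 2 ^ fst Q"
  using reach_bound[of Q] Dst_le of_nat_mono order_trans by meson

text \<open>The equation says that X is the last cell but one of some cheapest chain to Q. It makes
  \<open>Dst\<close> strictly smaller at X, which drives every recursion along the tree.\<close>

definition is_parent :: "dyadic \<Rightarrow> dyadic option \<Rightarrow> complex \<Rightarrow> bool" where
  "is_parent Q X m \<longleftrightarrow> link Q X m \<and> Dst (Some Q) = Dst X + 2 ^ fst Q \<and> (\<forall>A. X = Some A \<longrightarrow> whit A)"

text \<open>A cheapest chain without its last link is again cheapest; a cheaper approach to X would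
  make the whole chain cheaper.\<close>

lemma parent_exists: assumes "whit Q" shows "\<exists>X m. is_parent Q X m"
  using whit_reach[OF assms]
proof cases
  case (step X n m)
  have "reach (Some Q) (Dst X + 2 ^ fst Q)" using reach.step[OF reach_Dst] step by blast
  then have "Dst (Some Q) = Dst X + 2 ^ fst Q"
    using Dst_le[of "Some Q"] Dst_le[of X n] step by fastforce
  moreover have "whit A" if "X = Some A" for A
    using step(2) that by (cases rule: reach.cases) auto
  ultimately show ?thesis using step unfolding is_parent_def by blast
qed

definition parent :: "dyadic \<Rightarrow> dyadic option" where "parent Q = (SOME X. \<exists>m. is_parent Q X m)"
definition door :: "dyadic \<Rightarrow> complex" where "door Q = (SOME m. is_parent Q (parent Q) m)"

lemma is_parent: "whit Q \<Longrightarrow> is_parent Q (parent Q) (door Q)"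
  unfolding door_def parent_def using parent_exists[of Q] someI_ex by (metis (mono_tags, lifting))

text \<open>Distinct open squares are disjoint, so they communicate only through door discs. Each
  disc lies in the union of Q and the cell of its parent, so no other passage is opened.\<close>

definition bulge :: "dyadic \<Rightarrow> complex set" where
  "bulge Q = osq Q \<union> ball (door Q) (side Q / 6)"

definition tree_dom :: "complex set" where
  "tree_dom = - closed_box \<union> (\<Union>Q\<in>Collect whit. bulge Q)"

lemma door_props:
  assumes "whit Q"
  shows "door Q \<in> dsq Q" "door Q \<in> cell (parent Q)" "ball (door Q) (side Q / 6) \<subseteq> dsq Q \<union> cell (parent Q)"
    "convex (ball (door Q) (side Q / 6) \<inter> region (parent Q))"
    "Dst (Some Q) = Dst (parent Q) + 2 ^ fst Q" "parent Q = Some A \<Longrightarrow> whit A"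
  using is_parent[OF assms] by (simp_all add: is_parent_def link_def)

lemma Dst_lower: "whit Q \<Longrightarrow> 2 ^ fst Q \<le> Dst (Some Q)"
  using door_props(5)[of Q] by simp

lemma open_tree_dom: "open tree_dom"
  unfolding tree_dom_def bulge_def using closed_closed_box
  by (intro open_Un open_UN ballI open_osq open_ball) (simp add: open_Compl)

lemma bulge_subset: "whit Q \<Longrightarrow> bulge Q \<subseteq> tree_dom"
  unfolding tree_dom_def by blast

lemma K_subset_open_box: "K \<subseteq> open_box"
proof
  fix x assume "x \<in> K"
  then have "cmod x < 1/2" using K_small by auto
  then show "x \<in> open_box" using abs_Re_le_cmod[of x] abs_Im_le_cmod[of x] by (simp add: open_box_def)
qed

lemma cell_not_K: "(\<And>A. X = Some A \<Longrightarrow> whit A) \<Longrightarrow> cell X \<inter> K = {}"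
  using K_subset_open_box whit_not_K by (cases X) auto

lemma tree_dom_not_K: "tree_dom \<inter> K = {}"
proof -
  have "bulge Q \<inter> K = {}" if Q: "whit Q" for Q
    using door_props(3)[OF Q] cell_not_K[OF door_props(6)[OF Q]] whit_not_K[OF Q] osq_subset_dsq[of Q]
    unfolding bulge_def by blast
  then show ?thesis unfolding tree_dom_def using K_subset_open_box open_box_subset by blast
qed

text \<open>A point off K near k is outside the box or lies in a Whitney square whose side is at
  most a quarter of its distance to k. The centre of that square is then near k as well, and it
  belongs to the tree domain.\<close>

lemma frontier_K_subset: "frontier K \<subseteq> closure tree_dom"
proof
  fix k assume k: "k \<in> frontier K"
  have kK: "k \<in> K" using k compact_imp_closed[OF compact_K] frontier_subset_closed by blast
  have "k \<in> closure (- K)" using k by (simp add: frontier_closures)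
  show "k \<in> closure tree_dom"
    unfolding closure_approachable
  proof (intro allI impI)
    fix e :: real assume "e > 0"
    then obtain w where w: "w \<notin> K" "dist w k < e / 2"
      using \<open>k \<in> closure (- K)\<close> unfolding closure_approachable by (metis ComplD half_gt_zero)
    show "\<exists>y\<in>tree_dom. dist y k < e"
    proof (cases "w \<in> closed_box")
      case True
      then obtain Q where Q: "whit Q" "w \<in> dsq Q" using whit_cover w(1) by blast
      have "4 * side Q \<le> dist w k" using whit_lower[OF Q] infdist_le[OF kK, of w] by linarith
      then have "dist (cen Q) k < e"
        using dist_cen[OF Q(2)] dist_triangle3[of "cen Q" k w] w(2) side_pos[of Q] by linarith
      moreover have "cen Q \<in> tree_dom" using bulge_subset[OF Q(1)] cen_mem_osq[of Q] by (auto simp: bulge_def)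
      ultimately show ?thesis by blast
    next
      case False
      then have "w \<in> tree_dom" by (simp add: tree_dom_def)
      then show ?thesis using w(2) \<open>e > 0\<close> by (intro bexI[of _ w]) auto
    qed
  qed
qed

text \<open>The 4 comes from dist (cen A) (cen Q) <= 4 * side Q for a parent A of Q; the square
  comes from bounding both D(A) and D(Q) by \<open>chain_const\<close> / side Q.\<close>

definition telescope_const :: real where "telescope_const = 4 * chain_const^2"
text \<open>100 / 24 exceeds 4, since points on the two segments through a door are within 4 * side
  Q of \<open>cen Q\<close> and keep a disc of radius side Q / 24. 48 = 2 * 24 serves the outer ray,
  where the radius is (s - 1) / 2 with s - 1 >= side Q / 24.\<close>

definition John_const :: real where "John_const = 100 + 48 * telescope_const"

lemma chain_const_ge_1: "chain_const \<ge> 1"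
proof -
  have "1 * 1 \<le> (6 * (4 * M + 3)) * (24 * (4 * M + 3) + 3)^2"
    using M by (intro mult_mono one_le_power) auto
  then show ?thesis by (simp add: chain_const_def)
qed

lemma telescope_const_pos: "telescope_const > 0" using chain_const_ge_1 by (simp add: telescope_const_def)

lemma telescope_const_Dst:
  assumes "whit Q"
  shows "4 * side Q \<le> telescope_const / Dst (Some Q)" "telescope_const / Dst (Some Q) \<le> telescope_const * side Q" "Dst (Some Q) > 0"
proof -
  define p where "p = (2::real) ^ fst Q"
  have p: "p > 0" "side Q = 1 / p" by (simp_all add: p_def side_def)
  have "real (2 ^ fst Q) \<le> real (Dst (Some Q))" using Dst_lower[OF assms] by (simp only: of_nat_le_iff)
  then have b: "p \<le> Dst (Some Q)" "Dst (Some Q) \<le> chain_const * p"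
    using Dst_upper[OF assms] by (simp_all add: p_def)
  then show pos: "Dst (Some Q) > 0" using p by linarith
  show "telescope_const / Dst (Some Q) \<le> telescope_const * side Q"
    using b(1) p telescope_const_pos by (simp add: frac_le)
  have "4 / p * Dst (Some Q) \<le> 4 / p * (chain_const * p)" using b(2) p by (intro mult_left_mono) auto
  also have "\<dots> = 4 * chain_const" using p by simp
  also have "\<dots> \<le> telescope_const" using chain_const_ge_1 mult_left_mono[of 1 chain_const "4 * chain_const"] by (simp add: telescope_const_def power2_eq_square)
  finally show "4 * side Q \<le> telescope_const / Dst (Some Q)" using pos p by (simp add: pos_le_divide_eq)
qed

text \<open>With p = 1 / side Q and D(Q) = D(A) + p, the difference 1/D(A) - 1/D(Q) equals p / (D(A)
  D(Q)), and both distances are at most \<open>chain_const\<close> * p.\<close>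

lemma telescope:
  assumes "whit Q" "parent Q = Some A"
  shows "dist (cen A) (cen Q) \<le> telescope_const / Dst (Some A) - telescope_const / Dst (Some Q)" "side A \<le> 3 * side Q"
proof -
  have wA: "whit A" using door_props(6)[OF assms] .
  have dm: "door Q \<in> dsq Q" "door Q \<in> dsq A" using door_props(1,2)[OF assms(1)] assms(2) by auto
  show cmp: "side A \<le> 3 * side Q" using whit_side_comparable[OF wA assms(1) dm(2,1)] .
  have "dist (cen A) (cen Q) \<le> dist (door Q) (cen A) + dist (door Q) (cen Q)"
    by (rule dist_triangle3)
  then have le: "dist (cen A) (cen Q) \<le> 4 * side Q" using dist_cen[OF dm(1)] dist_cen[OF dm(2)] cmp by linarith
  define p a where "p = (2::real) ^ fst Q" and "a = real (Dst (Some A))"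
  define b where "b = real (Dst (Some Q))"
  have p: "p > 0" "side Q = 1 / p" by (simp_all add: p_def side_def)
  have b: "b = a + p" using door_props(5)[OF assms(1)] assms(2) by (simp add: a_def b_def p_def)
  have a: "a > 0" using telescope_const_Dst(3)[OF wA] by (simp add: a_def)
  have bL: "b \<le> chain_const * p" using Dst_upper[OF assms(1)] by (simp add: b_def p_def)
  have "4 * side Q = telescope_const * p / ((chain_const * p) * (chain_const * p))"
    using p chain_const_ge_1 by (simp add: telescope_const_def power2_eq_square)
  also have "\<dots> \<le> telescope_const * p / (a * b)"
    using a b bL p telescope_const_pos chain_const_ge_1 by (intro divide_left_mono mult_mono mult_pos_pos) auto
  also have "\<dots> = telescope_const / a - telescope_const / b" using a p by (simp add: b field_simps)
  finally show "dist (cen A) (cen Q) \<le> telescope_const / Dst (Some A) - telescope_const / Dst (Some Q)"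
    using le unfolding a_def b_def by linarith
qed

lemma ray_path_connected: "path_connected ((\<lambda>s. s *\<^sub>R (u::complex)) ` {1..})"
  by (intro path_connected_continuous_image continuous_intros convex_imp_path_connected) auto

text \<open>The summand \<open>telescope_const / Dst (Some Q)\<close> absorbs, by the lemma \<open>telescope\<close>, the shift of the centre from
  the parent to \<open>Q\<close>; this keeps the constants fixed along the induction.\<close>

lemma carrot_centre:
  assumes "whit Q"
  shows "\<exists>P m. path_connected P \<and> cen Q \<in> P \<and> door Q \<in> P \<and> m \<noteq> 0 \<and> (\<lambda>s. s *\<^sub>R m) ` {1..} \<subseteq> P \<and>
    (\<forall>x\<in>P. ball x ((dist x (cen Q) + telescope_const / Dst (Some Q)) / John_const) \<subseteq> tree_dom)"
  using assms
proof (induction "Dst (Some Q)" arbitrary: Q rule: less_induct)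
  case less
  note wQ = \<open>whit Q\<close>
  let ?m = "door Q" and ?s = "side Q"
  let ?r = "\<lambda>x. (dist x (cen Q) + telescope_const / Dst (Some Q)) / John_const"
  have John_const: "John_const > 0" using telescope_const_pos by (simp add: John_const_def)
  have sp: "?s > 0" by simp
  have C2s: "telescope_const * ?s > 0" using telescope_const_pos by simp
  have dbl: "ball ?m (?s / 6) \<subseteq> tree_dom" "osq Q \<subseteq> tree_dom"
    using bulge_subset[OF wQ] by (auto simp: bulge_def)
  \<comment> \<open>Replaces the term with \<open>Dst\<close> by its bound
    \<open>telescope_const\<close> * side Q, so that near Q all lengths are measured in side
    Q.\<close>
  have rad: "?r x \<le> y" if "dist x (cen Q) + telescope_const * ?s \<le> John_const * y" for x y
    using that telescope_const_Dst(2)[OF wQ] John_const by (simp add: pos_divide_le_eq mult.commute)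
  have C1s: "John_const * (?s / 24) = 100 / 24 * ?s + 2 * (telescope_const * ?s)" by (simp add: John_const_def algebra_simps)
  define S where "S = closed_segment ?m (cen Q)"
  have S: "path_connected S" "cen Q \<in> S" "?m \<in> S" by (auto simp: S_def intro: convex_imp_path_connected)
  have Sball: "ball x (?r x) \<subseteq> tree_dom" if x: "x \<in> S" for x
  proof -
    have "dist x (cen Q) \<le> dist ?m (cen Q)" using segment_bound(2)[OF x[unfolded S_def]] by (simp add: dist_norm norm_minus_commute)
    then have "dist x (cen Q) \<le> ?s" using dist_cen[OF door_props(1)[OF wQ]] by simp
    then have "?r x \<le> ?s / 24" using C1s C2s sp by (intro rad) linarith
    then have "ball x (?r x) \<subseteq> ball x (?s / 24)" by (rule subset_ball)
    also have "\<dots> \<subseteq> osq Q \<union> ball ?m (?s / 6)"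
      using door_segment_ball[OF door_props(1)[OF wQ] x[unfolded S_def], of "?s / 24"] by simp
    finally show ?thesis using dbl by blast
  qed
  show ?case
  proof (cases "parent Q")
    case None
    have mout: "?m \<notin> open_box" using door_props(2)[OF wQ] None by simp
    have mnorm: "1 \<le> cmod ?m" using mout abs_Re_le_cmod[of ?m] abs_Im_le_cmod[of ?m] by (auto simp: open_box_def)
    have mnorm2: "cmod ?m \<le> 2" using closed_box_norm whit_subset_box[OF wQ] door_props(1)[OF wQ] by blast
    define R where "R = (\<lambda>s. s *\<^sub>R ?m) ` {1..}"
    have "?m \<in> R" unfolding R_def by (rule image_eqI[of _ _ 1]) auto
    then have "path_connected (S \<union> R)" using S ray_path_connected unfolding R_def by (intro path_connected_Un) auto
    moreover have "ball x (?r x) \<subseteq> tree_dom" if x: "x \<in> R" for x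
    proof -
      obtain s where s: "s \<ge> 1" "x = s *\<^sub>R ?m" using x by (auto simp: R_def)
      have "x - ?m = (s - 1) *\<^sub>R ?m" by (simp add: s(2) algebra_simps)
      then have xm: "dist x ?m = (s - 1) * cmod ?m" using s(1) by (simp add: dist_norm)
      also have "\<dots> \<le> (s - 1) * 2" using mnorm2 s(1) by (intro mult_left_mono) auto
      finally have xm2: "dist x ?m \<le> (s - 1) * 2" .
      then have xc: "dist x (cen Q) \<le> (s - 1) * 2 + ?s"
        using dist_cen[OF door_props(1)[OF wQ]] dist_triangle[of x "cen Q" ?m] by linarith
      \<comment> \<open>Close to the rim the door disc provides the room, farther out the exterior
        of the box.\<close>
      show ?thesis
      proof (cases "s - 1 \<ge> ?s / 24")
        case True
        have "telescope_const * ?s \<le> telescope_const * (24 * (s - 1))" using True telescope_const_pos by (intro mult_left_mono) auto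
        moreover have "John_const * ((s - 1) / 2) = 50 * (s - 1) + telescope_const * (24 * (s - 1))" by (simp add: John_const_def field_simps)
        moreover have "dist x (cen Q) \<le> 50 * (s - 1)" using True xc sp by argo
        then have "dist x (cen Q) + telescope_const * ?s \<le> 50 * (s - 1) + telescope_const * (24 * (s - 1))"
          using calculation(1) by (rule add_mono)
        ultimately have "?r x \<le> (s - 1) / 2" by (intro rad) (simp only:)
        also have "\<dots> \<le> (s - 1) * (cmod ?m / 2)" using mnorm s(1) mult_left_mono[of 1 "cmod ?m" "(s - 1) / 2"] by simp
        finally have "ball x (?r x) \<subseteq> ball x ((s - 1) * (cmod ?m / 2))" by (rule subset_ball)
        then show ?thesis using ray_ball_outside[OF mout s(1)] s(2) unfolding tree_dom_def by blast
      next
        case False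
        have "John_const * (?s / 12) = 100 / 12 * ?s + 4 * (telescope_const * ?s)" by (simp add: John_const_def algebra_simps)
        then have r12: "?r x \<le> ?s / 12" using False xc sp C2s by (intro rad) argo
        have "ball x (?r x) \<subseteq> ball ?m (?s / 6)"
        proof
          fix z assume "z \<in> ball x (?r x)"
          then have "dist x z < ?s / 12" using r12 by (simp only: mem_ball)
          then have "dist ?m z < ?s / 6" using dist_triangle3[of ?m z x] xm2 False by argo
          then show "z \<in> ball ?m (?s / 6)" by simp
        qed
        then show ?thesis using dbl by blast
      qed
    qed
    moreover have "?m \<noteq> 0" using mnorm by auto
    ultimately show ?thesis using S Sball
      by (intro exI[of _ "S \<union> R"] exI[of _ ?m]) (auto simp: R_def)
  next
    case (Some A)
    have wA: "whit A" using door_props(6)[OF wQ Some] .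
    have "Dst (Some A) < Dst (Some Q)" using door_props(5)[OF wQ] Some by simp
    then obtain P m where P: "path_connected P" "cen A \<in> P" "m \<noteq> 0" "(\<lambda>s. s *\<^sub>R m) ` {1..} \<subseteq> P"
      and Pb: "\<And>x. x \<in> P \<Longrightarrow> ball x ((dist x (cen A) + telescope_const / Dst (Some A)) / John_const) \<subseteq> tree_dom"
      using less.hyps[OF _ wA] by blast
    note tel = telescope[OF wQ Some]
    have mA: "?m \<in> dsq A" using door_props(2)[OF wQ] Some by simp
    define S' where "S' = closed_segment ?m (cen A)"
    have S': "path_connected S'" "cen A \<in> S'" "?m \<in> S'" by (auto simp: S'_def intro: convex_imp_path_connected)
    have "path_connected (S' \<union> P)" using S' P by (intro path_connected_Un) auto
    then have "path_connected (S \<union> (S' \<union> P))" using S(3) S'(3) by (intro path_connected_Un[OF S(1)]) auto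
    moreover have "ball x (?r x) \<subseteq> tree_dom" if x: "x \<in> P" for x
    proof -
      have "dist x (cen Q) \<le> dist x (cen A) + dist (cen A) (cen Q)" by (rule dist_triangle)
      then have "?r x \<le> (dist x (cen A) + telescope_const / Dst (Some A)) / John_const"
        using tel(1) John_const by (intro divide_right_mono) auto
      then have "ball x (?r x) \<subseteq> ball x ((dist x (cen A) + telescope_const / Dst (Some A)) / John_const)" by (rule subset_ball)
      then show ?thesis using Pb[OF x] by blast
    qed
    moreover have "ball x (?r x) \<subseteq> tree_dom" if x: "x \<in> S'" for x
    proof -
      have "dist x ?m \<le> dist ?m (cen A)" using segment_bound(1)[OF x[unfolded S'_def]] by (simp add: dist_norm norm_minus_commute)
      then have "dist x (cen Q) \<le> 4 * ?s"
        using dist_cen[OF mA] tel(2) dist_cen[OF door_props(1)[OF wQ]] dist_triangle[of x "cen Q" ?m] by linarith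
      then have "?r x \<le> ?s / 24" using C1s C2s sp by (intro rad) linarith
      then have "ball x (?r x) \<subseteq> ball x (?s / 24)" by (rule subset_ball)
      also have "\<dots> \<subseteq> osq A \<union> ball ?m (?s / 6)"
        using door_segment_ball[OF mA x[unfolded S'_def], of "?s / 24"] by simp
      finally show ?thesis using dbl bulge_subset[OF wA] by (auto simp: bulge_def)
    qed
    ultimately show ?thesis using S P(3,4) Sball
      by (intro exI[of _ "S \<union> (S' \<union> P)"] exI[of _ m]) blast
  qed
qed

text \<open>Inside the box a segment leads from u to the centre of its square or, in a door disc, to
  the door, and a path of \<open>carrot_centre\<close> continues from there. On that path the
  summand \<open>telescope_const\<close> / D(Q) >= 4 * side Q pays for the distance from u to
  \<open>cen Q\<close>, which is at most 2 * side Q.\<close>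

theorem tree_dom_John:
  assumes "u \<in> tree_dom"
  shows "\<exists>P m. path_connected P \<and> u \<in> P \<and> P \<subseteq> tree_dom \<and> m \<noteq> 0 \<and> (\<lambda>s. s *\<^sub>R m) ` {1..} \<subseteq> P \<and>
    (\<forall>x\<in>P. ball x (dist x u / John_const) \<subseteq> tree_dom)"
proof -
  have John_const: "John_const \<ge> 2" using telescope_const_pos by (simp add: John_const_def)
  have inner: ?thesis
    if Q: "whit Q" and c: "c \<in> {cen Q, door Q}" and uc: "dist u c \<le> side Q"
      and seg: "\<And>x. x \<in> closed_segment u c \<Longrightarrow> ball x (dist x u / 2) \<subseteq> tree_dom \<and> x \<in> tree_dom" for Q c
  proof -
    obtain P m where P: "path_connected P" "cen Q \<in> P" "door Q \<in> P" "m \<noteq> 0" "(\<lambda>s. s *\<^sub>R m) ` {1..} \<subseteq> P"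
      and Pb: "\<And>x. x \<in> P \<Longrightarrow> ball x ((dist x (cen Q) + telescope_const / Dst (Some Q)) / John_const) \<subseteq> tree_dom"
      using carrot_centre[OF Q] by metis
    have "dist c (cen Q) \<le> side Q" using c dist_cen[OF door_props(1)[OF Q]] side_pos[of Q] by (auto simp: less_imp_le)
    then have b: "dist x u \<le> dist x (cen Q) + telescope_const / Dst (Some Q)" for x
      using uc telescope_const_Dst(1)[OF Q] dist_triangle[of x u "cen Q"] dist_triangle[of "cen Q" u c] side_pos[of Q]
      unfolding dist_commute[of "cen Q" c] dist_commute[of c u] by argo
    have "path_connected (closed_segment u c \<union> P)"
      using c P(2,3) by (intro path_connected_Un[OF _ P(1)]) (auto intro: convex_imp_path_connected)
    moreover have "ball x (dist x u / John_const) \<subseteq> tree_dom" if x: "x \<in> P" for x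
    proof -
      have "dist x u / John_const \<le> (dist x (cen Q) + telescope_const / Dst (Some Q)) / John_const" using b John_const by (intro divide_right_mono) auto
      then show ?thesis using Pb[OF x] subset_ball by blast
    qed
    moreover have "x \<in> tree_dom" if x: "x \<in> P" for x
    proof -
      have "telescope_const / Dst (Some Q) > 0" using telescope_const_pos telescope_const_Dst(3)[OF Q] by simp
      then have "(dist x (cen Q) + telescope_const / Dst (Some Q)) / John_const > 0" using John_const by (rule_tac divide_pos_pos[OF add_nonneg_pos[OF zero_le_dist]]) linarith+
      then show ?thesis using Pb[OF x] by (meson centre_in_ball subsetD)
    qed
    moreover have "ball x (dist x u / John_const) \<subseteq> tree_dom" if x: "x \<in> closed_segment u c" for x
    proof -
      have "dist x u / John_const \<le> dist x u / 2" using John_const by (intro divide_left_mono) auto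
      then show ?thesis using seg[OF x] subset_ball by blast
    qed
    ultimately show ?thesis using P(4,5) seg
      by (intro exI[of _ "closed_segment u c \<union> P"] exI[of _ m]) blast
  qed
  have segd: "dist x u = t * dist c u" if "x = (1 - t) *\<^sub>R u + t *\<^sub>R c" "0 \<le> t" for x c t
  proof -
    have "x - u = t *\<^sub>R (c - u)" by (simp add: that(1) algebra_simps)
    then show ?thesis using that(2) by (simp add: dist_norm)
  qed
  consider "u \<notin> closed_box" | Q where "whit Q" "u \<in> osq Q" | Q where "whit Q" "u \<in> ball (door Q) (side Q / 6)"
    using assms by (auto simp: tree_dom_def bulge_def)
  then show ?thesis
  proof cases
    case 1
    have u: "u \<notin> open_box" "u \<noteq> 0" using 1 open_box_subset by (auto simp: closed_box_def)
    have *: "ball x (dist x u / John_const) \<subseteq> tree_dom \<and> x \<in> tree_dom" if x: "x \<in> (\<lambda>s. s *\<^sub>R u) ` {1..}" for x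
    proof -
      obtain s where s: "s \<ge> 1" "x = s *\<^sub>R u" using x by auto
      have "x - u = (s - 1) *\<^sub>R u" by (simp add: s(2) algebra_simps)
      then have d: "dist x u = (s - 1) * cmod u" using s(1) by (simp add: dist_norm)
      have "dist x u / John_const \<le> dist x u / 2" using John_const by (intro divide_left_mono) auto
      then have "ball x (dist x u / John_const) \<subseteq> ball x ((s - 1) * (cmod u / 2))" unfolding d by (intro subset_ball) simp
      moreover have "x \<notin> closed_box"
      proof (cases "s = 1")
        case False
        then have "x \<in> ball (s *\<^sub>R u) ((s - 1) * (cmod u / 2))" using s u by simp
        then show ?thesis using ray_ball_outside[OF u(1) s(1)] by blast
      qed (use 1 s in simp)
      ultimately show ?thesis using ray_ball_outside[OF u(1) s(1)] s(2) unfolding tree_dom_def by blast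
    qed
    have "u \<in> (\<lambda>s. s *\<^sub>R u) ` {1..}" by (rule image_eqI[of _ _ 1]) auto
    then show ?thesis using * u(2) ray_path_connected
      by (intro exI[of _ "(\<lambda>s. s *\<^sub>R u) ` {1..}"] exI[of _ u]) blast
  next
    case (2 Q)
    have ud: "u \<in> dsq Q" using 2(2) osq_subset_dsq by (rule subsetD[rotated])
    show ?thesis
    proof (rule inner[OF 2(1), of "cen Q"])
      fix x assume "x \<in> closed_segment u (cen Q)"
      then obtain t where t: "0 \<le> t" "t \<le> 1" "x = (1 - t) *\<^sub>R u + t *\<^sub>R cen Q"
        by (auto simp: closed_segment_def)
      have "dist x u \<le> t * side Q" unfolding segd[OF t(3,1)]
        using dist_cen[OF ud] t(1) by (intro mult_left_mono) (auto simp: dist_commute)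
      then have "ball x (dist x u / 2) \<subseteq> ball x (t * (side Q / 2))" by (intro subset_ball) simp
      moreover have "x \<in> osq Q" unfolding t(3)
        using convexD_alt[OF convex_osq 2(2) cen_mem_osq t(1,2)] .
      ultimately show "ball x (dist x u / 2) \<subseteq> tree_dom \<and> x \<in> tree_dom"
        using osq_segment_ball[OF ud t(1,2)] bulge_subset[OF 2(1)] unfolding t(3) bulge_def by blast
    qed (use dist_cen[OF ud] in auto)
  next
    case (3 Q)
    let ?b = "ball (door Q) (side Q / 6)"
    have b: "?b \<subseteq> tree_dom" using bulge_subset[OF 3(1)] unfolding bulge_def by blast
    have du: "dist (door Q) u < side Q / 6" using 3(2) by simp
    have du': "dist u (door Q) \<le> side Q"
      using du side_pos[of Q] unfolding dist_commute[of u "door Q"] by linarith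
    show ?thesis
    proof (rule inner[OF 3(1), of "door Q"])
      fix x assume "x \<in> closed_segment u (door Q)"
      then obtain t where t: "0 \<le> t" "t \<le> 1" "x = (1 - t) *\<^sub>R u + t *\<^sub>R door Q"
        by (auto simp: closed_segment_def)
      have x1: "dist x u = t * dist (door Q) u" using segd[OF t(3,1)] .
      have "x - door Q = (1 - t) *\<^sub>R (u - door Q)" by (simp add: t(3) algebra_simps)
      then have x2: "dist x (door Q) = (1 - t) * dist (door Q) u" using t(2)
        by (simp add: dist_norm norm_minus_commute)
      have sum: "dist x u + dist x (door Q) = dist (door Q) u" unfolding x1 x2 by (simp add: algebra_simps)
      have "ball x (dist x u) \<subseteq> ?b"
      proof
        fix z assume "z \<in> ball x (dist x u)"
        then show "z \<in> ?b" using sum du dist_triangle3[of "door Q" z x] by simp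
      qed
      moreover have "ball x (dist x u / 2) \<subseteq> ball x (dist x u)" by (rule subset_ball) simp
      moreover have "dist x (door Q) < side Q / 6" using sum du zero_le_dist[of x u] by linarith
      then have "x \<in> ?b" by (simp add: dist_commute)
      ultimately show "ball x (dist x u / 2) \<subseteq> tree_dom \<and> x \<in> tree_dom" using b by blast
    qed (use du' in auto)
  qed
qed

end

section \<open>Continuous logarithms on the tree domain\<close>

text \<open>The values lie in the discrete set of multiples of 2 pi i. Applied to the difference of
  two continuous logarithms of one function.\<close>

lemma exp_eq_one_constant:
  fixes f :: "complex \<Rightarrow> complex"
  assumes "connected S" "continuous_on S f" "\<And>x. x \<in> S \<Longrightarrow> exp (f x) = 1"
  shows "\<exists>c. exp c = 1 \<and> (\<forall>x\<in>S. f x = c)"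
proof (cases "S = {}")
  case True
  then show ?thesis by (intro exI[of _ 0]) auto
next
  case False
  have "f constant_on S"
  proof (rule continuous_discrete_range_constant[OF assms(1,2)])
    fix x assume x: "x \<in> S"
    have "2 * pi \<le> norm (f y - f x)" if "y \<in> S" "f y \<noteq> f x" for y
    proof -
      have "exp (f y - f x) = 1" using assms(3) x that(1) by (simp add: exp_diff)
      then obtain n :: int where n: "f y - f x = of_int (2 * n) * of_real pi * \<i>"
        unfolding exp_eq_1 by (metis complex_eq_iff Im_complex_of_real Im_i_times Re_complex_of_real Re_i_times
          mult.commute mult_zero_right of_real_mult of_real_of_int_eq neg_0_equal_iff_equal)
      have "n \<noteq> 0" using n that(2) by auto
      then have "1 \<le> \<bar>real_of_int n\<bar>" by linarith
      then have "2 * pi * 1 \<le> 2 * pi * \<bar>real_of_int n\<bar>" by (intro mult_left_mono) auto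
      also have "\<dots> = norm (f y - f x)" unfolding n by (simp add: norm_mult)
      finally show ?thesis by simp
    qed
    then show "\<exists>e>0. \<forall>y. y \<in> S \<and> f y \<noteq> f x \<longrightarrow> e \<le> norm (f y - f x)"
      by (intro exI[of _ "2 * pi"]) auto
  qed
  then obtain c where c: "\<And>x. x \<in> S \<Longrightarrow> f x = c" unfolding constant_on_def by blast
  then show ?thesis using False assms(3) by (intro exI[of _ c]) auto
qed

lemma cell_dense:
  assumes "open N" "x \<in> N" "x \<in> cell X"
  shows "\<exists>y \<in> N. y \<in> region X"
proof (cases X)
  case (Some Q)
  then show ?thesis using open_meets_osq assms by auto
next
  case None
  then have x: "x \<notin> open_box" using assms(3) by simp
  obtain e where e: "e > 0" "ball x e \<subseteq> N" using assms(1,2) open_contains_ball by blast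
  have n: "cmod x > 0" using x by (auto simp: open_box_def)
  define s where "s = 1 + e / (2 * cmod x)"
  have s: "s > 1" using e n by (simp add: s_def)
  have "s *\<^sub>R x - x = (e / (2 * cmod x)) *\<^sub>R x" by (simp add: s_def algebra_simps)
  then have "dist x (s *\<^sub>R x) = e / 2" using e n by (simp add: dist_norm norm_minus_commute[of x])
  then have "s *\<^sub>R x \<in> N" using e by (intro subsetD[OF e(2)]) simp
  moreover have "s *\<^sub>R x \<in> - closed_box"
    using ray_ball_outside[OF x, of s] s n by (intro subsetD[OF ray_ball_outside[OF x, of s]]) auto
  ultimately show ?thesis using None by auto
qed

text \<open>Every rim point of the box has points outside the box arbitrarily near, so an open
  subset of the closed box avoids the rim.\<close>

lemma osq_subset_open_box: assumes "inbox Q" shows "osq Q \<subseteq> open_box"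
proof
  fix x assume x: "x \<in> osq Q"
  show "x \<in> open_box"
  proof (rule ccontr)
    assume "x \<notin> open_box"
    then obtain y where "y \<in> osq Q" "y \<notin> closed_box"
      using cell_dense[of "osq Q" x None] open_osq x by auto
    then show False using inbox_subset[OF assms] osq_subset_dsq by blast
  qed
qed

context planar_John
begin

lemma bulge_open: "open (bulge Q)"
  unfolding bulge_def by (intro open_Un open_osq open_ball)

lemma bulge_contractible: assumes "whit Q" shows "contractible (bulge Q)"
proof (rule starlike_imp_contractible)
  let ?m = "door Q"
  have "closed_segment ?m x \<subseteq> bulge Q" if x: "x \<in> bulge Q" for x
  proof (cases "x \<in> ball ?m (side Q / 6)")
    case True
    then have "closed_segment ?m x \<subseteq> ball ?m (side Q / 6)" by (intro closed_segment_subset) auto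
    then show ?thesis by (auto simp: bulge_def)
  next
    case False
    then have xo: "x \<in> osq Q" using x by (auto simp: bulge_def)
    show ?thesis
    proof
      fix y assume "y \<in> closed_segment ?m x"
      then obtain t where t: "0 \<le> t" "t \<le> 1" "y = (1 - t) *\<^sub>R ?m + t *\<^sub>R x"
        by (auto simp: closed_segment_def)
      show "y \<in> bulge Q"
      proof (cases "t = 0")
        case True
        then show ?thesis using t(3) by (simp add: bulge_def)
      next
        case False
        then have "y \<in> osq Q" using osq_mix[OF door_props(1)[OF assms] xo] t by simp
        then show ?thesis by (simp add: bulge_def)
      qed
    qed
  qed
  moreover have "?m \<in> bulge Q" by (simp add: bulge_def)
  ultimately show "starlike (bulge Q)" unfolding starlike_def by blast
qed

lemma region_cell_disjoint:
  assumes "\<And>A. X = Some A \<Longrightarrow> whit A" "\<And>B. Y = Some B \<Longrightarrow> whit B" "X \<noteq> Y"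
  shows "region Y \<inter> cell X = {}"
proof (cases Y)
  case None
  then obtain A where A: "X = Some A" "whit A" using assms by (cases X) auto
  then show ?thesis using None whit_subset_box[OF A(2)] by auto
next
  case (Some B)
  then have B: "whit B" using assms by blast
  show ?thesis
  proof (cases X)
    case None
    have "inbox B" using whit_good[OF B] by (simp add: good_def)
    then show ?thesis using Some None osq_subset_open_box[of B] by auto
  next
    case (Some A)
    then show ?thesis using \<open>Y = Some B\<close> assms whit_disjoint[OF B, of A] by auto
  qed
qed

text \<open>Attaching a square to its parent closes no cycle, so one additive constant per square
  suffices and no monodromy condition arises. The values \<open>h0\<close> on the exterior are
  prescribed in order that the logarithm extend to infinity afterwards.\<close>

theorem tree_dom_log:
  fixes f h0 :: "complex \<Rightarrow> complex"
  assumes f: "continuous_on tree_dom f" "\<And>x. x \<in> tree_dom \<Longrightarrow> f x \<noteq> 0"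
    and h0: "continuous_on (- closed_box) h0" "\<And>x. x \<in> - closed_box \<Longrightarrow> f x = exp (h0 x)"
  shows "\<exists>g. continuous_on tree_dom g \<and> (\<forall>x\<in>tree_dom. f x = exp (g x)) \<and> (\<forall>x\<in>- closed_box. g x = h0 x)"
proof -
  define ref where "ref h X = (case X of None \<Rightarrow> h0 | Some A \<Rightarrow> h A)"
    for h :: "dyadic \<Rightarrow> complex \<Rightarrow> complex" and X
  define dom where "dom X = (case X of None \<Rightarrow> - closed_box | Some A \<Rightarrow> bulge A)" for X :: "dyadic option"
  \<comment> \<open>Agreement is demanded only on the part of the door disc inside the open region
    of the parent. That part is convex, so a single constant achieves it.\<close>
  define P where "P h Q r \<longleftrightarrow> (whit Q \<longrightarrow> continuous_on (bulge Q) r \<and> (\<forall>x\<in>bulge Q. f x = exp (r x)) \<and>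
      (\<forall>x\<in>ball (door Q) (side Q / 6) \<inter> region (parent Q). r x = ref h (parent Q) x))" for h Q r
  \<comment> \<open>Choice by well-founded recursion on \<open>Dst\<close>: the condition on Q
    involves only the function of its parent.\<close>
  have "\<exists>h. \<forall>Q. P h Q (h Q)"
  proof (rule dependent_wf_choice[of "inv_image less_than (\<lambda>Q. Dst (Some Q))"])
    fix h h' :: "dyadic \<Rightarrow> complex \<Rightarrow> complex" and Q r assume eq: "\<And>z. (z, Q) \<in> inv_image less_than (\<lambda>Q. Dst (Some Q)) \<Longrightarrow> h z = h' z"
    show "P h Q r = P h' Q r"
    proof (cases "whit Q")
      case True
      have "ref h (parent Q) = ref h' (parent Q)"
        using door_props(5)[OF True] eq by (cases "parent Q") (auto simp: ref_def)
      then show ?thesis by (simp add: P_def)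
    qed (simp add: P_def)
  next
    fix Q and h :: "dyadic \<Rightarrow> complex \<Rightarrow> complex" assume IH: "\<And>A. (A, Q) \<in> inv_image less_than (\<lambda>Q. Dst (Some Q)) \<Longrightarrow> P h A (h A)"
    show "\<exists>r. P h Q r"
    proof (cases "whit Q")
      case False
      then show ?thesis by (simp add: P_def)
    next
      case Q: True
      have cont: "continuous_on (bulge Q) f" using f(1) bulge_subset[OF Q] by (rule continuous_on_subset)
      obtain l where l: "continuous_on (bulge Q) l" "\<And>x. x \<in> bulge Q \<Longrightarrow> f x = exp (l x)"
        using continuous_logarithm_on_contractible[OF cont bulge_contractible[OF Q]] f(2) bulge_subset[OF Q] by blast
      let ?O = "ball (door Q) (side Q / 6) \<inter> region (parent Q)"
      have rf: "continuous_on (region (parent Q)) (ref h (parent Q)) \<and>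
          (\<forall>x \<in> region (parent Q). f x = exp (ref h (parent Q) x))"
      proof (cases "parent Q")
        case None
        then show ?thesis using h0 by (simp add: ref_def)
      next
        case (Some A)
        then have "P h A (h A)" "whit A" using IH[of A] door_props(5,6)[OF Q] by auto
        then show ?thesis using continuous_on_subset[of "bulge A" "h A" "osq A"] Some
          by (auto simp: P_def ref_def bulge_def)
      qed
      have "connected ?O" using door_props(4)[OF Q] by (rule convex_connected)
      moreover have Ob: "?O \<subseteq> bulge Q" "?O \<subseteq> region (parent Q)" by (auto simp: bulge_def)
      then have "continuous_on ?O (\<lambda>x. l x - ref h (parent Q) x)"
        using l(1) rf by (intro continuous_on_diff) (auto intro: continuous_on_subset)
      moreover have "exp (l x - ref h (parent Q) x) = 1" if "x \<in> ?O" for x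
      proof -
        have "exp (l x) = exp (ref h (parent Q) x)" using l(2) rf Ob that by (metis subsetD)
        then show ?thesis by (simp add: exp_diff)
      qed
      ultimately obtain c where c: "exp c = 1" "\<forall>x\<in>?O. l x - ref h (parent Q) x = c"
        using exp_eq_one_constant[of ?O "\<lambda>x. l x - ref h (parent Q) x"] by blast
      have "P h Q (\<lambda>x. l x - c)"
        unfolding P_def
      proof (intro impI conjI ballI)
        show "continuous_on (bulge Q) (\<lambda>x. l x - c)" by (intro continuous_intros l(1))
        show "f x = exp (l x - c)" if "x \<in> bulge Q" for x using l(2)[OF that] c(1) by (simp add: exp_diff)
        show "l x - c = ref h (parent Q) x" if "x \<in> ?O" for x using c(2) that by (simp add: algebra_simps)
      qed
      then show ?thesis by blast
    qed
  qed (rule wf_inv_image[OF wf_less_than])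
  then obtain h where "\<And>Q. P h Q (h Q)" by blast
  then have h: "continuous_on (bulge Q) (h Q)" "\<And>x. x \<in> bulge Q \<Longrightarrow> f x = exp (h Q x)"
     "\<And>x. x \<in> ball (door Q) (side Q / 6) \<Longrightarrow> x \<in> region (parent Q) \<Longrightarrow> h Q x = ref h (parent Q) x"
     if "whit Q" for Q
    using that unfolding P_def by blast+
  define I where "I = insert None (Some ` Collect whit)"
  have I: "whit A" if "X \<in> I" "X = Some A" for X A using that by (auto simp: I_def)
  have opD: "open (dom X)" for X using closed_closed_box bulge_open by (cases X) (auto simp: dom_def)
  have reg: "region X \<subseteq> dom X" for X by (cases X) (auto simp: dom_def bulge_def)
  have cD: "continuous_on (dom X) (ref h X)" if "X \<in> I" for X
    using I[OF that] h(1) h0(1) by (cases X) (auto simp: dom_def ref_def)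
  have eD: "f x = exp (ref h X x)" if "X \<in> I" "x \<in> dom X" for X x
    using I[OF that(1)] h(2) h0(2) that(2) by (cases X) (auto simp: dom_def ref_def)
  \<comment> \<open>A piece enters the open region of another cell only through its door disc, and
    only if that cell is its parent.\<close>
  have agree1: "ref h X x = ref h Y x" if X: "X \<in> I" and Y: "Y \<in> I" and x: "x \<in> dom X" "x \<in> region Y" for X Y x
  proof (cases "X = Y")
    case False
    note dj = region_cell_disjoint[OF I[OF X] I[OF Y] False]
    show ?thesis
    proof (cases X)
      case None
      then have "x \<in> cell X" using x(1) open_box_subset by (auto simp: dom_def)
      then show ?thesis using dj x(2) by blast
    next
      case (Some Q)
      then have Q: "whit Q" using I X by blast
      have "x \<notin> dsq Q" using dj x(2) Some by auto
      then have xb: "x \<in> ball (door Q) (side Q / 6)" using x(1) Some osq_subset_dsq[of Q] by (auto simp: dom_def bulge_def)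
      then have xc: "x \<in> cell (parent Q)" using door_props(3)[OF Q] \<open>x \<notin> dsq Q\<close> by blast
      have "parent Q = Y"
        using region_cell_disjoint[of "parent Q" Y] door_props(6)[OF Q] I[OF Y] xc x(2) by blast
      then show ?thesis using h(3)[OF Q xb] x(2) Some by (simp add: ref_def)
    qed
  qed simp
  have cover: "\<exists>Y\<in>I. x \<in> cell Y" if X: "X \<in> I" and x: "x \<in> dom X" for X x
  proof (cases X)
    case None
    then show ?thesis using x open_box_subset by (intro bexI[of _ None]) (auto simp: I_def dom_def)
  next
    case (Some Q)
    then have Q: "whit Q" using I X by blast
    have "x \<in> cell (Some Q) \<or> x \<in> cell (parent Q)"
      using x Some door_props(3)[OF Q] osq_subset_dsq[of Q] by (auto simp: dom_def bulge_def)
    moreover have "parent Q \<in> I" using door_props(6)[OF Q] by (cases "parent Q") (auto simp: I_def)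
    ultimately show ?thesis using X Some by blast
  qed
  \<comment> \<open>Pieces may overlap in other ways, for instance two door discs in a common
    parent. The set of disagreement is open, so it would meet an open region, where both functions
    agree with the one of that region.\<close>
  have agree: "ref h X x = ref h Y x" if X: "X \<in> I" and Y: "Y \<in> I" and x: "x \<in> dom X" "x \<in> dom Y" for X Y x
  proof (rule ccontr)
    assume ne: "ref h X x \<noteq> ref h Y x"
    let ?D = "dom X \<inter> dom Y"
    define N where "N = ?D \<inter> (\<lambda>x. ref h X x - ref h Y x) -` (- {0})"
    have "continuous_on ?D (\<lambda>x. ref h X x - ref h Y x)"
      using cD[OF X] cD[OF Y] by (intro continuous_on_diff) (auto intro: continuous_on_subset)
    then have opN: "open N" unfolding N_def using opD by (intro continuous_open_preimage) auto
    have xN: "x \<in> N" using ne x by (simp add: N_def)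
    obtain Z where Z: "Z \<in> I" "x \<in> cell Z" using cover[OF X x(1)] by blast
    obtain y where y: "y \<in> N" "y \<in> region Z" using cell_dense[OF opN xN Z(2)] by blast
    then have "ref h X y = ref h Y y" using agree1[OF X Z(1)] agree1[OF Y Z(1)] by (simp add: N_def)
    then show False using y(1) by (simp add: N_def)
  qed
  have tree: "tree_dom = (\<Union>X\<in>I. dom X)" by (auto simp: tree_dom_def I_def dom_def)
  define g where "g x = ref h (SOME X. X \<in> I \<and> x \<in> dom X) x" for x
  have g: "g x = ref h X x" if "X \<in> I" "x \<in> dom X" for X x
  proof -
    have "(SOME X. X \<in> I \<and> x \<in> dom X) \<in> I \<and> x \<in> dom (SOME X. X \<in> I \<and> x \<in> dom X)"
      by (rule someI[of "\<lambda>X. X \<in> I \<and> x \<in> dom X" X]) (use that in simp)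
    then show ?thesis unfolding g_def using agree that by blast
  qed
  show ?thesis
  proof (intro exI conjI ballI)
    show "continuous_on tree_dom g" unfolding tree
    proof (rule continuous_on_open_UN)
      fix X assume X: "X \<in> I"
      show "open (dom X)" by (rule opD)
      show "continuous_on (dom X) g" using continuous_on_cong[of "dom X" "dom X" g "ref h X"] g[OF X] cD[OF X] by simp
    qed
    show "f x = exp (g x)" if "x \<in> tree_dom" for x
      using that g eD unfolding tree by (metis UN_E)
    show "g x = h0 x" if "x \<in> - closed_box" for x
      using g[of None x] that by (simp add: I_def dom_def ref_def)
  qed
qed

end

section \<open>Stereographic charts of the sphere\<close>

definition wt :: "real \<Rightarrow> complex \<Rightarrow> real" where
  "wt R u = sqrt (1 + (R * cmod u)^2)"

lemma wt_ge_1: "wt R u \<ge> 1"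
  by (simp add: wt_def)

lemma wt_pos: "wt R u > 0"
  using wt_ge_1[of R u] by linarith

text \<open>For distinct a and b, reflect in the hyperplane orthogonal to b - a. This isometry moves
  the pole of the stereographic projection to the John centre.\<close>

lemma exists_reflection:
  fixes a b :: "'a::real_inner"
  assumes "norm a = norm b"
  shows "\<exists>T. (\<forall>x y. dist (T x) (T y) = dist x y) \<and> T a = b \<and> (\<forall>x. T (T x) = x) \<and> (\<forall>x. norm (T x) = norm x)"
proof (cases "a = b")
  case True
  then show ?thesis by (intro exI[of _ id]) auto
next
  case False
  define v where "v = b - a"
  define T where "T x = x - (2 * (x \<bullet> v) / (v \<bullet> v)) *\<^sub>R v" for x
  have v: "v \<bullet> v \<noteq> 0" using False by (simp add: v_def)
  have n: "norm (T x) = norm x" for x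
  proof -
    define r where "r = 2 * (x \<bullet> v) / (v \<bullet> v)"
    have rv: "r * (v \<bullet> v) = 2 * (x \<bullet> v)" using v by (simp add: r_def)
    have Tx: "T x = x - r *\<^sub>R v" by (simp add: T_def r_def)
    have "T x \<bullet> T x = x \<bullet> x - 2 * r * (x \<bullet> v) + r * (r * (v \<bullet> v))"
      unfolding Tx by (simp add: inner_diff_left inner_diff_right inner_commute[of v x] algebra_simps)
    then have "T x \<bullet> T x = x \<bullet> x" unfolding rv by simp
    then show ?thesis by (simp add: norm_eq_sqrt_inner)
  qed
  have lin: "T (x - y) = T x - T y" for x y
    by (simp add: T_def inner_diff_left diff_divide_distrib algebra_simps)
  have "2 * (a \<bullet> v) / (v \<bullet> v) = - 1"
  proof -
    have "a \<bullet> a = b \<bullet> b" using assms by (simp add: norm_eq_sqrt_inner)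
    then have "2 * (a \<bullet> v) = - (v \<bullet> v)" by (simp add: v_def inner_diff inner_commute)
    then show ?thesis using v by simp
  qed
  then have "T a = b" by (simp add: T_def v_def)
  moreover have "T (T x) = x" for x
    using v by (simp add: T_def inner_diff_left algebra_simps)
  moreover have "dist (T x) (T y) = dist x y" for x y by (simp add: dist_norm n flip: lin)
  ultimately show ?thesis using n by blast
qed

locale sphere_chart =
  fixes z0 :: "complex \<times> real" and R :: real and \<psi> :: "complex \<Rightarrow> complex \<times> real"
  assumes z0: "z0 \<in> riemann_sphere" and R: "R > 0"
    and bij: "bij_betw \<psi> UNIV (riemann_sphere - {z0})"
    and dist_\<psi>: "\<And>x y. dist (\<psi> x) (\<psi> y) = 2 * R * cmod (x - y) / (wt R x * wt R y)"
    and dist_z0: "\<And>x. dist (\<psi> x) z0 = 2 / wt R x"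

text \<open>One \<psi> serves all scales, because R is chosen only after the complement has been
  measured in the chart with R = 1.\<close>

lemma chart_exists:
  assumes "z0 \<in> riemann_sphere"
  shows "\<exists>\<psi>. \<forall>R>0. sphere_chart z0 R (\<lambda>u. \<psi> (R *\<^sub>R u))"
proof -
  have "norm ((0::complex), (1::real)) = norm z0" using assms by (simp add: riemann_sphere_def norm_Pair)
  from exists_reflection[OF this]
  obtain T where "(\<forall>x y. dist (T x) (T y) = dist x y) \<and> T (0, 1) = z0 \<and> (\<forall>x. T (T x) = x) \<and> (\<forall>x. norm (T x) = norm x)" ..
  then have T: "dist (T x) (T y) = dist x y" "T (0, 1) = z0" "T (T x) = x" "norm (T x) = norm x" for x y
    by blast+
  have S: "T x \<in> riemann_sphere \<longleftrightarrow> x \<in> riemann_sphere" for x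
    using T(4) by (simp add: riemann_sphere_def)
  have injT: "inj T" by (metis T(3) injI)
  have "bij_betw (stereo \<circ> Some) UNIV (riemann_sphere - {(0,1)})"
  proof -
    have "bij_betw stereo (UNIV - {None}) (riemann_sphere - {stereo None})"
      using bij_betw_stereo by (intro bij_betw_DiffI) (auto simp: bij_betw_def riemann_sphere_def norm_Pair)
    moreover have "bij_betw Some UNIV (UNIV - {None :: complex option})"
      by (auto simp: bij_betw_def notin_range_Some)
    ultimately show ?thesis using bij_betw_trans by fastforce
  qed
  moreover have "T ` (riemann_sphere - {(0,1)}) = riemann_sphere - {z0}"
  proof
    show "T ` (riemann_sphere - {(0,1)}) \<subseteq> riemann_sphere - {z0}"
      using S T(2) injT by (auto dest: injD)
    show "riemann_sphere - {z0} \<subseteq> T ` (riemann_sphere - {(0,1)})"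
    proof
      fix x assume "x \<in> riemann_sphere - {z0}"
      then show "x \<in> T ` (riemann_sphere - {(0,1)})"
        using S T(2,3) by (intro image_eqI[of _ _ "T x"]) (auto, metis T(3))
    qed
  qed
  then have "bij_betw T (riemann_sphere - {(0,1)}) (riemann_sphere - {z0})"
    using injT by (auto simp: bij_betw_def intro: inj_on_subset)
  ultimately have b: "bij_betw (T \<circ> (stereo \<circ> Some)) UNIV (riemann_sphere - {z0})"
    by (rule bij_betw_trans)
  have "sphere_chart z0 R (\<lambda>u. (T \<circ> (stereo \<circ> Some)) (R *\<^sub>R u))" if R: "R > 0" for R
  proof
    have "bij (\<lambda>u::complex. R *\<^sub>R u)"
      using R by (intro bij_betw_byWitness[where f' = "\<lambda>u. u /\<^sub>R R"]) auto
    from bij_betw_trans[OF this b]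
    show "bij_betw (\<lambda>u. (T \<circ> (stereo \<circ> Some)) (R *\<^sub>R u)) UNIV (riemann_sphere - {z0})"
      by (simp add: comp_def)
    show "dist ((T \<circ> (stereo \<circ> Some)) (R *\<^sub>R x)) ((T \<circ> (stereo \<circ> Some)) (R *\<^sub>R y)) =
       2 * R * cmod (x - y) / (wt R x * wt R y)" for x y
    proof -
      have "cmod (R *\<^sub>R x - R *\<^sub>R y) = R * cmod (x - y)"
        using R by (simp flip: scaleR_diff_right)
      then show ?thesis unfolding comp_def T(1) dist_stereo using R by (simp add: wt_def)
    qed
    show "dist ((T \<circ> (stereo \<circ> Some)) (R *\<^sub>R x)) z0 = 2 / wt R x" for x
    proof -
      have "dist (T (stereo (Some (R *\<^sub>R x)))) z0 = dist (stereo (Some (R *\<^sub>R x))) (stereo None)"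
        using T(1)[of _ "(0,1)"] T(2) by simp
      also have "\<dots> = 2 / wt R x" unfolding dist_stereo_infinity using R by (simp add: wt_def)
      finally show ?thesis by simp
    qed
  qed (use assms R in auto)
  then show ?thesis by blast
qed

section \<open>The chart and its reciprocal near the centre\<close>

context sphere_chart
begin

abbreviation S where "S \<equiv> riemann_sphere"

definition \<phi> :: "complex \<times> real \<Rightarrow> complex" where "\<phi> = inv_into UNIV \<psi>"

lemma \<phi>_\<psi> [simp]: "\<phi> (\<psi> u) = u"
  unfolding \<phi>_def using bij by (simp add: bij_betw_def)

lemma \<psi>_\<phi>: "p \<in> S - {z0} \<Longrightarrow> \<psi> (\<phi> p) = p"
  unfolding \<phi>_def using bij by (metis bij_betw_def f_inv_into_f)

lemma \<psi>_in: "\<psi> u \<in> S" "\<psi> u \<noteq> z0"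
  using bij by (auto simp: bij_betw_def)

lemma inj_\<psi>: "\<psi> x = \<psi> y \<longleftrightarrow> x = y"
  by (metis \<phi>_\<psi>)

lemma cont_\<psi>: "continuous_on A \<psi>"
proof -
  have "(2 * R)-lipschitz_on A \<psi>"
  proof (rule lipschitz_onI)
    fix x y
    have "2 * R * cmod (x - y) / (wt R x * wt R y) \<le> 2 * R * cmod (x - y) / 1"
      using R wt_ge_1[of R x] wt_ge_1[of R y] mult_mono[of 1 "wt R x" 1 "wt R y"]
      by (intro divide_left_mono) auto
    then show "dist (\<psi> x) (\<psi> y) \<le> 2 * R * dist x y" by (simp only: dist_\<psi> dist_complex_def div_by_1)
  qed (use R in simp)
  then show ?thesis by (rule lipschitz_on_continuous_on)
qed

text \<open>The distance formulas can be solved for the planar distance, in terms of dist q p and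
  the distances of q and p to z0.\<close>

lemma cont_\<phi>: "continuous_on (S - {z0}) \<phi>"
  unfolding continuous_on_def
proof
  fix p assume p: "p \<in> S - {z0}"
  have eq: "dist (\<phi> q) (\<phi> p) = 2 * dist q p / (R * dist q z0 * dist p z0)" if "q \<in> S - {z0}" for q
  proof -
    have e1: "dist q p = 2 * R * cmod (\<phi> q - \<phi> p) / (wt R (\<phi> q) * wt R (\<phi> p))"
      using dist_\<psi>[of "\<phi> q" "\<phi> p"] \<psi>_\<phi> that p by simp
    have e2: "dist q z0 = 2 / wt R (\<phi> q)" "dist p z0 = 2 / wt R (\<phi> p)"
      using dist_z0[of "\<phi> q"] dist_z0[of "\<phi> p"] \<psi>_\<phi> that p by simp_all
    show ?thesis unfolding e1 e2 dist_complex_def using R wt_pos[of R "\<phi> q"] wt_pos[of R "\<phi> p"]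
      by (simp add: field_simps)
  qed
  have "((\<lambda>q. 2 * dist q p / (R * dist q z0 * dist p z0)) \<longlongrightarrow> 2 * dist p p / (R * dist p z0 * dist p z0)) (at p within S - {z0})"
    using R p by (intro tendsto_intros) auto
  then have "((\<lambda>q. 2 * dist q p / (R * dist q z0 * dist p z0)) \<longlongrightarrow> 0) (at p within S - {z0})"
    by simp
  then have "((\<lambda>q. dist (\<phi> q) (\<phi> p)) \<longlongrightarrow> 0) (at p within S - {z0})"
    by (rule Lim_transform_eventually) (auto simp: eventually_at_filter eq)
  then show "(\<phi> \<longlongrightarrow> \<phi> p) (at p within S - {z0})"
    by (simp add: tendsto_dist_iff[symmetric])
qed

definition inv_chart :: "complex \<Rightarrow> complex \<times> real" where "inv_chart v = (if v = 0 then z0 else \<psi> (1 / v))"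

lemma wt_inverse: "v \<noteq> 0 \<Longrightarrow> wt R (1 / v) = sqrt ((cmod v)^2 + R^2) / cmod v"
proof -
  assume v: "v \<noteq> 0"
  have "1 + (R * cmod (1 / v))^2 = ((cmod v)^2 + R^2) / (cmod v)^2"
    using v by (simp add: norm_divide power_mult_distrib power_divide add_divide_distrib)
  then show ?thesis by (simp add: wt_def real_sqrt_divide)
qed

lemma dist_inv_chart: "dist (inv_chart v) (inv_chart v') = 2 * R * cmod (v - v') / (sqrt ((cmod v)^2 + R^2) * sqrt ((cmod v')^2 + R^2))"
proof -
  have z: "dist z0 (\<psi> (1 / v)) = 2 * R * cmod v / (R * sqrt ((cmod v)^2 + R^2))" if "v \<noteq> 0" for v
    using dist_z0[of "1/v"] that R by (simp add: wt_inverse dist_commute)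
  show ?thesis
  proof (cases "v = 0 \<or> v' = 0")
    case True
    then show ?thesis using z[of v] z[of v'] R by (auto simp: inv_chart_def dist_commute mult.commute)
  next
    case False
    have "cmod (1 / v - 1 / v') = cmod (v - v') / (cmod v * cmod v')"
      using False by (simp add: diff_frac_eq norm_divide norm_mult norm_minus_commute)
    then show ?thesis using False by (simp add: inv_chart_def dist_\<psi> wt_inverse)
  qed
qed

lemma cont_inv_chart: "continuous_on A inv_chart"
proof -
  have "(2 / R)-lipschitz_on A inv_chart"
  proof (rule lipschitz_onI)
    fix x y
    have "R \<le> sqrt ((cmod v)^2 + R^2)" for v :: complex using R by (simp add: real_le_rsqrt)
    then have "R * R \<le> sqrt ((cmod x)^2 + R^2) * sqrt ((cmod y)^2 + R^2)"
      using R by (intro mult_mono) (auto intro: order_trans)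
    then have "2 * R * cmod (x - y) / (sqrt ((cmod x)^2 + R^2) * sqrt ((cmod y)^2 + R^2)) \<le> 2 * R * cmod (x - y) / (R * R)"
      using R by (intro divide_left_mono mult_pos_pos) (auto simp: sum_power2_gt_zero_iff add_nonneg_pos)
    also have "\<dots> = 2 / R * cmod (x - y)" using R by simp
    finally show "dist (inv_chart x) (inv_chart y) \<le> 2 / R * dist x y" by (simp only: dist_inv_chart dist_complex_def)
  qed (use R in simp)
  then show ?thesis by (rule lipschitz_on_continuous_on)
qed

text \<open>The weight w = 2 / dist p z0 is at least 2, so (R |\<phi> p|)^2 = w^2 - 1 >= (w / 2)^2.
  This quantifies \<phi> p tending to infinity at z0 and serves for continuity there.\<close>

lemma norm_\<phi>_near:
  assumes "p \<in> S - {z0}" "dist p z0 \<le> 1"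
  shows "cmod (1 / \<phi> p) \<le> R * dist p z0"
proof -
  define \<delta> w where "\<delta> = dist p z0" and "w = wt R (\<phi> p)"
  have \<delta>: "\<delta> = 2 / w" using dist_z0[of "\<phi> p"] \<psi>_\<phi>[OF assms(1)] by (simp add: \<delta>_def w_def)
  have w: "w > 0" using wt_pos by (simp add: w_def)
  have "w \<ge> 2" using assms(2) w unfolding \<delta>_def[symmetric] \<delta> by simp
  have "w^2 = 1 + (R * cmod (\<phi> p))^2" by (simp add: w_def wt_def)
  moreover have "(w/2)^2 + 1 \<le> w^2" using power_mono[OF \<open>w \<ge> 2\<close>, of 2] by (simp add: power_divide)
  ultimately have "(w/2)^2 \<le> (R * cmod (\<phi> p))^2" by simp
  then have "w / 2 \<le> R * cmod (\<phi> p)" using R by (intro power2_le_imp_le[of "w/2"]) auto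
  then have "1 / (R * cmod (\<phi> p)) \<le> 1 / (w / 2)" using w by (intro divide_left_mono) auto
  then have "R * (1 / (R * cmod (\<phi> p))) \<le> R * \<delta>" using R \<delta> by (intro mult_left_mono) auto
  then show ?thesis using R by (simp add: norm_divide \<delta>_def)
qed

text \<open>Shrinking v moves 1 / v away from the origin, hence not back into the box.\<close>

lemma outer_starlike: "starlike {v. v = 0 \<or> 1 / v \<notin> closed_box}"
  unfolding starlike_def
proof (intro bexI[of _ 0] ballI subsetI)
  fix v y assume v: "v \<in> {v. v = 0 \<or> 1 / v \<notin> closed_box}" and "y \<in> closed_segment 0 v"
  then obtain t where t: "0 \<le> t" "t \<le> 1" "y = t *\<^sub>R v" by (auto simp: closed_segment_def)
  show "y \<in> {v. v = 0 \<or> 1 / v \<notin> closed_box}"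
  proof (cases "y = 0")
    case False
    then have t0: "t > 0" "v \<noteq> 0" using t by auto
    then have n: "1 / v \<notin> closed_box" using v by auto
    have "1 / v = t *\<^sub>R (1 / y)" using t0 by (simp add: t(3) scaleR_conv_of_real)
    then have "Re (1 / v) = t * Re (1 / y)" "Im (1 / v) = t * Im (1 / y)" by simp_all
    then have le: "\<bar>Re (1 / v)\<bar> \<le> \<bar>Re (1 / y)\<bar>" "\<bar>Im (1 / v)\<bar> \<le> \<bar>Im (1 / y)\<bar>"
      using t by (simp_all only: abs_mult) (auto intro!: mult_left_le_one_le)
    then have "1 / y \<notin> closed_box" using n unfolding closed_box_def mem_Collect_eq by linarith
    then show ?thesis by simp
  qed simp
qed simp

text \<open>In the reciprocal chart the ray together with its end z0 is a segment ending at
  0.\<close>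

lemma ray_to_pole:
  assumes "m \<noteq> 0"
  shows "path_connected (insert z0 (\<psi> ` ((\<lambda>s. s *\<^sub>R m) ` {1..})))"
proof -
  have "insert z0 (\<psi> ` ((\<lambda>s. s *\<^sub>R m) ` {1..})) = inv_chart ` closed_segment 0 (1 / m)"
  proof
    show "insert z0 (\<psi> ` ((\<lambda>s. s *\<^sub>R m) ` {1..})) \<subseteq> inv_chart ` closed_segment 0 (1 / m)"
    proof
      fix p assume "p \<in> insert z0 (\<psi> ` ((\<lambda>s. s *\<^sub>R m) ` {1..}))"
      then consider "p = z0" | s where "s \<ge> 1" "p = \<psi> (s *\<^sub>R m)" by auto
      then show "p \<in> inv_chart ` closed_segment 0 (1 / m)"
      proof cases
        case 1
        then show ?thesis by (intro image_eqI[of _ _ 0]) (auto simp: inv_chart_def)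
      next
        case 2
        have "(1 / s) *\<^sub>R (1 / m) \<in> closed_segment 0 (1 / m)"
          using 2(1) by (auto simp: closed_segment_def intro!: exI[of _ "1/s"])
        moreover have "inv_chart ((1 / s) *\<^sub>R (1 / m)) = p"
          using 2 assms by (simp add: inv_chart_def scaleR_conv_of_real)
        ultimately show ?thesis by blast
      qed
    qed
    show "inv_chart ` closed_segment 0 (1 / m) \<subseteq> insert z0 (\<psi> ` ((\<lambda>s. s *\<^sub>R m) ` {1..}))"
    proof
      fix p assume "p \<in> inv_chart ` closed_segment 0 (1 / m)"
      then obtain t where t: "0 \<le> t" "t \<le> 1" "p = inv_chart (t *\<^sub>R (1 / m))" by (auto simp: closed_segment_def)
      show "p \<in> insert z0 (\<psi> ` ((\<lambda>s. s *\<^sub>R m) ` {1..}))"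
      proof (cases "t = 0")
        case True
        then show ?thesis using t by (simp add: inv_chart_def)
      next
        case False
        then have "1 \<le> 1 / t" using t by simp
        moreover have "p = \<psi> ((1 / t) *\<^sub>R m)" using False t(3) assms by (simp add: inv_chart_def scaleR_conv_of_real)
        ultimately show ?thesis by blast
      qed
    qed
  qed
  moreover have "path_connected (inv_chart ` closed_segment 0 (1 / m))"
    by (intro path_connected_continuous_image cont_inv_chart convex_imp_path_connected) auto
  ultimately show ?thesis by simp
qed

end

lemma sphere_boundary_openin:
  assumes "openin (top_of_set riemann_sphere) \<Omega>"
  shows "sphere_boundary \<Omega> = closure \<Omega> - \<Omega>" "closure \<Omega> \<subseteq> riemann_sphere"
proof -
  have sub: "\<Omega> \<subseteq> riemann_sphere" using assms openin_imp_subset by blast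
  show cl: "closure \<Omega> \<subseteq> riemann_sphere" using sub by (intro closure_minimal) (auto simp: riemann_sphere_def)
  have "top_of_set riemann_sphere closure_of \<Omega> = closure \<Omega>"
    using sub cl by (simp add: closure_of_subtopology Int_absorb1 Int_absorb2)
  then show "sphere_boundary \<Omega> = closure \<Omega> - \<Omega>"
    using assms by (simp add: sphere_boundary_def frontier_of_def interior_of_openin)
qed

lemma le_infdist:
  assumes "A \<noteq> {}" "\<And>a. a \<in> A \<Longrightarrow> r \<le> dist x a"
  shows "r \<le> infdist x A"
  using assms by (auto simp: infdist_def intro: cINF_greatest)

section \<open>The tree domain on the sphere\<close>

text \<open>For open connected sets in the plane, continuous logarithms characterise simple
  connectivity; a homeomorphism of the sphere minus b with the plane transports this. A chart
  punctured at z0 would not do, as z0 lies in the domain to which the lemma is applied.\<close>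

lemma openin_sphere_simply_connected_log:
  fixes X :: "(complex \<times> real) set"
  assumes X: "openin (top_of_set riemann_sphere) X" "connected X" and b: "b \<in> riemann_sphere - X"
    and log: "\<And>f. continuous_on X f \<Longrightarrow> (\<And>p. p \<in> X \<Longrightarrow> f p \<noteq> 0) \<Longrightarrow>
       \<exists>G :: complex \<times> real \<Rightarrow> complex. continuous_on X G \<and> (\<forall>p\<in>X. f p = exp (G p))"
  shows "simply_connected X"
proof -
  have "(riemann_sphere - {b}) homeomorphic (UNIV :: complex set)" unfolding riemann_sphere_def
    by (rule homeomorphic_punctured_sphere_affine)
       (use b in \<open>auto simp: riemann_sphere_def affine_UNIV aff_dim_UNIV\<close>)
  then obtain i j where hom: "homeomorphism (riemann_sphere - {b}) (UNIV :: complex set) i j"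
    unfolding homeomorphic_def by blast
  have sub: "X \<subseteq> riemann_sphere - {b}" using X(1) b openin_imp_subset by blast
  then have homX: "homeomorphism X (i ` X) i j" using hom
    by (rule_tac homeomorphism_of_subsets[OF hom]) auto
  have "openin (top_of_set (riemann_sphere - {b})) X" using X(1) sub by (rule openin_subset_trans) auto
  then have "openin (top_of_set (UNIV :: complex set)) (i ` X)"
    by (rule homeomorphism_imp_open_map[OF hom])
  then have op: "open (i ` X)" by simp
  have ci: "continuous_on X i" and cj: "continuous_on (i ` X) j"
    using homX by (auto simp: homeomorphism_def)
  have "\<exists>g. continuous_on (i ` X) g \<and> (\<forall>z\<in>i ` X. F z = exp (g z))"
    if F: "continuous_on (i ` X) F" "\<forall>z\<in>i ` X. F z \<noteq> 0" for F :: "complex \<Rightarrow> complex"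
  proof -
    have "continuous_on X (\<lambda>p. F (i p))" by (rule continuous_on_compose2[OF F(1) ci]) auto
    then obtain G where G: "continuous_on X G" "\<forall>p\<in>X. F (i p) = exp (G p)"
      using log[of "\<lambda>p. F (i p)"] F(2) by blast
    have jX: "j z \<in> X" "i (j z) = z" if "z \<in> i ` X" for z
      using homX that by (auto simp: homeomorphism_def)
    show ?thesis
    proof (intro exI conjI ballI)
      show "continuous_on (i ` X) (\<lambda>z. G (j z))" by (rule continuous_on_compose2[OF G(1) cj]) (use jX in auto)
      show "F z = exp (G (j z))" if "z \<in> i ` X" for z using G(2) jX[OF that] by metis
    qed
  qed
  then have "simply_connected (i ` X)"
    using simply_connected_eq_continuous_log[OF op] connected_continuous_image[OF ci X(2)] by blast
  moreover have "X homeomorphic i ` X" using homX homeomorphic_def by blast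
  ultimately show ?thesis using homeomorphic_simply_connected_eq by blast
qed

locale John_tree = sphere_chart z0 R \<psi> + planar_John K M
  for z0 :: "complex \<times> real" and R :: real and \<psi> :: "complex \<Rightarrow> complex \<times> real"
    and K :: "complex set" and M :: real
begin

definition tree_sphere :: "(complex \<times> real) set" where
  "tree_sphere = insert z0 (\<psi> ` tree_dom)"

lemma compl_tree_dom: "- tree_dom \<subseteq> closed_box"
  by (auto simp: tree_dom_def)

lemma sphere_minus_tree: "S - tree_sphere = \<psi> ` (- tree_dom)"
proof
  show "S - tree_sphere \<subseteq> \<psi> ` (- tree_dom)"
  proof
    fix p assume p: "p \<in> S - tree_sphere"
    then have "\<psi> (\<phi> p) = p" by (intro \<psi>_\<phi>) (auto simp: tree_sphere_def)
    moreover have "\<phi> p \<notin> tree_dom" using p calculation unfolding tree_sphere_def by (metis DiffE imageI insertI2)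
    ultimately show "p \<in> \<psi> ` (- tree_dom)" by (metis ComplI imageI)
  qed
  show "\<psi> ` (- tree_dom) \<subseteq> S - tree_sphere"
  proof
    fix p assume "p \<in> \<psi> ` (- tree_dom)"
    then obtain u where u: "u \<notin> tree_dom" "p = \<psi> u" by blast
    then have "p \<notin> \<psi> ` tree_dom" by (auto simp: inj_\<psi>)
    then show "p \<in> S - tree_sphere" using \<psi>_in[of u] u(2) by (simp add: tree_sphere_def)
  qed
qed

lemma openin_tree_sphere: "openin (top_of_set S) tree_sphere"
proof -
  have "bounded closed_box" using closed_box_norm by (auto simp: bounded_iff)
  then have "compact (- tree_dom)"
    using compl_tree_dom open_tree_dom by (auto simp: compact_eq_bounded_closed intro: bounded_subset)
  then have "closed (S - tree_sphere)" unfolding sphere_minus_tree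
    by (intro compact_imp_closed compact_continuous_image cont_\<psi>)
  then have "openin (top_of_set S) (S - (S - tree_sphere))"
    by (intro openin_diff) (auto simp: closedin_closed_Int closedin_closed intro!: exI[of _ "S - tree_sphere"])
  moreover have "S - (S - tree_sphere) = tree_sphere"
    using \<psi>_in z0 by (auto simp: tree_sphere_def)
  ultimately show ?thesis by simp
qed

text \<open>A logarithm is chosen first around z0, on the star-shaped exterior seen in the
  reciprocal chart; \<open>tree_dom_log\<close> then extends it over the tree.\<close>

lemma tree_sphere_log:
  fixes f :: "complex \<times> real \<Rightarrow> complex"
  assumes f: "continuous_on tree_sphere f" and nz: "\<And>p. p \<in> tree_sphere \<Longrightarrow> f p \<noteq> 0"
  shows "\<exists>G. continuous_on tree_sphere G \<and> (\<forall>p\<in>tree_sphere. f p = exp (G p))"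
proof -
  define V where "V = {v :: complex. v = 0 \<or> 1 / v \<notin> closed_box}"
  have V_in: "inv_chart v \<in> tree_sphere" if "v \<in> V" for v
    using that by (auto simp: V_def inv_chart_def tree_sphere_def tree_dom_def)
  then have "continuous_on V (\<lambda>v. f (inv_chart v))"
    by (intro continuous_on_compose2[OF f cont_inv_chart]) auto
  moreover have "contractible V" unfolding V_def by (rule starlike_imp_contractible[OF outer_starlike])
  ultimately obtain h where h: "continuous_on V h" "\<And>v. v \<in> V \<Longrightarrow> f (inv_chart v) = exp (h v)"
    using continuous_logarithm_on_contractible[of V "\<lambda>v. f (inv_chart v)"] nz V_in by metis
  have nzero: "u \<noteq> 0" if "u \<notin> closed_box" for u using that by (auto simp: closed_box_def)
  define h0 where "h0 u = h (1 / u)" for u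
  have ct: "continuous_on tree_dom (\<lambda>u. f (\<psi> u))"
    by (intro continuous_on_compose2[OF f cont_\<psi>]) (auto simp: tree_sphere_def)
  have ch0: "continuous_on (- closed_box) h0" unfolding h0_def
    by (intro continuous_on_compose2[OF h(1)] continuous_intros) (auto simp: V_def nzero)
  have eh0: "f (\<psi> u) = exp (h0 u)" if "u \<in> - closed_box" for u
    using h(2)[of "1 / u"] that nzero[of u] by (simp add: V_def inv_chart_def h0_def)
  have "\<exists>g. continuous_on tree_dom g \<and> (\<forall>x\<in>tree_dom. f (\<psi> x) = exp (g x)) \<and> (\<forall>x\<in>- closed_box. g x = h0 x)"
    by (rule tree_dom_log[OF ct _ ch0 eh0]) (use nz in \<open>auto simp: tree_sphere_def\<close>)
  then obtain g where g: "continuous_on tree_dom g" "\<And>x. x \<in> tree_dom \<Longrightarrow> f (\<psi> x) = exp (g x)"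
     "\<And>x. x \<in> - closed_box \<Longrightarrow> g x = h0 x" by blast
  define G where "G p = (if p = z0 then h 0 else g (\<phi> p))" for p
  have "f p = exp (G p)" if p: "p \<in> tree_sphere" for p
  proof (cases "p = z0")
    case True
    then show ?thesis using h(2)[of 0] by (simp add: V_def inv_chart_def G_def)
  next
    case False
    then obtain u where "u \<in> tree_dom" "p = \<psi> u" using p by (auto simp: tree_sphere_def)
    then show ?thesis using g(2)[of u] False by (simp add: G_def)
  qed
  moreover have "continuous_on tree_sphere G"
    unfolding continuous_on_eq_continuous_within
  proof
    fix p assume p: "p \<in> tree_sphere"
    have sub: "tree_sphere \<subseteq> S" using \<psi>_in z0 by (auto simp: tree_sphere_def)
    show "continuous (at p within tree_sphere) G"
    proof (cases "p = z0")
      case False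
      have "continuous_on (tree_sphere - {z0}) (\<lambda>p. g (\<phi> p))"
        using sub by (intro continuous_on_compose2[OF g(1)] continuous_on_subset[OF cont_\<phi>]) (auto simp: tree_sphere_def)
      then have "continuous_on (tree_sphere - {z0}) G"
        by (rule continuous_on_eq) (simp add: G_def)
      then have "continuous (at p within tree_sphere - {z0}) G"
        using p False by (simp add: continuous_on_eq_continuous_within)
      moreover have "at p within (tree_sphere - {z0}) = at p within tree_sphere"
        using False by (intro at_within_nhd[of _ "- {z0}"]) auto
      ultimately show ?thesis by simp
    next
      case True
      \<comment> \<open>The reciprocal coordinate, with value 0 at z0; near z0 the function G is h
        composed with r.\<close>
      define r where "r p = (if p = z0 then 0 else 1 / \<phi> p)" for p
      have near: "cmod (r q) \<le> R * dist q z0" if "q \<in> S" "dist q z0 \<le> 1" for q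
        using norm_\<phi>_near[of q] that R by (simp add: r_def)
      have e1: "\<forall>\<^sub>F q in at z0 within tree_sphere. cmod (r q) \<le> R * dist q z0"
        unfolding eventually_at using near sub by (intro exI[of _ 1]) auto
      have "((\<lambda>q. R * dist q z0) \<longlongrightarrow> R * dist z0 z0) (at z0 within tree_sphere)"
        by (intro tendsto_intros)
      then have r0: "(r \<longlongrightarrow> 0) (at z0 within tree_sphere)"
        using e1 by (intro Lim_null_comparison[OF e1]) simp
      have opV: "\<forall>v. cmod v < 1 / 2 \<longrightarrow> v \<in> V"
      proof (intro allI impI)
        fix v :: complex assume v: "cmod v < 1 / 2"
        show "v \<in> V"
        proof (cases "v = 0")
          case False
          then have "cmod (1 / v) > 2" using v by (simp add: norm_divide field_simps)
          then show ?thesis using closed_box_norm[of "1 / v"] by (auto simp: V_def)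
        qed (simp add: V_def)
      qed
      have rV: "\<forall>\<^sub>F q in at z0 within tree_sphere. r q \<in> V"
        using tendstoD[OF r0, of "1/2"] by (rule eventually_mono) (use opV in auto)
      have ev: "\<forall>\<^sub>F q in at z0 within tree_sphere. q \<in> tree_sphere \<and> q \<noteq> z0 \<and> dist q z0 < 1"
        unfolding eventually_at by (intro exI[of _ 1]) auto
      have "((\<lambda>q. h (r q)) \<longlongrightarrow> h 0) (at z0 within tree_sphere)"
        by (rule continuous_on_tendsto_compose[OF h(1) r0 _ rV]) (simp add: V_def)
      moreover have "\<forall>\<^sub>F q in at z0 within tree_sphere. h (r q) = G q"
        using rV ev
      proof eventually_elim
        case (elim q)
        then have q: "q \<noteq> z0" "r q = 1 / \<phi> q" by (auto simp: r_def)
        obtain u where u: "u \<in> tree_dom" "q = \<psi> u" using elim q by (auto simp: tree_sphere_def)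
        \<comment> \<open>For u = 0 the convention 1 / 0 = 0 puts r q in V although u is in the box.
          This case is excluded because \<psi> 0 has distance 2 from z0.\<close>
        show ?case
        proof (cases "u = 0")
          case True
          then show ?thesis using dist_z0[of u] u elim by (simp add: wt_def)
        next
          case False
          then have "u \<notin> closed_box" using elim q u by (auto simp: V_def)
          then show ?thesis using g(3)[of u] q u by (simp add: G_def h0_def)
        qed
      qed
      ultimately have "(G \<longlongrightarrow> h 0) (at z0 within tree_sphere)" by (rule Lim_transform_eventually)
      then show ?thesis using True by (simp add: continuous_within G_def)
    qed
  qed
  ultimately show ?thesis by blast
qed

text \<open>In the plane |x - u| <= \<open>John_const\<close> * |x - v| for v outside the tree
  domain. In chordal distances the weight of x cancels, and \<kappa> compares the weights of u and
  v; at z = z0 this comparison alone gives the claim.\<close>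

lemma carrot_in_tree_sphere:
  assumes \<kappa>: "\<kappa> > 0" "\<forall>u\<in>tree_dom. \<forall>v\<in>closed_box. \<kappa> * wt R v \<le> wt R u"
    and z1: "z1 \<in> tree_sphere - {z0}"
  shows "\<exists>A. path_connected A \<and> z0 \<in> A \<and> z1 \<in> A \<and> A \<subseteq> tree_sphere \<and>
    (\<forall>z\<in>A. \<forall>b\<in>S - tree_sphere. \<kappa> / John_const * dist z z1 \<le> dist z b)"
proof -
  obtain u where u: "u \<in> tree_dom" "z1 = \<psi> u" using z1 by (auto simp: tree_sphere_def)
  obtain P m where P: "path_connected P" "u \<in> P" "P \<subseteq> tree_dom" "m \<noteq> 0" "(\<lambda>s. s *\<^sub>R m) ` {1..} \<subseteq> P"
    and Pb: "\<And>x. x\<in>P \<Longrightarrow> ball x (dist x u / John_const) \<subseteq> tree_dom"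
    using tree_dom_John[OF u(1)] by metis
  define A where "A = insert z0 (\<psi> ` P)"
  have John_const: "John_const \<ge> 1" using telescope_const_pos by (simp add: John_const_def)
  let ?ray = "insert z0 (\<psi> ` ((\<lambda>s. s *\<^sub>R m) ` {1..}))"
  have "\<psi> m \<in> ?ray" "m \<in> P" using P(5) by (auto intro!: image_eqI[of _ _ "m"] image_eqI[of m "\<lambda>s. s *\<^sub>R m" 1])
  then have "path_connected (?ray \<union> \<psi> ` P)"
    by (intro path_connected_Un[OF ray_to_pole[OF P(4)]] path_connected_continuous_image cont_\<psi> P(1)) blast
  moreover have "?ray \<union> \<psi> ` P = A" using P(5) by (auto simp: A_def)
  ultimately have pcA: "path_connected A" by simp
  have "\<kappa> / John_const * dist z z1 \<le> dist z b" if zA: "z \<in> A" and b: "b \<in> S - tree_sphere" for z b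
  proof -
    obtain v where v: "v \<notin> tree_dom" "b = \<psi> v" using b unfolding sphere_minus_tree by blast
    have vb: "v \<in> closed_box" using v(1) compl_tree_dom by blast
    have w: "\<kappa> * wt R v \<le> wt R u" using \<kappa>(2) u(1) vb by blast
    have pos: "wt R u > 0" "wt R v > 0" by (simp_all add: wt_pos)
    have inv: "\<kappa> / wt R u \<le> 1 / wt R v" using w pos by (simp add: field_simps)
    have uz: "dist z0 z1 = 2 / wt R u" "dist z0 b = 2 / wt R v"
      using dist_z0 u(2) v(2) by (simp_all add: dist_commute)
    consider "z = z0" | x where "x \<in> P" "z = \<psi> x" using zA by (auto simp: A_def)
    then show ?thesis
    proof cases
      case 1
      have "\<kappa> / John_const * dist z z1 = 2 / John_const * (\<kappa> / wt R u)" using 1 uz by simp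
      also have "\<dots> \<le> 2 / John_const * (1 / wt R v)" using inv John_const by (intro mult_left_mono) auto
      also have "\<dots> \<le> 2 * (1 / wt R v)" using John_const pos by (intro mult_right_mono) (auto simp: field_simps)
      finally show ?thesis using 1 uz by simp
    next
      case 2
      have "v \<notin> ball x (dist x u / John_const)" using Pb[OF 2(1)] v(1) by blast
      then have d: "cmod (x - u) / John_const \<le> cmod (x - v)" by (simp add: dist_norm)
      have wx: "wt R x > 0" by (rule wt_pos)
      have "\<kappa> / John_const * dist z z1 = 2 * R / wt R x * ((cmod (x - u) / John_const) * (\<kappa> / wt R u))"
        unfolding 2(2) u(2) dist_\<psi> by (simp add: mult_ac)
      also have "\<dots> \<le> 2 * R / wt R x * (cmod (x - v) * (1 / wt R v))"
        using d inv R wx \<kappa>(1) pos by (intro mult_left_mono mult_mono) auto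
      also have "\<dots> = dist z b" unfolding 2(2) v(2) dist_\<psi> by (simp add: mult_ac)
      finally show ?thesis .
    qed
  qed
  moreover have "z1 \<in> A" "A \<subseteq> tree_sphere" using u P(2,3) by (auto simp: A_def tree_sphere_def)
  ultimately show ?thesis using pcA by (intro exI[of _ A]) (auto simp: A_def)
qed

theorem tree_sphere_John:
  assumes \<kappa>: "\<kappa> > 0" "\<forall>u\<in>tree_dom. \<forall>v\<in>closed_box. \<kappa> * wt R v \<le> wt R u"
    and ne: "sphere_boundary tree_sphere \<noteq> {}"
  shows "John_domain (\<kappa> / John_const) tree_sphere" "simply_connected tree_sphere"
proof -
  note bd = sphere_boundary_openin[OF openin_tree_sphere]
  have bsub: "sphere_boundary tree_sphere \<subseteq> S - tree_sphere" using bd by blast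
  have conn: "path_component tree_sphere z0 z1" if z1: "z1 \<in> tree_sphere" for z1
  proof (cases "z1 = z0")
    case False
    then have "z1 \<in> tree_sphere - {z0}" using z1 by simp
    from carrot_in_tree_sphere[OF \<kappa> this]
    obtain A where A: "path_connected A" "z0 \<in> A" "z1 \<in> A" "A \<subseteq> tree_sphere" by blast
    then have "path_component A z0 z1" by (simp add: path_connected_component)
    then show ?thesis using A(4) by (rule path_component_of_subset[rotated])
  qed (simp add: path_component_refl tree_sphere_def)
  have "path_connected tree_sphere"
    unfolding path_connected_component using conn path_component_trans path_component_sym by meson
  then have con: "connected tree_sphere" by (rule path_connected_imp_connected)
  have dom: "sphere_domain tree_sphere"
    using openin_tree_sphere con ne by (simp add: sphere_domain_def)
  have "\<exists>\<gamma>. arc \<gamma> \<and> path_image \<gamma> \<subseteq> tree_sphere \<and> pathstart \<gamma> = z0 \<and> pathfinish \<gamma> = z1 \<and>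
        (\<forall>z \<in> path_image \<gamma>. infdist z (sphere_boundary tree_sphere) \<ge> \<kappa> / John_const * dist z z1)"
    if z1: "z1 \<in> tree_sphere - {z0}" for z1
  proof -
    from carrot_in_tree_sphere[OF \<kappa> z1]
    obtain A where A: "path_connected A" "z0 \<in> A" "z1 \<in> A" "A \<subseteq> tree_sphere"
      and est: "\<forall>z\<in>A. \<forall>b\<in>S - tree_sphere. \<kappa> / John_const * dist z z1 \<le> dist z b" by (elim exE conjE)
    obtain p where p: "path p" "path_image p \<subseteq> A" "pathstart p = z0" "pathfinish p = z1"
      using A(1-3) unfolding path_connected_def by blast
    have "z0 \<noteq> z1" using z1 by auto
    \<comment> \<open>The estimate holds at every point of A, so a path in A may be thinned to an
      arc.\<close>
    from path_contains_arc[OF p(1,3,4) this]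
    obtain q where q: "arc q" "path_image q \<subseteq> path_image p" "pathstart q = z0" "pathfinish q = z1" by blast
    have "\<kappa> / John_const * dist z z1 \<le> infdist z (sphere_boundary tree_sphere)" if z: "z \<in> path_image q" for z
    proof (rule le_infdist[OF ne])
      fix b assume "b \<in> sphere_boundary tree_sphere"
      then show "\<kappa> / John_const * dist z z1 \<le> dist z b" using est bsub z q(2) p(2) by blast
    qed
    then show ?thesis using q p(2) A(4) by (intro exI[of _ q]) blast
  qed
  then have "John_domain_center (\<kappa> / John_const) tree_sphere z0"
    unfolding John_domain_center_def using dom by (simp add: tree_sphere_def)
  then show "John_domain (\<kappa> / John_const) tree_sphere"
    unfolding John_domain_def by (intro bexI[of _ z0]) (auto simp: tree_sphere_def)
  obtain b where "b \<in> S - tree_sphere" using ne bsub by blast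
  then show "simply_connected tree_sphere"
    by (rule openin_sphere_simply_connected_log[OF openin_tree_sphere con]) (rule tree_sphere_log)
qed

end

section \<open>Reduction of a John domain to the planar picture\<close>

context sphere_chart
begin

definition hole :: "(complex \<times> real) set \<Rightarrow> complex set" where
  "hole \<Omega> = {u. \<psi> u \<notin> \<Omega>}"

lemma compact_hole:
  assumes "openin (top_of_set S) \<Omega>" "z0 \<in> \<Omega>"
  shows "compact (hole \<Omega>)"
proof -
  have "closedin (top_of_set S) (S - \<Omega>)" using closedin_diff[OF closedin_topspace assms(1)] by simp
  then have "closed (S - \<Omega>)" by (rule closedin_closed_trans) (simp add: riemann_sphere_def)
  then have "compact (S - \<Omega>)"
    unfolding compact_eq_bounded_closed by (auto simp: riemann_sphere_def intro: bounded_subset[OF bounded_sphere])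
  moreover have "continuous_on (S - \<Omega>) \<phi>" using assms(2) by (intro continuous_on_subset[OF cont_\<phi>]) auto
  ultimately have "compact (\<phi> ` (S - \<Omega>))" by (rule compact_continuous_image[rotated])
  moreover have "\<phi> ` (S - \<Omega>) = hole \<Omega>"
  proof (intro set_eqI iffI)
    fix u assume "u \<in> hole \<Omega>"
    then show "u \<in> \<phi> ` (S - \<Omega>)" using \<psi>_in[of u] by (intro image_eqI[of _ _ "\<psi> u"]) (auto simp: hole_def)
  next
    fix u assume "u \<in> \<phi> ` (S - \<Omega>)"
    then obtain p where p: "p \<in> S" "p \<notin> \<Omega>" "u = \<phi> p" by blast
    then have "\<psi> u = p" using \<psi>_\<phi>[of p] assms(2) by blast
    then show "u \<in> hole \<Omega>" using p by (simp add: hole_def)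
  qed
  ultimately show ?thesis by simp
qed

lemma boundary_hole:
  assumes "openin (top_of_set S) \<Omega>" "z0 \<in> \<Omega>"
  shows "sphere_boundary \<Omega> = \<psi> ` frontier (hole \<Omega>)"
proof -
  note bd = sphere_boundary_openin[OF assms(1)]
  have cl: "closed (hole \<Omega>)" using compact_hole[OF assms] compact_imp_closed by blast
  have fr: "frontier (hole \<Omega>) = hole \<Omega> \<inter> closure (- hole \<Omega>)"
    using cl by (simp add: frontier_closures closure_closed)
  have sub: "\<Omega> \<subseteq> S" using assms(1) openin_imp_subset by blast
  show ?thesis
  proof
    show "\<psi> ` frontier (hole \<Omega>) \<subseteq> sphere_boundary \<Omega>"
    proof
      fix b assume "b \<in> \<psi> ` frontier (hole \<Omega>)"
      then obtain k where k: "k \<in> hole \<Omega>" "k \<in> closure (- hole \<Omega>)" "b = \<psi> k" using fr by blast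
      have "\<psi> ` closure (- hole \<Omega>) \<subseteq> closure \<Omega>"
        by (rule image_closure_subset[OF cont_\<psi>]) (auto simp: hole_def intro: subsetD[OF closure_subset])
      then show "b \<in> sphere_boundary \<Omega>" using k bd by (auto simp: hole_def)
    qed
    show "sphere_boundary \<Omega> \<subseteq> \<psi> ` frontier (hole \<Omega>)"
    proof
      fix b assume "b \<in> sphere_boundary \<Omega>"
      then have b: "b \<in> closure \<Omega>" "b \<notin> \<Omega>" "b \<in> S - {z0}" using bd assms(2) by auto
      \<comment> \<open>Removing z0 from \<Omega> changes no closure point other than z0, and keeps
        the approximating sequence in the domain of \<phi>.\<close>
      have "closure \<Omega> = insert z0 (closure (\<Omega> - {z0}))" using assms(2) by (metis closure_insert insert_Diff)
      then have "b \<in> closure (\<Omega> - {z0})" using b by auto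
      then obtain x where x: "\<And>n. x n \<in> \<Omega> - {z0}" "x \<longlonglongrightarrow> b" unfolding closure_sequential by blast
      have "(\<lambda>n. \<phi> (x n)) \<longlonglongrightarrow> \<phi> b"
        using continuous_on_tendsto_compose[OF cont_\<phi> x(2) b(3)] x(1) sub by (auto intro: always_eventually)
      moreover have "\<phi> (x n) \<in> - hole \<Omega>" for n
      proof -
        have "\<psi> (\<phi> (x n)) = x n" using x(1)[of n] sub by (intro \<psi>_\<phi>) auto
        then show ?thesis using x(1)[of n] by (simp add: hole_def)
      qed
      ultimately have "\<phi> b \<in> closure (- hole \<Omega>)"
        unfolding closure_sequential by (intro exI[of _ "\<lambda>n. \<phi> (x n)"]) simp
      moreover have "\<psi> (\<phi> b) = b" using b(3) by (rule \<psi>_\<phi>)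
      ultimately show "b \<in> \<psi> ` frontier (hole \<Omega>)" using b(2) fr
        by (intro image_eqI[of _ _ "\<phi> b"]) (auto simp: hole_def)
    qed
  qed
qed

end

text \<open>A small step away from the origin leaves K. It supplies the boundary point of largest
  weight, with which all other weights are compared.\<close>

lemma max_norm_frontier:
  fixes K :: "complex set"
  assumes "k \<in> K" "\<And>x. x \<in> K \<Longrightarrow> cmod x \<le> cmod k"
  shows "k \<in> frontier K"
proof -
  have "k \<notin> interior K"
  proof
    assume "k \<in> interior K"
    then obtain e where e: "e > 0" "ball k e \<subseteq> K" unfolding mem_interior by blast
    define v where "v = (if k = 0 then 1 else sgn k)"
    have v: "cmod v = 1" by (simp add: v_def norm_sgn)
    have "k + (e / 2) *\<^sub>R v \<in> ball k e" using e v by (simp add: dist_norm)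
    moreover have "cmod (k + (e / 2) *\<^sub>R v) = cmod k + e / 2"
    proof (cases "k = 0")
      case True
      then show ?thesis using e v by simp
    next
      case False
      then have "k + (e / 2) *\<^sub>R v = (cmod k + e / 2) *\<^sub>R v" by (simp add: v_def sgn_div_norm algebra_simps)
      then show ?thesis using e v by simp
    qed
    ultimately show False using assms(2)[of "k + (e / 2) *\<^sub>R v"] e by auto
  qed
  then show ?thesis using assms(1) closure_subset[of K] by (auto simp: frontier_def)
qed

context sphere_chart
begin

text \<open>The weight of \<open>u\<close> is the inverse of half the distance from \<open>\<psi> u\<close> to the centre, so this is the John
  inequality at the initial point \<open>z0\<close> of the arc to \<open>\<psi> u\<close>.\<close>

lemma John_weight_lower:
  assumes J: "John_domain_center \<epsilon> \<Omega> z0" and \<epsilon>: "\<epsilon> > 0" and k: "k \<in> frontier (hole \<Omega>)"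
    and u: "u \<in> closure (- hole \<Omega>)"
  shows "\<epsilon> * wt R k \<le> wt R u"
proof -
  have op: "openin (top_of_set S) \<Omega>" and z0\<Omega>: "z0 \<in> \<Omega>"
    using J by (auto simp: John_domain_center_def sphere_domain_def)
  have "\<epsilon> * wt R k \<le> wt R u" if u: "u \<notin> hole \<Omega>" for u
  proof -
    have "\<psi> u \<in> \<Omega> - {z0}" using u \<psi>_in by (auto simp: hole_def)
    then obtain \<gamma> where "pathstart \<gamma> = z0"
      "\<forall>z \<in> path_image \<gamma>. infdist z (sphere_boundary \<Omega>) \<ge> \<epsilon> * dist z (\<psi> u)"
      using J unfolding John_domain_center_def by blast
    then have "\<epsilon> * dist z0 (\<psi> u) \<le> infdist z0 (sphere_boundary \<Omega>)"
      using pathstart_in_path_image[of \<gamma>] by auto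
    also have "\<dots> \<le> dist z0 (\<psi> k)" using boundary_hole[OF op z0\<Omega>] k by (intro infdist_le) auto
    finally have "\<epsilon> * (2 / wt R u) \<le> 2 / wt R k" using dist_z0 by (simp add: dist_commute)
    then show ?thesis using wt_pos[of R u] wt_pos[of R k] by (simp add: field_simps)
  qed
  then have "- hole \<Omega> \<subseteq> {u. \<epsilon> * wt R k \<le> wt R u}" by blast
  moreover have "closed {u. \<epsilon> * wt R k \<le> wt R u}"
    unfolding wt_def by (intro closed_Collect_le continuous_intros)
  ultimately show ?thesis using closure_minimal u by blast
qed

text \<open>G is the John arc without z0, seen in the chart. The weight of x cancels from the John
  inequality, leaving the weight of u and that of a frontier point, which c bounds from
  below.\<close>

lemma John_escape:
  assumes J: "John_domain_center \<epsilon> \<Omega> z0" and \<epsilon>: "\<epsilon> > 0"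
    and c: "c > 0" "\<And>x. x \<in> frontier (hole \<Omega>) \<Longrightarrow> c \<le> wt R x"
    and u: "u \<notin> hole \<Omega>"
  shows "\<exists>G. connected G \<and> u \<in> G \<and> \<not> G \<subseteq> closed_box \<and>
    (\<forall>x\<in>G. dist x u \<le> wt R u / (\<epsilon> * c) * infdist x (hole \<Omega>))"
proof -
  have op: "openin (top_of_set S) \<Omega>" and z0\<Omega>: "z0 \<in> \<Omega>" and ne: "sphere_boundary \<Omega> \<noteq> {}"
    using J by (auto simp: John_domain_center_def sphere_domain_def)
  have sub: "\<Omega> \<subseteq> S" using op openin_imp_subset by blast
  have clK: "closed (hole \<Omega>)" using compact_hole[OF op z0\<Omega>] compact_imp_closed by blast
  have Kne: "hole \<Omega> \<noteq> {}" using ne boundary_hole[OF op z0\<Omega>] by auto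
  have "\<psi> u \<in> \<Omega> - {z0}" using u \<psi>_in by (auto simp: hole_def)
  then obtain \<gamma> where \<gamma>: "arc \<gamma>" "path_image \<gamma> \<subseteq> \<Omega>" "pathstart \<gamma> = z0" "pathfinish \<gamma> = \<psi> u"
    "\<forall>z \<in> path_image \<gamma>. infdist z (sphere_boundary \<Omega>) \<ge> \<epsilon> * dist z (\<psi> u)"
    using J unfolding John_domain_center_def by blast
  have inj: "inj_on \<gamma> {0..1}" and cont: "continuous_on {0..1} \<gamma>"
    using \<gamma>(1) by (auto simp: arc_def path_def)
  have nz: "\<gamma> t \<in> S - {z0}" if "t \<in> {0<..1}" for t
  proof -
    have "\<gamma> t \<noteq> \<gamma> 0" using inj_onD[OF inj, of t 0] that by auto
    moreover have "\<gamma> t \<in> path_image \<gamma>" using that by (auto simp: path_image_def)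
    ultimately show ?thesis using \<gamma>(2,3) sub by (auto simp: pathstart_def)
  qed
  define G where "G = (\<lambda>t. \<phi> (\<gamma> t)) ` {0<..1}"
  have c01: "continuous_on {0<..1} \<gamma>" by (rule continuous_on_subset[OF cont]) auto
  have "continuous_on {0<..1} (\<lambda>t. \<phi> (\<gamma> t))"
    by (rule continuous_on_compose2[OF cont_\<phi> c01]) (use nz in blast)
  then have "connected G" unfolding G_def by (rule connected_continuous_image) (simp add: is_interval_connected)
  moreover have "u \<in> G" unfolding G_def
    using \<gamma>(4) by (intro image_eqI[of _ _ 1]) (auto simp: pathfinish_def)
  \<comment> \<open>The image of the box is closed and misses z0, whereas the arc tends to z0 as t
    tends to 0.\<close>
  moreover have "\<not> G \<subseteq> closed_box"
  proof
    assume GB: "G \<subseteq> closed_box"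
    have "compact closed_box" using closed_closed_box closed_box_norm by (auto simp: compact_eq_bounded_closed bounded_iff)
    then have "closed (\<psi> ` closed_box)" by (intro compact_imp_closed compact_continuous_image cont_\<psi>)
    moreover have "\<gamma> ` {0<..1} \<subseteq> \<psi> ` closed_box"
    proof
      fix p assume "p \<in> \<gamma> ` {0<..1}"
      then obtain t where t: "t \<in> {0<..1}" "p = \<gamma> t" by blast
      then have "\<psi> (\<phi> p) = p" "\<phi> p \<in> closed_box" using nz GB \<psi>_\<phi> by (auto simp: G_def)
      then show "p \<in> \<psi> ` closed_box" by (metis imageI)
    qed
    moreover have cl: "closure {0<..1::real} = {0..1}" by simp
    ultimately have "\<gamma> ` {0..1} \<subseteq> \<psi> ` closed_box"
      using image_closure_subset[of "{0<..1}" \<gamma> "\<psi> ` closed_box"] cont by simp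
    then have "z0 \<in> \<psi> ` closed_box" using \<gamma>(3) by (auto simp: pathstart_def)
    then show False using \<psi>_in by blast
  qed
  moreover have "dist x u \<le> wt R u / (\<epsilon> * c) * infdist x (hole \<Omega>)" if x: "x \<in> G" for x
  proof -
    obtain t where t: "t \<in> {0<..1}" "x = \<phi> (\<gamma> t)" using x by (auto simp: G_def)
    have \<psi>x: "\<psi> x = \<gamma> t" using \<psi>_\<phi>[OF nz[OF t(1)]] t(2) by simp
    have im: "\<gamma> t \<in> path_image \<gamma>" using t(1) by (auto simp: path_image_def)
    have xK: "x \<notin> hole \<Omega>" using \<psi>x im \<gamma>(2) by (auto simp: hole_def)
    obtain k where k: "k \<in> hole \<Omega>" "infdist x (hole \<Omega>) = dist x k"
      using infdist_attains_inf[OF clK Kne] by blast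
    \<comment> \<open>The John inequality speaks of the boundary, \<open>infdist\<close> of the
      whole hole; the segment to the nearest point k crosses the frontier no farther away than
      k.\<close>
    have "closed_segment x k \<inter> frontier (hole \<Omega>) \<noteq> {}"
      using k(1) xK by (intro connected_Int_frontier) auto
    then obtain y where y: "y \<in> closed_segment x k" "y \<in> frontier (hole \<Omega>)" by blast
    have xy: "dist x y \<le> infdist x (hole \<Omega>)" using segment_bound(1)[OF y(1)] k(2) by (simp add: dist_norm norm_minus_commute)
    have "\<epsilon> * dist (\<psi> x) (\<psi> u) \<le> infdist (\<psi> x) (sphere_boundary \<Omega>)" using \<gamma>(5) im \<psi>x by simp
    also have "\<dots> \<le> dist (\<psi> x) (\<psi> y)" using boundary_hole[OF op z0\<Omega>] y(2) by (intro infdist_le) auto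
    finally have "\<epsilon> * (2 * R * cmod (x - u) / (wt R x * wt R u)) \<le> 2 * R * cmod (x - y) / (wt R x * wt R y)"
      by (simp only: dist_\<psi>)
    then have "2 * R / wt R x * (\<epsilon> * (cmod (x - u) / wt R u)) \<le> 2 * R / wt R x * (cmod (x - y) / wt R y)"
      by (simp add: mult_ac)
    then have "\<epsilon> * (cmod (x - u) / wt R u) \<le> cmod (x - y) / wt R y"
      using R wt_pos[of R x] by (subst (asm) mult_le_cancel_left_pos) auto
    also have "\<dots> \<le> cmod (x - y) / c" using c y(2) by (intro divide_left_mono mult_pos_pos wt_pos) auto
    also have "\<dots> \<le> infdist x (hole \<Omega>) / c" using xy c(1) by (intro divide_right_mono) (auto simp: dist_norm)
    finally show ?thesis using \<epsilon> c(1) wt_pos[of R u] by (simp add: dist_norm field_simps)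
  qed
  ultimately show ?thesis by blast
qed

end

theorem theorem2:
  shows "\<forall>\<epsilon>::real. \<epsilon> > 0 \<longrightarrow> (\<exists>c::real. c > 0 \<and>
    (\<forall>\<Omega>. John_domain \<epsilon> \<Omega> \<longrightarrow>
      (\<exists>\<Omega>'. John_domain c \<Omega>' \<and> simply_connected \<Omega>' \<and>
            sphere_boundary \<Omega> \<subseteq> sphere_boundary \<Omega>')))"
proof (intro allI impI)
  fix \<epsilon> :: real assume \<epsilon>: "\<epsilon> > 0"
  \<comment> \<open>5 / \<epsilon>^2 bounds the factor in \<open>John_escape\<close>, where the
    weight of u is at most 5 * \<open>wt R k\<close> and c is \<epsilon> *
    \<open>wt R k\<close>.\<close>
  define M where "M = 1 + 5 / \<epsilon>^2"
  have M1: "M \<ge> 1" by (simp add: M_def)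
  \<comment> \<open>Outside its locale \<open>John_const\<close> is a function of M alone, so c
    depends only on \<epsilon>. The factor \<epsilon> / 5 is the comparison of weights.\<close>
  define c where "c = \<epsilon> / 5 / planar_John.John_const M"
  have main: "\<exists>\<Omega>'. John_domain c \<Omega>' \<and> simply_connected \<Omega>' \<and> sphere_boundary \<Omega> \<subseteq> sphere_boundary \<Omega>' \<and> c > 0"
    if JD: "John_domain \<epsilon> \<Omega>" for \<Omega>
  proof -
    obtain z0 where J: "John_domain_center \<epsilon> \<Omega> z0" using JD unfolding John_domain_def by blast
    have op: "openin (top_of_set riemann_sphere) \<Omega>" and z0\<Omega>: "z0 \<in> \<Omega>" and ne: "sphere_boundary \<Omega> \<noteq> {}"
      using J by (auto simp: John_domain_center_def sphere_domain_def)
    have z0S: "z0 \<in> riemann_sphere" using op z0\<Omega> openin_imp_subset by blast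
    obtain \<psi> where \<psi>: "\<And>R. R > 0 \<Longrightarrow> sphere_chart z0 R (\<lambda>u. \<psi> (R *\<^sub>R u))"
      using chart_exists[OF z0S] by blast
    interpret c1: sphere_chart z0 1 "\<lambda>u. \<psi> (1 *\<^sub>R u)" by (rule \<psi>) simp
    define K0 where "K0 = c1.hole \<Omega>"
    have K0: "compact K0" "K0 \<noteq> {}"
      using c1.compact_hole[OF op z0\<Omega>] c1.boundary_hole[OF op z0\<Omega>] ne by (auto simp: K0_def)
    obtain k0 where k0: "k0 \<in> K0" "\<And>x. x \<in> K0 \<Longrightarrow> cmod x \<le> cmod k0"
      using continuous_attains_sup[OF K0, of cmod] continuous_on_norm_id by blast
    \<comment> \<open>R > 2 |k0| shrinks the hole into the disc of radius 1/2. The weight at k0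
      instead of |k0| keeps R positive when k0 = 0 and ties the weights on the box to that of
      k.\<close>
    define R where "R = 2 * wt 1 k0"
    have R: "R > 0" using wt_pos[of 1 k0] by (simp add: R_def)
    interpret ch: sphere_chart z0 R "\<lambda>u. \<psi> (R *\<^sub>R u)" by (rule \<psi>[OF R])
    define K where "K = ch.hole \<Omega>"
    define k where "k = k0 /\<^sub>R R"
    have KK: "x \<in> K \<longleftrightarrow> R *\<^sub>R x \<in> K0" for x unfolding K_def K0_def c1.hole_def ch.hole_def by simp
    have kK: "k \<in> K" using k0(1) R by (simp add: KK k_def)
    have kmax: "cmod x \<le> cmod k" if "x \<in> K" for x
    proof -
      have "R * cmod x \<le> cmod k0" using k0(2)[of "R *\<^sub>R x"] that KK R by simp
      then show ?thesis using R by (simp add: k_def field_simps)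
    qed
    have wk: "wt R k = wt 1 k0" using R by (simp add: wt_def k_def)
    have "cmod k0 < wt 1 k0" unfolding wt_def by (simp add: real_less_rsqrt)
    then have k12: "cmod k < 1 / 2" using R by (simp add: k_def R_def field_simps)
    have kfr: "k \<in> frontier K" by (rule max_norm_frontier[OF kK kmax])
    have lower: "\<epsilon> * wt R k \<le> wt R u" if "u \<in> closure (- K)" for u
      using ch.John_weight_lower[OF J \<epsilon>] kfr that by (simp add: K_def)
    \<comment> \<open>With w = \<open>wt R k\<close>: R |v| <= 2 R = 4 w and 1 + 16 w^2 <= 25
      w^2.\<close>
    have upper: "wt R v \<le> 5 * wt R k" if "v \<in> closed_box" for v
    proof -
      have w1: "wt R k \<ge> 1" by (rule wt_ge_1)
      have "R * cmod v \<le> R * 2" using closed_box_norm[OF that] R by (intro mult_left_mono) auto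
      then have "R * cmod v \<le> 4 * wt R k" unfolding wk by (simp add: R_def)
      then have "(R * cmod v)^2 \<le> (4 * wt R k)^2" using R by (intro power_mono) auto
      moreover have "1 \<le> (wt R k)^2" using w1 by (simp add: one_le_power)
      ultimately have "1 + (R * cmod v)^2 \<le> (5 * wt R k)^2" by (simp add: power_mult_distrib)
      then show ?thesis unfolding wt_def[of R v] using w1 by (intro real_le_lsqrt) auto
    qed
    have cK: "compact K" using ch.compact_hole[OF op z0\<Omega>] by (simp add: K_def)
    interpret t: John_tree z0 R "\<lambda>u. \<psi> (R *\<^sub>R u)" K M
    proof
      show "compact K" by (rule cK)
      show "K \<noteq> {}" using kK by blast
      show "K \<subseteq> ball 0 (1/2)" using kmax k12 by force
      show "M \<ge> 1" by (rule M1)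
      fix u assume u: "u \<in> closed_box" "u \<notin> K"
      have pos: "\<epsilon> * wt R k > 0" using \<epsilon> wt_pos[of R k] by simp
      have fr: "\<epsilon> * wt R k \<le> wt R x" if "x \<in> frontier (ch.hole \<Omega>)" for x
        using that by (intro lower) (auto simp: K_def frontier_closures)
      obtain G where G: "connected G" "u \<in> G" "\<not> G \<subseteq> closed_box"
        "\<forall>x\<in>G. dist x u \<le> wt R u / (\<epsilon> * (\<epsilon> * wt R k)) * infdist x K"
        using ch.John_escape[OF J \<epsilon> pos fr, of u] u(2) unfolding K_def by blast
      have "wt R u / (\<epsilon> * (\<epsilon> * wt R k)) \<le> 5 * wt R k / (\<epsilon> * (\<epsilon> * wt R k))"
        using upper[OF u(1)] \<epsilon> wt_pos[of R k] by (intro divide_right_mono) auto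
      also have "\<dots> \<le> M" using \<epsilon> wt_pos[of R k] by (simp add: M_def power2_eq_square)
      finally have "wt R u / (\<epsilon> * (\<epsilon> * wt R k)) * infdist x K \<le> M * infdist x K" for x
        by (rule mult_right_mono) (rule infdist_nonneg)
      then show "\<exists>G. connected G \<and> u \<in> G \<and> \<not> G \<subseteq> closed_box \<and> (\<forall>x\<in>G. dist x u \<le> M * infdist x K)"
        using G by (intro exI[of _ G]) (meson order_trans)
    qed
    have cpos: "c > 0" using \<epsilon> t.telescope_const_pos by (simp add: c_def t.John_const_def)
    have sub: "t.tree_sphere \<subseteq> \<Omega>"
    proof -
      have "\<psi> (R *\<^sub>R u) \<in> \<Omega>" if "u \<notin> K" for u using that unfolding K_def ch.hole_def by simp
      then show ?thesis unfolding t.tree_sphere_def using z0\<Omega> t.tree_dom_not_K by blast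
    qed
    have bsub: "sphere_boundary \<Omega> \<subseteq> sphere_boundary t.tree_sphere"
    proof
      fix b assume "b \<in> sphere_boundary \<Omega>"
      then obtain x where x: "x \<in> frontier K" "b = \<psi> (R *\<^sub>R x)"
        using ch.boundary_hole[OF op z0\<Omega>] by (auto simp: K_def)
      have "x \<in> closure t.tree_dom" using t.frontier_K_subset x(1) by blast
      moreover have "(\<lambda>u. \<psi> (R *\<^sub>R u)) ` closure t.tree_dom \<subseteq> closure t.tree_sphere"
        by (rule image_closure_subset[OF ch.cont_\<psi>])
           (auto simp: t.tree_sphere_def intro: subsetD[OF closure_subset])
      ultimately have "b \<in> closure t.tree_sphere" using x(2) by blast
      moreover have "b \<notin> \<Omega>" using \<open>b \<in> sphere_boundary \<Omega>\<close> sphere_boundary_openin[OF op] by blast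
      ultimately show "b \<in> sphere_boundary t.tree_sphere"
        using sphere_boundary_openin[OF t.openin_tree_sphere] sub by blast
    qed
    have \<kappa>: "\<epsilon> / 5 > 0" "\<forall>u\<in>t.tree_dom. \<forall>v\<in>closed_box. \<epsilon> / 5 * wt R v \<le> wt R u"
    proof -
      show "\<epsilon> / 5 > 0" using \<epsilon> by simp
      show "\<forall>u\<in>t.tree_dom. \<forall>v\<in>closed_box. \<epsilon> / 5 * wt R v \<le> wt R u"
      proof (intro ballI)
        fix u v assume u: "u \<in> t.tree_dom" and v: "v \<in> closed_box"
        have "\<epsilon> / 5 * wt R v \<le> \<epsilon> / 5 * (5 * wt R k)" using upper[OF v] \<epsilon> by (intro mult_left_mono) auto
        also have "\<dots> = \<epsilon> * wt R k" by simp
        also have "\<dots> \<le> wt R u" using t.tree_dom_not_K u closure_subset[of "- K"] by (intro lower) auto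
        finally show "\<epsilon> / 5 * wt R v \<le> wt R u" .
      qed
    qed
    have "sphere_boundary t.tree_sphere \<noteq> {}" using bsub ne by blast
    from t.tree_sphere_John[OF \<kappa> this] show ?thesis
      using bsub cpos unfolding c_def by blast
  qed
  show "\<exists>c>0. \<forall>\<Omega>. John_domain \<epsilon> \<Omega> \<longrightarrow> (\<exists>\<Omega>'. John_domain c \<Omega>' \<and> simply_connected \<Omega>' \<and>
            sphere_boundary \<Omega> \<subseteq> sphere_boundary \<Omega>')"
  \<comment> \<open>Positivity of c was derived inside an instance of the locale, which takes a John
    domain to build; without one any constant will do.\<close>
  proof (cases "\<exists>\<Omega>. John_domain \<epsilon> \<Omega>")
    case True
    then have "c > 0" using main by blast
    then show ?thesis using main by blast
  next
    case False
    then show ?thesis by (intro exI[of _ 1]) auto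
  qed
qed

end
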